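(* The ISR property is not preserved under W$^*$-equivalence: there exist two countable discrete groups $G$ and $H$ such that $L(G)\cong L(H)$ (as von Neumann algebras), but exactly one of the groups $G$ and $H$ has the ISR property.
   Context: For a countable discrete group $G$, $L(G)\subseteq B(\ell^2(G))$ denotes the group von Neumann algebra, i.e. the von Neumann algebra generated by the left regular representation unitaries $u_g$, $g\in G$ ($u_g\delta_h=\delta_{gh}$). For a subgroup $H\le G$, $L(H)$ is identified with the von Neumann subalgebra of $L(G)$ generated by $\{u_h:h\in H\}$. Von Neumann subalgebras are unital, i.e. contain the identity of $L(G)$. A von Neumann subalgebra $P\subseteq L(G)$ is called invariant if $u_gPu_g^{*}=P$ for all $g\in G$. The group $G$ has the invariant von Neumann subalgebras rigidity (ISR) property if every invariant von Neumann subalgebra $P\subseteq L(G)$ is of the form $P=L(N)$ for some normal subgroup $N\lhd G$. Two groups $G,H$ are W$^*$-equivalent if $L(G)\cong L(H)$. *)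

theory Defs
  imports "HOL-Analysis.Infinite_Sum" "HOL-Library.FuncSet" "HOL-Algebra.Coset"
begin

text \<open>Vectors are functions on the whole type that vanish outside the index set. In this way
  a group given by its carrier set has a Hilbert space, without a type for each group.\<close>

definition ell2 :: "'a set \<Rightarrow> ('a \<Rightarrow> complex) set" where
  "ell2 X = {f. (\<forall>x. x \<notin> X \<longrightarrow> f x = 0) \<and> (\<lambda>x. (cmod (f x))\<^sup>2) summable_on X}"

definition ell2_inner :: "'a set \<Rightarrow> ('a \<Rightarrow> complex) \<Rightarrow> ('a \<Rightarrow> complex) \<Rightarrow> complex" where
  "ell2_inner X f g = (\<Sum>\<^sub>\<infinity>x\<in>X. f x * cnj (g x))"

definition ell2_norm :: "'a set \<Rightarrow> ('a \<Rightarrow> complex) \<Rightarrow> real" where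
  "ell2_norm X f = sqrt (\<Sum>\<^sub>\<infinity>x\<in>X. (cmod (f x))\<^sup>2)"

type_synonym 'a oper = "('a \<Rightarrow> complex) \<Rightarrow> ('a \<Rightarrow> complex)"

text \<open>Operators are extensional functions on \<^term>\<open>ell2 X\<close>, so that equality in HOL is equality
  of operators; \<^term>\<open>compose (ell2 X) S T\<close> is their product.\<close>

definition bounded_ops :: "'a set \<Rightarrow> 'a oper set" where
  "bounded_ops X = {T \<in> ell2 X \<rightarrow>\<^sub>E ell2 X.
     (\<forall>f\<in>ell2 X. \<forall>g\<in>ell2 X. T (\<lambda>x. f x + g x) = (\<lambda>x. T f x + T g x)) \<and>
     (\<forall>c. \<forall>f\<in>ell2 X. T (\<lambda>x. c * f x) = (\<lambda>x. c * T f x)) \<and>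
     (\<exists>K. \<forall>f\<in>ell2 X. ell2_norm X (T f) \<le> K * ell2_norm X f)}"

definition op_add :: "'a set \<Rightarrow> 'a oper \<Rightarrow> 'a oper \<Rightarrow> 'a oper" where
  "op_add X S T = (\<lambda>f\<in>ell2 X. \<lambda>x. S f x + T f x)"

definition op_scale :: "'a set \<Rightarrow> complex \<Rightarrow> 'a oper \<Rightarrow> 'a oper" where
  "op_scale X c T = (\<lambda>f\<in>ell2 X. \<lambda>x. c * T f x)"

definition op_adj :: "'a set \<Rightarrow> 'a oper \<Rightarrow> 'a oper" where
  "op_adj X T = (THE S. S \<in> bounded_ops X \<and>
     (\<forall>f\<in>ell2 X. \<forall>g\<in>ell2 X. ell2_inner X (T f) g = ell2_inner X f (S g)))"

definition commutant :: "'a set \<Rightarrow> 'a oper set \<Rightarrow> 'a oper set" where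
  "commutant X M =
     {T \<in> bounded_ops X. \<forall>S\<in>M. compose (ell2 X) T S = compose (ell2 X) S T}"

text \<open>A commutant is an algebra that contains the identity operator, so the last condition
  makes \<open>M\<close> a unital subalgebra, with the unit of the algebra of all bounded operators.\<close>

definition von_neumann_algebra :: "'a set \<Rightarrow> 'a oper set \<Rightarrow> bool" where
  "von_neumann_algebra X M \<longleftrightarrow>
     M \<subseteq> bounded_ops X \<and> (\<forall>T\<in>M. op_adj X T \<in> M) \<and> commutant X (commutant X M) = M"

definition vn_generated :: "'a set \<Rightarrow> 'a oper set \<Rightarrow> 'a oper set" where
  "vn_generated X S = \<Inter>{M. von_neumann_algebra X M \<and> S \<subseteq> M}"

text \<open>Normality is not required: a \<open>*\<close>-isomorphism between von Neumann algebras is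
  automatically normal.\<close>

definition vn_isomorphism ::
    "'a set \<Rightarrow> 'a oper set \<Rightarrow> 'b set \<Rightarrow> 'b oper set \<Rightarrow> ('a oper \<Rightarrow> 'b oper) \<Rightarrow> bool" where
  "vn_isomorphism X M Y N \<phi> \<longleftrightarrow>
     bij_betw \<phi> M N \<and>
     (\<forall>S\<in>M. \<forall>T\<in>M. \<phi> (op_add X S T) = op_add Y (\<phi> S) (\<phi> T)) \<and>
     (\<forall>c. \<forall>T\<in>M. \<phi> (op_scale X c T) = op_scale Y c (\<phi> T)) \<and>
     (\<forall>S\<in>M. \<forall>T\<in>M. \<phi> (compose (ell2 X) S T) = compose (ell2 Y) (\<phi> S) (\<phi> T)) \<and>
     (\<forall>T\<in>M. \<phi> (op_adj X T) = op_adj Y (\<phi> T))"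

text \<open>On basis vectors this is \<open>u\<^sub>g \<delta>\<^sub>h = \<delta>\<^sub>g\<^sub>h\<close>.\<close>

definition left_reg :: "('a, 'm) monoid_scheme \<Rightarrow> 'a \<Rightarrow> 'a oper" where
  "left_reg G g = (\<lambda>f\<in>ell2 (carrier G). \<lambda>x.
     if x \<in> carrier G then f (inv\<^bsub>G\<^esub> g \<otimes>\<^bsub>G\<^esub> x) else 0)"

text \<open>For a subgroup \<open>H\<close>, its von Neumann algebra as a subalgebra of that of \<open>G\<close>.\<close>

definition vn_of_subgroup :: "('a, 'm) monoid_scheme \<Rightarrow> 'a set \<Rightarrow> 'a oper set" where
  "vn_of_subgroup G H = vn_generated (carrier G) (left_reg G ` H)"

definition group_vn :: "('a, 'm) monoid_scheme \<Rightarrow> 'a oper set" where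
  "group_vn G = vn_of_subgroup G (carrier G)"

definition conj_by :: "('a, 'm) monoid_scheme \<Rightarrow> 'a \<Rightarrow> 'a oper \<Rightarrow> 'a oper" where
  "conj_by G g T = compose (ell2 (carrier G)) (left_reg G g)
     (compose (ell2 (carrier G)) T (op_adj (carrier G) (left_reg G g)))"

definition invariant_subalgebra :: "('a, 'm) monoid_scheme \<Rightarrow> 'a oper set \<Rightarrow> bool" where
  "invariant_subalgebra G P \<longleftrightarrow>
     von_neumann_algebra (carrier G) P \<and> P \<subseteq> group_vn G \<and>
     (\<forall>g\<in>carrier G. conj_by G g ` P = P)"

definition ISR :: "('a, 'm) monoid_scheme \<Rightarrow> bool" where
  "ISR G \<longleftrightarrow> (\<forall>P. invariant_subalgebra G P \<longrightarrow> (\<exists>N. N \<lhd> G \<and> P = vn_of_subgroup G N))"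

definition Wstar_equivalent :: "('a, 'm) monoid_scheme \<Rightarrow> ('b, 'n) monoid_scheme \<Rightarrow> bool" where
  "Wstar_equivalent G H \<longleftrightarrow>
     (\<exists>\<phi>. vn_isomorphism (carrier G) (group_vn G) (carrier H) (group_vn H) \<phi>)"

end

theory Submission
  imports Defs "HOL-Analysis.Inner_Product" "HOL-Analysis.Elementary_Normed_Spaces"
    "HOL-Library.Poly_Mapping" "HOL-Library.Z2" "HOL-Library.Function_Algebras"
begin

text \<open>Let \<open>G\<close> be the group of finitary invertible matrices over the field with two elements
  generated by transvections, and let \<open>H\<close> be its subgroup of matrices whose first two rows are
  trivial, a semidirect product of two copies of the natural module with \<open>G\<close>.

  Both groups are increasing unions of one and the same sequence of finite groups, along different
  embeddings. Each of these finite groups \<open>T\<close> normalizes, inside the next one, an abelian group of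
  block matrices, and acts almost freely on its characters. This gives a projection \<open>p\<close> with
  \<open>p u\<^sub>k p = 0\<close> for \<open>k \<noteq> 1\<close> in \<open>T\<close> whose conjugates under \<open>T\<close> almost sum to \<open>1\<close>, so that almost
  every permutation of the set \<open>T\<close> is implemented by a unitary of the group ring. Two embeddings of
  a finite group in \<open>T\<close> differ by such a permutation, hence are almost unitarily conjugate, and an
  intertwining argument in the 2-norm produces \<open>L(G) \<cong> L(H)\<close>.

  \<open>H\<close> fails the ISR property: exchanging the two rows commutes with the conjugation action on the
  abelian normal subgroup, and the sums \<open>u\<^sub>h + u\<^bsub>h'\<^esub>\<close> over exchanged pairs generate an invariant algebra
  that is not of the form \<open>L(N)\<close>.

  For \<open>G\<close>, let \<open>P\<close> be invariant and \<open>s\<close> an elementary transvection. The centralizer of \<open>s\<close> has no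
  finite orbits except \<open>{1}\<close> and \<open>{s}\<close>, hence either \<open>u\<^sub>s \<in> P\<close>, and then \<open>P = L(G)\<close>, or the elements
  of \<open>P\<close> have no coefficient at transvections. In the second case the coefficient of
  \<open>x \<sigma> x\<^sup>* \<sigma>\<^sup>-\<^sup>1\<close> at the commutator of \<open>h\<close> and a far away transvection \<open>\<sigma>\<close> is nearly at least
  \<open>|x(h)|\<^sup>2\<close>, and so \<open>x\<close> is a scalar.\<close>
section \<open>The Hilbert space of square-summable functions\<close>

text \<open>Both groups are locally finite with infinite conjugacy classes, so both algebras are the
  hyperfinite II_1 factor; the intertwining argument takes the place of the Murray-von Neumann
  uniqueness theorem. It works because left multiplication through any embedding is a free action,
  and free actions of a finite group on the set \<open>T\<close> differ by a permutation. The link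
  between the towers is a permutation of coordinates: a matrix supported below \<open>s\<close> has
  trivial rows \<open>s\<close> and \<open>s + 1\<close>, and after exchanging these with 0 and 1 it
  belongs to the subgroup. The obstacle is that this permutation depends on \<open>s\<close>, so the
  embeddings of successive stages disagree; the almost conjugating unitaries repair this, with
  squared 2-norm errors \<open>(1/4) ^ n\<close> to make the norm errors summable. Over the field
  with two elements transvections are involutions and the characters in question are real, so real
  group rings suffice. Two rows rather than one are used because a single copy of the module has no
  nontrivial automorphism that commutes with the group, whereas two copies can be exchanged.\<close>

typedef 'a l2 = "{f :: 'a \<Rightarrow> complex. (\<lambda>x. (cmod (f x))\<^sup>2) summable_on UNIV}"
  morphisms coord Abs_l2
  by (rule exI[of _ "\<lambda>_. 0"]) simp

setup_lifting type_definition_l2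

lemma coord_summable: "(\<lambda>x. (cmod (coord a x))\<^sup>2) summable_on UNIV"
  using coord[of a] by simp

lemma l2_eqI: "(\<And>x. coord a x = coord b x) \<Longrightarrow> a = b"
  by (simp add: coord_inject[symmetric] fun_eq_iff)

lemma abs_summable_mult_of_squares:
  fixes f g :: "'a \<Rightarrow> complex"
  assumes "(\<lambda>x. (cmod (f x))\<^sup>2) summable_on A" "(\<lambda>x. (cmod (g x))\<^sup>2) summable_on A"
  shows "(\<lambda>x. f x * g x) abs_summable_on A"
proof (rule summable_on_comparison_test)
  show "(\<lambda>x. (cmod (f x))\<^sup>2 + (cmod (g x))\<^sup>2) summable_on A"
    using assms by (rule summable_on_add)
  show "norm (f x * g x) \<le> (cmod (f x))\<^sup>2 + (cmod (g x))\<^sup>2" for x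
  proof -
    have "0 \<le> cmod (f x) * cmod (g x)" by simp
    then show ?thesis
      using sum_squares_bound[of "cmod (f x)" "cmod (g x)"] unfolding norm_mult by linarith
  qed
qed auto

lemma summable_add_squares:
  fixes f g :: "'a \<Rightarrow> complex"
  assumes "(\<lambda>x. (cmod (f x))\<^sup>2) summable_on A" "(\<lambda>x. (cmod (g x))\<^sup>2) summable_on A"
  shows "(\<lambda>x. (cmod (f x + g x))\<^sup>2) summable_on A"
proof (rule summable_on_comparison_test)
  show "(\<lambda>x. 2 * ((cmod (f x))\<^sup>2 + (cmod (g x))\<^sup>2)) summable_on A"
    using assms by (intro summable_on_cmult_right summable_on_add)
  show "(cmod (f x + g x))\<^sup>2 \<le> 2 * ((cmod (f x))\<^sup>2 + (cmod (g x))\<^sup>2)" for x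
  proof -
    have "(cmod (f x + g x))\<^sup>2 \<le> (cmod (f x) + cmod (g x))\<^sup>2"
      by (simp add: norm_triangle_ineq power_mono)
    then show ?thesis
      using sum_squares_bound[of "cmod (f x)" "cmod (g x)"] by (simp add: power2_sum)
  qed
qed auto

instantiation l2 :: (type) real_vector
begin

lift_definition zero_l2 :: "'a l2" is "\<lambda>_. 0" by simp
lift_definition plus_l2 :: "'a l2 \<Rightarrow> 'a l2 \<Rightarrow> 'a l2" is "\<lambda>f g x. f x + g x"
  by (rule summable_add_squares)
lift_definition uminus_l2 :: "'a l2 \<Rightarrow> 'a l2" is "\<lambda>f x. - f x" by simp
lift_definition minus_l2 :: "'a l2 \<Rightarrow> 'a l2 \<Rightarrow> 'a l2" is "\<lambda>f g x. f x - g x"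
  subgoal for f g using summable_add_squares[of f UNIV "\<lambda>x. - g x"] by simp
  done
lift_definition scaleR_l2 :: "real \<Rightarrow> 'a l2 \<Rightarrow> 'a l2" is "\<lambda>r f x. of_real r * f x"
  by (simp add: norm_mult power_mult_distrib summable_on_cmult_right)

instance
  by standard (transfer; simp add: fun_eq_iff algebra_simps)+

end

lift_definition scaleC :: "complex \<Rightarrow> 'a l2 \<Rightarrow> 'a l2" (infixr \<open>*\<^sub>C\<close> 75) is "\<lambda>c f x. c * f x"
  by (simp add: norm_mult power_mult_distrib summable_on_cmult_right)

lemma coord_simps [simp]:
  "coord 0 x = 0" "coord (a + b) x = coord a x + coord b x"
  "coord (- a) x = - coord a x" "coord (a - b) x = coord a x - coord b x"
  "coord (r *\<^sub>R a) x = of_real r * coord a x" "coord (c *\<^sub>C a) x = c * coord a x"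
  by (transfer; simp)+

lemma coord_sum [simp]: "coord (sum f A) x = (\<Sum>i\<in>A. coord (f i) x)"
  by (induction A rule: infinite_finite_induct) auto

definition cinner :: "'a l2 \<Rightarrow> 'a l2 \<Rightarrow> complex" where
  "cinner a b = (\<Sum>\<^sub>\<infinity>x. coord a x * cnj (coord b x))"

lemma cinner_abs_summable: "(\<lambda>x. coord a x * cnj (coord b x)) abs_summable_on UNIV"
  by (rule abs_summable_mult_of_squares) (simp_all add: coord_summable)

lemma cinner_summable: "(\<lambda>x. coord a x * cnj (coord b x)) summable_on UNIV"
  using cinner_abs_summable by (rule abs_summable_summable)

lemma cinner_add_left: "cinner (a + b) c = cinner a c + cinner b c"
  unfolding cinner_def by (subst infsum_add[symmetric]) (simp_all add: cinner_summable algebra_simps)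

lemma cinner_scaleC_left: "cinner (z *\<^sub>C a) b = z * cinner a b"
  unfolding cinner_def by (subst infsum_cmult_right'[symmetric]) (simp add: algebra_simps)

lemma cinner_commute: "cinner a b = cnj (cinner b a)"
  unfolding cinner_def by (subst infsum_cnj[symmetric]) (simp add: mult.commute)

lemma cinner_self: "cinner a a = of_real (\<Sum>\<^sub>\<infinity>x. (cmod (coord a x))\<^sup>2)"
  unfolding cinner_def complex_norm_square[symmetric] of_real_power[symmetric]
  by (rule infsumI[OF has_sum_of_real[OF has_sum_infsum[OF coord_summable]]])

lemma scaleR_scaleC: "r *\<^sub>R a = of_real r *\<^sub>C (a :: 'a l2)"
  by (rule l2_eqI) simp

instantiation l2 :: (type) real_inner
begin

definition inner_l2 :: "'a l2 \<Rightarrow> 'a l2 \<Rightarrow> real" where "inner_l2 a b = Re (cinner a b)"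
definition norm_l2 :: "'a l2 \<Rightarrow> real" where "norm_l2 a = sqrt (inner a a)"
definition sgn_l2 :: "'a l2 \<Rightarrow> 'a l2" where "sgn_l2 a = inverse (norm a) *\<^sub>R a"
definition dist_l2 :: "'a l2 \<Rightarrow> 'a l2 \<Rightarrow> real" where "dist_l2 a b = norm (a - b)"
definition uniformity_l2 :: "('a l2 \<times> 'a l2) filter"
  where "uniformity_l2 = (INF e\<in>{0<..}. principal {(x, y). dist x y < e})"
definition open_l2 :: "'a l2 set \<Rightarrow> bool"
  where "open_l2 U = (\<forall>x\<in>U. eventually (\<lambda>(x', y). x' = x \<longrightarrow> y \<in> U) uniformity)"

instance
proof
  fix a b c :: "'a l2" and r :: real
  show "inner a b = inner b a"
    unfolding inner_l2_def by (subst cinner_commute) simp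
  show "inner (a + b) c = inner a c + inner b c"
    by (simp add: inner_l2_def cinner_add_left)
  show "inner (r *\<^sub>R a) b = r * inner a b"
    by (simp add: inner_l2_def cinner_scaleC_left scaleR_scaleC)
  show "0 \<le> inner a a"
    by (simp add: inner_l2_def cinner_self infsum_nonneg)
  show "inner a a = 0 \<longleftrightarrow> a = 0"
  proof
    assume "inner a a = 0"
    then have "(\<Sum>\<^sub>\<infinity>x. (cmod (coord a x))\<^sup>2) = 0"
      by (simp add: inner_l2_def cinner_self)
    then have "(cmod (coord a x))\<^sup>2 = 0" for x
      by (intro nonneg_infsum_le_0D[of _ UNIV]) (simp_all add: coord_summable)
    then show "a = 0" by (intro l2_eqI) simp
  qed (simp add: inner_l2_def cinner_def)
qed (simp_all add: norm_l2_def sgn_l2_def dist_l2_def uniformity_l2_def open_l2_def)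

end

lemma norm_l2_sq: "(norm a)\<^sup>2 = (\<Sum>\<^sub>\<infinity>x. (cmod (coord a x))\<^sup>2)"
  by (simp add: power2_norm_eq_inner inner_l2_def cinner_self)

lemma norm_l2_eq: "norm a = sqrt (\<Sum>\<^sub>\<infinity>x. (cmod (coord a x))\<^sup>2)"
  using norm_l2_sq[of a] by (metis norm_ge_zero real_sqrt_unique)

lemma sum_coord_le_norm: "finite F \<Longrightarrow> (\<Sum>x\<in>F. (cmod (coord a x))\<^sup>2) \<le> (norm a)\<^sup>2"
  unfolding norm_l2_sq by (rule finite_sum_le_infsum) (simp_all add: coord_summable)

lemma coord_le_norm: "cmod (coord a x) \<le> norm a"
  using sum_coord_le_norm[of "{x}" a] by (simp add: power2_le_iff_abs_le)

lemma norm_scaleC [simp]: "norm (c *\<^sub>C a) = cmod c * norm (a :: 'a l2)"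
proof -
  have "(norm (c *\<^sub>C a))\<^sup>2 = (cmod c * norm a)\<^sup>2"
    unfolding power_mult_distrib norm_l2_sq
    by (subst infsum_cmult_right'[symmetric]) (simp add: norm_mult power_mult_distrib)
  then show ?thesis
    by (metis mult_nonneg_nonneg norm_ge_zero power2_eq_imp_eq)
qed

lemma summable_squares_of_bounded:
  fixes f :: "'a \<Rightarrow> complex"
  assumes "\<And>F. finite F \<Longrightarrow> (\<Sum>x\<in>F. (cmod (f x))\<^sup>2) \<le> K"
  shows "(\<lambda>x. (cmod (f x))\<^sup>2) summable_on UNIV" "(\<Sum>\<^sub>\<infinity>x. (cmod (f x))\<^sup>2) \<le> K"
proof -
  show s: "(\<lambda>x. (cmod (f x))\<^sup>2) summable_on UNIV"
    by (rule nonneg_bdd_above_summable_on) (use assms in \<open>auto intro!: bdd_aboveI2\<close>)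
  show "(\<Sum>\<^sub>\<infinity>x. (cmod (f x))\<^sup>2) \<le> K"
    using s by (rule infsum_le_finite_sums) (use assms in auto)
qed

instance l2 :: (type) complete_space
proof
  fix X :: "nat \<Rightarrow> 'a l2"
  assume C: "Cauchy X"
  have "Cauchy (\<lambda>n. coord (X n) x)" for x
  proof (rule metric_CauchyI)
    fix e :: real assume "e > 0"
    then obtain M where "\<forall>m\<ge>M. \<forall>n\<ge>M. dist (X m) (X n) < e"
      using metric_CauchyD[OF C] by blast
    then show "\<exists>M. \<forall>m\<ge>M. \<forall>n\<ge>M. dist (coord (X m) x) (coord (X n) x) < e"
      using coord_le_norm[of "X m - X n" x for m n] unfolding dist_norm
      by (metis coord_simps(4) order_le_less_trans)
  qed
  then have "\<forall>x. \<exists>l. (\<lambda>n. coord (X n) x) \<longlonglongrightarrow> l"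
    using Cauchy_convergent convergent_def by blast
  then obtain f where f: "\<And>x. (\<lambda>n. coord (X n) x) \<longlonglongrightarrow> f x" by metis
  \<comment> \<open>Coordinatewise limits do not control the norm, so the Cauchy estimate is passed
    to the limit on finite index sets, with a bound independent of the set.\<close>
  have key: "(\<Sum>x\<in>F. (cmod (coord (X m) x - f x))\<^sup>2) \<le> e\<^sup>2"
    if M: "\<forall>m\<ge>M. \<forall>n\<ge>M. dist (X m) (X n) < e" and "m \<ge> M" "finite F" for M m e F
  proof (rule tendsto_upperbound)
    show "(\<lambda>n. \<Sum>x\<in>F. (cmod (coord (X m) x - coord (X n) x))\<^sup>2)
      \<longlonglongrightarrow> (\<Sum>x\<in>F. (cmod (coord (X m) x - f x))\<^sup>2)"
      by (intro tendsto_intros f)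
    show "\<forall>\<^sub>F n in sequentially. (\<Sum>x\<in>F. (cmod (coord (X m) x - coord (X n) x))\<^sup>2) \<le> e\<^sup>2"
    proof (rule eventually_sequentiallyI[of M])
      fix n assume "n \<ge> M"
      then have "norm (X m - X n) \<le> e"
        using M \<open>m \<ge> M\<close> by (metis dist_norm less_imp_le)
      then have "(norm (X m - X n))\<^sup>2 \<le> e\<^sup>2" by (simp add: power_mono)
      then show "(\<Sum>x\<in>F. (cmod (coord (X m) x - coord (X n) x))\<^sup>2) \<le> e\<^sup>2"
        using sum_coord_le_norm[OF \<open>finite F\<close>, of "X m - X n"] by simp
    qed
  qed simp
  obtain M where M: "\<forall>m\<ge>M. \<forall>n\<ge>M. dist (X m) (X n) < 1"
    using metric_CauchyD[OF C, of 1] by auto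
  have "(\<lambda>x. (cmod (coord (X M) x - f x))\<^sup>2) summable_on UNIV"
    by (rule summable_squares_of_bounded[of _ "1\<^sup>2"]) (rule key[OF M], auto)
  from summable_add_squares[OF coord_summable[of "X M"], of "\<lambda>x. - (coord (X M) x - f x)"] this
  have fs: "(\<lambda>x. (cmod (f x))\<^sup>2) summable_on UNIV"
    by (simp add: norm_minus_commute)
  define L where "L = Abs_l2 f"
  have L: "coord L x = f x" for x
    by (simp add: L_def Abs_l2_inverse fs)
  have "X \<longlonglongrightarrow> L"
  proof (rule metric_LIMSEQ_I)
    fix r :: real assume "r > 0"
    then obtain M where M: "\<forall>m\<ge>M. \<forall>n\<ge>M. dist (X m) (X n) < r/2"
      using metric_CauchyD[OF C, of "r/2"] by auto
    have "dist (X m) L < r" if "m \<ge> M" for m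
    proof -
      have "(norm (X m - L))\<^sup>2 \<le> (r/2)\<^sup>2"
        unfolding norm_l2_sq coord_simps L
        by (rule summable_squares_of_bounded) (rule key[OF M that])
      then have "norm (X m - L) \<le> r/2"
        using \<open>r > 0\<close> by (simp add: power2_le_iff_abs_le)
      then show ?thesis using \<open>r > 0\<close> by (simp add: dist_norm)
    qed
    then show "\<exists>no. \<forall>n\<ge>no. dist (X n) L < r" by blast
  qed
  then show "convergent X" by (rule convergentI)
qed

lemma cinner_simps:
  "cinner (a + b) c = cinner a c + cinner b c" "cinner a (b + c) = cinner a b + cinner a c"
  "cinner (a - b) c = cinner a c - cinner b c" "cinner a (b - c) = cinner a b - cinner a c"
  "cinner (z *\<^sub>C a) b = z * cinner a b" "cinner a (z *\<^sub>C b) = cnj z * cinner a b"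
  "cinner 0 a = 0" "cinner a 0 = 0"
proof -
  show *: "cinner (a + b) c = cinner a c + cinner b c" for a b c :: "'a l2"
    by (rule cinner_add_left)
  show **: "cinner a (b + c) = cinner a b + cinner a c" for a b c :: "'a l2"
    by (subst (1 2 3) cinner_commute) (simp add: *)
  show "cinner (a - b) c = cinner a c - cinner b c" 
    using *[of "a - b" b c] by simp
  show "cinner a (b - c) = cinner a b - cinner a c"
    using **[of a "b - c" c] by simp
  show "cinner (z *\<^sub>C a) b = z * cinner a b" by (rule cinner_scaleC_left)
  show "cinner a (z *\<^sub>C b) = cnj z * cinner a b"
    by (subst (1 2) cinner_commute) (simp add: cinner_scaleC_left)
qed (simp_all add: cinner_def)

lemma cinner_norm: "cinner a a = of_real ((norm a)\<^sup>2)"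
  by (simp add: cinner_self norm_l2_sq)

lemma Re_cinner: "Re (cinner a b) = inner a b"
  by (simp add: inner_l2_def)

lemma Im_cinner: "Im (cinner a b) = inner a (\<i> *\<^sub>C b)"
  by (simp add: inner_l2_def cinner_simps)

text \<open>Multiplying \<open>a\<close> by a phase makes the inner product real and nonnegative,
  which reduces the claim to the real inner product.\<close>

lemma cinner_Cauchy_Schwarz: "cmod (cinner a b) \<le> norm a * norm b"
proof (cases "cinner a b = 0")
  case False
  define u where "u = cnj (sgn (cinner a b))"
  have "cmod u = 1" using False by (simp add: u_def norm_sgn)
  have "u * cinner a b = of_real (cmod (cinner a b))"
  proof -
    have "u * cinner a b = (cinner a b * cnj (cinner a b)) / of_real (cmod (cinner a b))"
      by (simp add: u_def sgn_eq mult.commute)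
    also have "\<dots> = of_real (cmod (cinner a b))"
      using False by (simp add: complex_norm_square[symmetric] power2_eq_square)
    finally show ?thesis .
  qed
  then have "cmod (cinner a b) = inner (u *\<^sub>C a) b"
    by (metis cinner_simps(5) Re_cinner Re_complex_of_real)
  also have "\<dots> \<le> norm (u *\<^sub>C a) * norm b" by (rule norm_cauchy_schwarz)
  finally show ?thesis by (simp add: \<open>cmod u = 1\<close>)
qed simp

lemma cinner_eqI: "(\<And>c. cinner c a = cinner c b) \<Longrightarrow> a = b"
  by (metis cinner_norm cinner_simps(4) eq_iff_diff_eq_0 norm_eq_zero of_real_eq_0_iff power_eq_0_iff)

lemma bounded_linear_coord: "bounded_linear (\<lambda>a. coord a x)"
  by (rule bounded_linear_intro[of _ 1]) (simp_all add: coord_le_norm scaleR_conv_of_real)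

lemma bounded_linear_cinner_left: "bounded_linear (\<lambda>a. cinner a b)"
  by (rule bounded_linear_intro[of _ "norm b"])
    (simp_all add: cinner_simps scaleR_scaleC cinner_Cauchy_Schwarz scaleR_conv_of_real)

lemma bounded_linear_scaleC: "bounded_linear (\<lambda>a. c *\<^sub>C (a :: 'a l2))"
  by (rule bounded_linear_intro[of _ "cmod c"]) (auto intro!: l2_eqI simp: algebra_simps)

lemma scaleC_simps [simp]:
  "(1::complex) *\<^sub>C a = a" "0 *\<^sub>C a = 0" "c *\<^sub>C (0 :: 'a l2) = 0" "c *\<^sub>C d *\<^sub>C a = (c * d) *\<^sub>C a"
  by (auto intro!: l2_eqI)

lemma scaleC_distrib:
  "c *\<^sub>C (a + b) = c *\<^sub>C a + c *\<^sub>C (b :: 'a l2)" "c *\<^sub>C (a - b) = c *\<^sub>C a - c *\<^sub>C b"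
  "(c + d) *\<^sub>C a = c *\<^sub>C a + d *\<^sub>C a" "c *\<^sub>C sum f A = (\<Sum>i\<in>A. c *\<^sub>C f i)"
  by (auto intro!: l2_eqI simp: algebra_simps sum_distrib_left)

lift_definition bv :: "'a \<Rightarrow> 'a l2" is "\<lambda>g x. if x = g then 1 else 0"
  by (rule finite_nonzero_values_imp_summable_on) (auto intro: finite_subset[of _ "{_}"])

lemma coord_bv: "coord (bv g) x = (if x = g then 1 else 0)"
  by transfer simp

lemma cinner_bv: "cinner a (bv g) = coord a g" 
proof -
  have "cinner a (bv g) = (\<Sum>\<^sub>\<infinity>x\<in>{g}. coord a x * cnj (coord (bv g) x))"
    unfolding cinner_def by (rule infsum_cong_neutral) (auto simp: coord_bv)
  then show ?thesis by (simp add: coord_bv)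
qed

lemma norm_bv [simp]: "norm (bv g) = 1"
proof -
  have "(norm (bv g))\<^sup>2 = (\<Sum>\<^sub>\<infinity>x\<in>{g}. (cmod (coord (bv g) x))\<^sup>2)"
    unfolding norm_l2_sq by (rule infsum_cong_neutral) (auto simp: coord_bv)
  then show ?thesis by (simp add: coord_bv power2_eq_1_iff) (smt (verit) norm_ge_zero)
qed

text \<open>For finite \<open>F\<close> this is the truncation behind density arguments; for a
  subgroup \<open>F\<close> it is a projection that commutes with the left translations by
  \<open>F\<close>.\<close>

definition cut :: "'a set \<Rightarrow> 'a l2 \<Rightarrow> 'a l2" where
  "cut F a = Abs_l2 (\<lambda>x. if x \<in> F then coord a x else 0)"

lemma coord_cut [simp]: "coord (cut F a) x = (if x \<in> F then coord a x else 0)"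
proof -
  have "(\<lambda>x. (cmod (if x \<in> F then coord a x else 0))\<^sup>2) summable_on UNIV"
    by (rule summable_on_comparison_test[OF coord_summable[of a]]) auto
  then show ?thesis unfolding cut_def by (subst Abs_l2_inverse) auto
qed

lemma cut_finite: "finite F \<Longrightarrow> cut F a = (\<Sum>g\<in>F. coord a g *\<^sub>C bv g)"
  by (auto intro!: l2_eqI simp: coord_bv if_distrib cong: if_cong)

lemma cut_approx:
  assumes "e > 0"
  obtains F where "finite F" "norm (a - cut F a) < e"
proof -
  let ?f = "\<lambda>x. (cmod (coord a x))\<^sup>2"
  obtain F where F: "finite F" "dist (sum ?f F) (infsum ?f UNIV) \<le> e\<^sup>2 / 2"
    using infsum_finite_approximation[OF coord_summable[of a], of "e\<^sup>2/2"] assms by auto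
  have "(norm (a - cut F a))\<^sup>2 = infsum ?f (UNIV - F)"
    unfolding norm_l2_sq by (rule infsum_cong_neutral) auto
  also have "\<dots> = infsum ?f UNIV - infsum ?f F"
    by (rule infsum_Diff) (auto simp: coord_summable F)
  also have "\<dots> < e\<^sup>2"
    using F assms by (auto simp: dist_real_def abs_if split: if_splits) (smt (verit) zero_less_power2 field_sum_of_halves)+
  finally have "norm (a - cut F a) < e"
    using assms power_less_imp_less_base by fastforce
  then show ?thesis using that F by blast
qed

section \<open>Closed subspaces and orthogonal projection\<close>

definition csubspace :: "'a l2 set \<Rightarrow> bool" where
  "csubspace S \<longleftrightarrow> 0 \<in> S \<and> (\<forall>a\<in>S. \<forall>b\<in>S. a + b \<in> S) \<and> (\<forall>c. \<forall>a\<in>S. c *\<^sub>C a \<in> S)"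

lemma csubspace_sum: "csubspace S \<Longrightarrow> (\<And>i. i \<in> A \<Longrightarrow> f i \<in> S) \<Longrightarrow> sum f A \<in> S"
  by (induction A rule: infinite_finite_induct) (auto simp: csubspace_def)

lemma csubspace_diff: "csubspace S \<Longrightarrow> a \<in> S \<Longrightarrow> b \<in> S \<Longrightarrow> a - b \<in> S"
proof -
  assume S: "csubspace S" "a \<in> S" "b \<in> S"
  have "a - b = a + (-1) *\<^sub>C b" by (rule l2_eqI) simp
  then show ?thesis using S unfolding csubspace_def by metis
qed

text \<open>Used as an induction principle: an identity whose solutions form a closed subspace has
  to be checked on the basis vectors only.\<close>

lemma dense_bv:
  assumes S: "csubspace S" "closed S" "\<And>g. bv g \<in> S"
  shows "a \<in> S"
proof -
  have "\<exists>b\<in>S. dist b a < e" if e: "e > 0" for e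
  proof -
    obtain F where F: "finite F" "norm (a - cut F a) < e" using cut_approx[OF e] .
    have "cut F a \<in> S"
      unfolding cut_finite[OF F(1)] using S by (intro csubspace_sum) (auto simp: csubspace_def)
    then show ?thesis using F by (auto simp: dist_norm norm_minus_commute)
  qed
  then have "a \<in> closure S" by (simp add: closure_approachable)
  then show ?thesis using S by simp
qed

text \<open>A minimizing sequence for the distance is Cauchy by the parallelogram law, and its limit
  cannot be improved in any direction of \<open>S\<close>, which is orthogonality.\<close>

lemma Hilbert_projection:
  fixes S :: "'a l2 set"
  assumes S: "csubspace S" "closed S"
  obtains b where "b \<in> S" "\<And>c. c \<in> S \<Longrightarrow> cinner (a - b) c = 0"
proof -
  define d where "d = Inf ((\<lambda>b. norm (a - b)) ` S)"
  have ne: "S \<noteq> {}" using S by (auto simp: csubspace_def)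
  have bdd: "bdd_below ((\<lambda>b. norm (a - b)) ` S)" by (rule bdd_belowI2[of _ 0]) simp
  have dle: "d \<le> norm (a - b)" if "b \<in> S" for b
    unfolding d_def using that bdd by (intro cInf_lower) auto
  have d0: "d \<ge> 0" unfolding d_def using ne by (intro cInf_greatest) auto
  have "\<exists>b\<in>S. norm (a - b) < d + inverse (real (Suc n))" for n
    using cInf_lessD[of "(\<lambda>b. norm (a - b)) ` S" "d + inverse (real (Suc n))"] ne
    unfolding d_def by auto
  then obtain X where X: "\<And>n. X n \<in> S" "\<And>n. norm (a - X n) < d + inverse (real (Suc n))" by metis
  have "(\<lambda>n. d + inverse (real (Suc n))) \<longlonglongrightarrow> d + 0"
    by (intro tendsto_add tendsto_const LIMSEQ_inverse_real_of_nat)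
  then have lim: "(\<lambda>n. norm (a - X n)) \<longlonglongrightarrow> d"
    unfolding add_0_right
  proof (rule tendsto_sandwich[rotated 3])
    show "\<forall>\<^sub>F n in sequentially. d \<le> norm (a - X n)" by (simp add: X dle)
    show "\<forall>\<^sub>F n in sequentially. norm (a - X n) \<le> d + inverse (real (Suc n))"
      by (intro always_eventually allI less_imp_le X(2))
  qed simp
  have par: "(norm (b - c))\<^sup>2 \<le> 2 * (norm (a - b))\<^sup>2 + 2 * (norm (a - c))\<^sup>2 - 4 * d\<^sup>2"
    if "b \<in> S" "c \<in> S" for b c
  proof -
    have "(1/2) *\<^sub>R (b + c) \<in> S"
      using that S unfolding scaleR_scaleC csubspace_def by blast
    then have "d\<^sup>2 \<le> (norm (a - (1/2) *\<^sub>R (b + c)))\<^sup>2"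
      by (intro power_mono dle d0)
    moreover have "4 * (norm (a - (1/2) *\<^sub>R (b + c)))\<^sup>2 + (norm (b - c))\<^sup>2
        = 2 * (norm (a - b))\<^sup>2 + 2 * (norm (a - c))\<^sup>2"
      by (simp add: power2_norm_eq_inner inner_simps inner_commute algebra_simps)
    ultimately show ?thesis by simp
  qed
  have "Cauchy X"
  proof (rule metric_CauchyI)
    fix e :: real assume e: "e > 0"
    have "(\<lambda>n. (norm (a - X n))\<^sup>2) \<longlonglongrightarrow> d\<^sup>2" by (intro tendsto_intros lim)
    then have "\<forall>\<^sub>F n in sequentially. (norm (a - X n))\<^sup>2 < d\<^sup>2 + e\<^sup>2 / 4"
      by (rule order_tendstoD) (use e in simp)
    then obtain M where M: "\<And>n. n \<ge> M \<Longrightarrow> (norm (a - X n))\<^sup>2 < d\<^sup>2 + e\<^sup>2 / 4"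
      by (auto simp: eventually_sequentially)
    have "dist (X m) (X n) < e" if "m \<ge> M" "n \<ge> M" for m n
    proof -
      have "(norm (X m - X n))\<^sup>2 < e\<^sup>2"
        using par[OF X(1) X(1), of m n] M[OF that(1)] M[OF that(2)] by simp
      then show ?thesis using e power_less_imp_less_base by (fastforce simp: dist_norm)
    qed
    then show "\<exists>M. \<forall>m\<ge>M. \<forall>n\<ge>M. dist (X m) (X n) < e" by blast
  qed
  then obtain b where b: "X \<longlonglongrightarrow> b" using Cauchy_convergent convergent_def by blast
  have bS: "b \<in> S" using closed_sequentially[OF S(2) X(1) b] .
  have nb: "norm (a - b) = d"
    by (rule LIMSEQ_unique[OF _ lim]) (intro tendsto_intros b)
  have re: "inner (a - b) c = 0" if c: "c \<in> S" for c
  proof (rule ccontr)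
    assume "inner (a - b) c \<noteq> 0"
    then have cp: "inner c c > 0" by auto
    \<comment> \<open>This value of \<open>t\<close> minimizes the distance along the line through
      \<open>b\<close> in direction \<open>c\<close>.\<close>
    define t where "t = inner (a - b) c / inner c c"
    have "b + t *\<^sub>R c \<in> S"
      using c bS S unfolding scaleR_scaleC csubspace_def by blast
    then have "d\<^sup>2 \<le> (norm (a - (b + t *\<^sub>R c)))\<^sup>2"
      by (intro power_mono dle d0)
    also have "\<dots> = (norm (a - b))\<^sup>2 - 2 * t * inner (a - b) c + t * t * inner c c"
      by (simp add: power2_norm_eq_inner inner_simps inner_commute algebra_simps)
    also have "\<dots> = d\<^sup>2 - (inner (a - b) c)\<^sup>2 / inner c c"
      using cp by (simp add: nb t_def power2_eq_square)
    finally show False using cp \<open>inner (a - b) c \<noteq> 0\<close>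
      by (simp add: divide_le_0_iff)
  qed
  have "cinner (a - b) c = 0" if "c \<in> S" for c
  proof (rule complex_eqI)
    show "Re (cinner (a - b) c) = Re 0" using re that by (simp add: Re_cinner)
    \<comment> \<open>The imaginary part is the real inner product with \<i> times \<open>c\<close>,
      so closure under complex scalars upgrades real to complex orthogonality.\<close>
    have "\<i> *\<^sub>C c \<in> S" using that S by (auto simp: csubspace_def)
    then show "Im (cinner (a - b) c) = Im 0" using re by (simp add: Im_cinner)
  qed
  then show ?thesis using that bS by blast
qed

section \<open>Bounded operators and von Neumann algebras\<close>

definition cbl :: "('a l2 \<Rightarrow> 'b l2) \<Rightarrow> bool" where
  "cbl T \<longleftrightarrow> bounded_linear T \<and> (\<forall>c a. T (c *\<^sub>C a) = c *\<^sub>C T a)"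

lemma cbl_bounded_linear: "cbl T \<Longrightarrow> bounded_linear T"
  by (simp add: cbl_def)

lemma cbl_scaleC: "cbl T \<Longrightarrow> T (c *\<^sub>C a) = c *\<^sub>C T a"
  by (simp add: cbl_def)

lemma cbl_add: "cbl T \<Longrightarrow> T (a + b) = T a + T b"
  and cbl_diff: "cbl T \<Longrightarrow> T (a - b) = T a - T b"
  and cbl_zero: "cbl T \<Longrightarrow> T 0 = 0"
  and cbl_sum: "cbl T \<Longrightarrow> T (sum f A) = (\<Sum>i\<in>A. T (f i))"
  by (simp_all add: cbl_bounded_linear linear_simps(1,2,3) bounded_linear.linear linear_sum)

lemma cbl_intro:
  assumes "\<And>a b. T (a + b) = T a + T b" "\<And>c a. T (c *\<^sub>C a) = c *\<^sub>C T a" "\<And>a. norm (T a) \<le> K * norm a"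
  shows "cbl T"
  unfolding cbl_def
proof
  show "bounded_linear T"
    by (rule bounded_linear_intro[of _ K]) (use assms in \<open>simp_all add: scaleR_scaleC mult.commute\<close>)
qed (use assms in auto)

lemma cbl_comp: "cbl S \<Longrightarrow> cbl T \<Longrightarrow> cbl (S \<circ> T)"
  by (auto simp: cbl_def o_def intro: bounded_linear_compose)

lemma cbl_id [simp]: "cbl id" "cbl (\<lambda>a. a)"
  by (auto simp: cbl_def id_def bounded_linear_ident)

lemma cbl_plus: "cbl S \<Longrightarrow> cbl T \<Longrightarrow> cbl (\<lambda>a. S a + T a)"
  by (simp add: cbl_def bounded_linear_add scaleC_distrib)

lemma cbl_cmult: "cbl T \<Longrightarrow> cbl (\<lambda>a. c *\<^sub>C T a)"
  by (auto simp: cbl_def mult.commute intro: bounded_linear_compose[OF bounded_linear_scaleC])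

lemma csubspace_cbl_eq:
  assumes "cbl S" "cbl T"
  shows "csubspace {a. S a = T a}" "closed {a. S a = T a}"
proof -
  show "csubspace {a. S a = T a}"
    using assms by (auto simp: csubspace_def cbl_add cbl_zero cbl_scaleC)
  show "closed {a. S a = T a}"
    by (intro closed_Collect_eq linear_continuous_on cbl_bounded_linear assms)
qed

lemma cbl_eqI:
  assumes "cbl S" "cbl T" "\<And>g. S (bv g) = T (bv g)"
  shows "S = T"
  using dense_bv[OF csubspace_cbl_eq[OF assms(1,2)]] assms(3) by auto

lemma mult_cnj_cmod: "z * cnj z = (complex_of_real (cmod z))\<^sup>2"
  by (simp add: complex_norm_square[symmetric])

lemma cinner_sum: "cinner b (\<Sum>g\<in>F. c g *\<^sub>C v g) = (\<Sum>g\<in>F. cnj (c g) * cinner b (v g))"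
  by (induction F rule: infinite_finite_induct) (auto simp: cinner_simps)

section \<open>Adjoints of bounded operators\<close>

definition adjo :: "('a l2 \<Rightarrow> 'b l2) \<Rightarrow> 'b l2 \<Rightarrow> 'a l2" where
  "adjo T b = Abs_l2 (\<lambda>g. cinner b (T (bv g)))"

text \<open>Testing \<open>T\<close> on the finite combination \<open>a\<close> of basis vectors
  with the prospective coefficients gives \<open>cinner b (T a) = S\<close>, and \<open>S\<close> is
  also the squared norm of \<open>a\<close>. Cauchy-Schwarz then bounds \<open>norm a\<close> by
  \<open>K * norm b\<close>, uniformly in the finite set \<open>F\<close>.\<close>

lemma adjo_bounded:
  assumes "cbl T" "\<And>a. norm (T a) \<le> K * norm a"
  shows "coord (adjo T b) g = cinner b (T (bv g))" "norm (adjo T b) \<le> K * norm b"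
proof -
  let ?y = "\<lambda>g. cinner b (T (bv g))"
  have K: "K \<ge> 0" using assms(2)[of "bv undefined"] norm_ge_zero[of "T (bv undefined)"] by (simp del: norm_ge_zero)
  have bd: "(\<Sum>g\<in>F. (cmod (?y g))\<^sup>2) \<le> (K * norm b)\<^sup>2" if F: "finite F" for F
  proof -
    define a where "a = (\<Sum>g\<in>F. ?y g *\<^sub>C bv g)"
    define S where "S = (\<Sum>g\<in>F. (cmod (?y g))\<^sup>2)"
    have S0: "S \<ge> 0" by (simp add: S_def sum_nonneg)
    have Tb: "cinner b (T a) = of_real S"
      unfolding a_def cbl_sum[OF assms(1)] cbl_scaleC[OF assms(1)] cinner_sum S_def
      by (simp add: mult_cnj_cmod mult.commute)
    have ca: "coord a g = (if g \<in> F then ?y g else 0)" for g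
      using F by (simp add: a_def coord_bv if_distrib cong: if_cong)
    have "of_real ((norm a)\<^sup>2) = complex_of_real S"
      unfolding cinner_norm[symmetric] using cinner_sum[of a ?y bv F]
      by (simp add: a_def[symmetric] cinner_bv ca S_def mult_cnj_cmod mult.commute)
    then have na: "(norm a)\<^sup>2 = S" using of_real_eq_iff by blast
    have "S \<le> norm b * norm (T a)"
      using cinner_Cauchy_Schwarz[of b "T a"] S0 by (simp add: Tb)
    also have "\<dots> \<le> norm b * (K * norm a)"
      by (intro mult_left_mono assms) simp
    finally have "norm a * norm a \<le> (K * norm b) * norm a"
      using na by (simp add: power2_eq_square algebra_simps)
    then have "norm a \<le> K * norm b"
      using K by (cases "norm a = 0") (simp_all add: mult_le_cancel_right)
    then have "(norm a)\<^sup>2 \<le> (K * norm b)\<^sup>2" by (simp add: power_mono)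
    then show ?thesis by (simp add: na S_def)
  qed
  have "(\<lambda>g. (cmod (?y g))\<^sup>2) summable_on UNIV" "(\<Sum>\<^sub>\<infinity>g. (cmod (?y g))\<^sup>2) \<le> (K * norm b)\<^sup>2"
    using summable_squares_of_bounded[OF bd] by auto
  then show c: "coord (adjo T b) g = cinner b (T (bv g))" for g
    unfolding adjo_def by (simp add: Abs_l2_inverse)
  have "(norm (adjo T b))\<^sup>2 \<le> (K * norm b)\<^sup>2"
    unfolding norm_l2_sq c using summable_squares_of_bounded[OF bd] by auto
  then show "norm (adjo T b) \<le> K * norm b"
    using K by (simp add: power2_le_iff_abs_le)
qed

lemma cbl_bound:
  assumes "cbl T"
  obtains K where "\<And>a. norm (T a) \<le> K * norm a"
  using bounded_linear.bounded[OF cbl_bounded_linear[OF assms]] by (metis mult.commute)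

lemma coord_adjo: "cbl T \<Longrightarrow> coord (adjo T b) g = cinner b (T (bv g))"
  using cbl_bound adjo_bounded(1) by metis

lemma cbl_adjo:
  assumes "cbl T" shows "cbl (adjo T)"
proof -
  obtain K where K: "\<And>a. norm (T a) \<le> K * norm a" using cbl_bound[OF assms] by blast
  show ?thesis
    by (rule cbl_intro[of _ K]) (auto intro!: l2_eqI adjo_bounded[OF assms K] simp: coord_adjo assms cinner_simps)
qed

lemma adjo:
  assumes T: "cbl T"
  shows "cinner (T a) b = cinner a (adjo T b)"
proof -
  let ?S = "{a. cinner (T a) b = cinner a (adjo T b)}"
  have "a \<in> ?S"
  proof (rule dense_bv)
    show "csubspace ?S"
      using T by (auto simp: csubspace_def cbl_add cbl_zero cbl_scaleC cinner_simps)
    show "closed ?S"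
      by (intro closed_Collect_eq linear_continuous_on bounded_linear_cinner_left
          bounded_linear_compose[OF bounded_linear_cinner_left cbl_bounded_linear[OF T]])
    show "bv g \<in> ?S" for g
      using cinner_commute[of "bv g"] cinner_commute[of "T (bv g)" b]
      by (simp add: cinner_bv coord_adjo[OF T])
  qed
  then show ?thesis by simp
qed

lemma adjo_unique:
  assumes "cbl T" "\<And>a b. cinner (T a) b = cinner a (S b)"
  shows "S = adjo T"
  by (intro ext cinner_eqI) (simp add: assms(2)[symmetric] adjo[OF assms(1)])

lemma adjo_adjo:
  assumes T: "cbl T" shows "adjo (adjo T) = T"
proof (rule adjo_unique[symmetric])
  show "cbl (adjo T)" using T by (rule cbl_adjo)
  show "cinner (adjo T a) b = cinner a (T b)" for a b
    using adjo[OF T, of b a] cinner_commute[of "adjo T a" b] cinner_commute[of a "T b"] by simp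
qed

lemma adjo_comp: "cbl S \<Longrightarrow> cbl T \<Longrightarrow> adjo (S \<circ> T) = adjo T \<circ> adjo S"
  by (rule adjo_unique[symmetric]) (auto simp: cbl_comp adjo)

section \<open>Commutants and double commutants\<close>

definition commut :: "('a l2 \<Rightarrow> 'a l2) set \<Rightarrow> ('a l2 \<Rightarrow> 'a l2) set" where
  "commut M = {T. cbl T \<and> (\<forall>S\<in>M. T \<circ> S = S \<circ> T)}"

abbreviation bicommut where "bicommut M \<equiv> commut (commut M)"

definition vna :: "('a l2 \<Rightarrow> 'a l2) set \<Rightarrow> bool" where
  "vna M \<longleftrightarrow> M \<subseteq> Collect cbl \<and> (\<forall>T\<in>M. adjo T \<in> M) \<and> bicommut M = M"

lemma commut_cbl: "T \<in> commut M \<Longrightarrow> cbl T"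
  by (simp add: commut_def)

lemma commut_subset: "commut M \<subseteq> Collect cbl"
  by (auto simp: commut_cbl)

lemma commutD: "T \<in> commut M \<Longrightarrow> S \<in> M \<Longrightarrow> T (S a) = S (T a)"
  by (auto simp: commut_def fun_eq_iff)

lemma commutI: "cbl T \<Longrightarrow> (\<And>S a. S \<in> M \<Longrightarrow> T (S a) = S (T a)) \<Longrightarrow> T \<in> commut M"
  by (auto simp: commut_def fun_eq_iff)

lemma commut_antimono: "M \<subseteq> N \<Longrightarrow> commut N \<subseteq> commut M"
  by (auto simp: commut_def)

lemma subset_bicommut: "M \<subseteq> Collect cbl \<Longrightarrow> M \<subseteq> bicommut M"
  by (auto simp: commut_def)

lemma tricommut: "M \<subseteq> Collect cbl \<Longrightarrow> commut (bicommut M) = commut M"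
  by (intro equalityI commut_antimono subset_bicommut) (auto simp: commut_cbl)

lemma adjo_commut:
  assumes "M \<subseteq> Collect cbl" "\<And>S. S \<in> M \<Longrightarrow> adjo S \<in> M" "T \<in> commut M"
  shows "adjo T \<in> commut M"
proof (rule commutI)
  show "cbl (adjo T)" using assms commut_cbl cbl_adjo by blast
  fix S a assume S: "S \<in> M"
  have "T \<circ> adjo S = adjo S \<circ> T" using assms S by (auto simp: commut_def)
  then have "adjo (T \<circ> adjo S) = adjo (adjo S \<circ> T)" by simp
  then have "S \<circ> adjo T = adjo T \<circ> S"
    using S assms by (simp add: adjo_comp commut_cbl cbl_adjo adjo_adjo subset_iff)
  then show "adjo T (S a) = S (adjo T a)" by (simp add: fun_eq_iff)
qed

lemma vna_commut:
  assumes "M \<subseteq> Collect cbl" "\<And>S. S \<in> M \<Longrightarrow> adjo S \<in> M"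
  shows "vna (commut M)"
  unfolding vna_def using assms adjo_commut[OF assms] tricommut[OF assms(1)] by (auto simp: commut_cbl)

lemma vna_bicommut:
  assumes "M \<subseteq> Collect cbl" "\<And>S. S \<in> M \<Longrightarrow> adjo S \<in> M"
  shows "vna (bicommut M)"
  by (rule vna_commut) (use adjo_commut[OF assms] in \<open>auto simp: commut_cbl\<close>)

lemma vna_bicommut_subset: "vna P \<Longrightarrow> M \<subseteq> P \<Longrightarrow> bicommut M \<subseteq> P"
  by (metis vna_def commut_antimono)

lemma commut_comp: "S \<in> commut M \<Longrightarrow> T \<in> commut M \<Longrightarrow> S \<circ> T \<in> commut M"
  by (rule commutI) (auto simp: cbl_comp commut_cbl commutD)

lemma commut_plus: "M \<subseteq> Collect cbl \<Longrightarrow> S \<in> commut M \<Longrightarrow> T \<in> commut M \<Longrightarrow> (\<lambda>a. S a + T a) \<in> commut M"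
  by (rule commutI) (auto simp: cbl_plus commut_cbl commutD cbl_add subset_iff)

lemma commut_cmult: "M \<subseteq> Collect cbl \<Longrightarrow> T \<in> commut M \<Longrightarrow> (\<lambda>a. c *\<^sub>C T a) \<in> commut M"
  by (rule commutI) (auto simp: cbl_cmult commut_cbl commutD cbl_scaleC subset_iff)

lemma commut_id: "M \<subseteq> Collect cbl \<Longrightarrow> (\<lambda>a. a) \<in> commut M"
  by (rule commutI) auto

lemma vna_comp: "vna P \<Longrightarrow> S \<in> P \<Longrightarrow> T \<in> P \<Longrightarrow> S \<circ> T \<in> P"
  using commut_comp[of S "commut P" T] by (simp add: vna_def)

lemma vna_plus: "vna P \<Longrightarrow> S \<in> P \<Longrightarrow> T \<in> P \<Longrightarrow> (\<lambda>a. S a + T a) \<in> P"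
  using commut_plus[OF commut_subset[of P], of S T] by (auto simp: vna_def)

lemma vna_cmult: "vna P \<Longrightarrow> T \<in> P \<Longrightarrow> (\<lambda>a. c *\<^sub>C T a) \<in> P"
  using commut_cmult[OF commut_subset[of P], of T] by (auto simp: vna_def)

lemma vna_id: "vna P \<Longrightarrow> (\<lambda>a. a) \<in> P"
  using commut_id[OF commut_subset[of P]] by (auto simp: vna_def)

section \<open>The group von Neumann algebra\<close>

text \<open>Groups are types of class \<open>group_add\<close>: they are written additively without being commutative.\<close>

definition pm :: "('a \<Rightarrow> 'b) \<Rightarrow> 'b l2 \<Rightarrow> 'a l2" where
  "pm f a = Abs_l2 (\<lambda>x. coord a (f x))"

lemma coord_pm: "bij f \<Longrightarrow> coord (pm f a) x = coord a (f x)"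
  unfolding pm_def using coord_summable[of a] summable_on_reindex_bij_betw[of f UNIV UNIV "\<lambda>x. (cmod (coord a x))\<^sup>2"]
  by (subst Abs_l2_inverse) auto

lemma cinner_pm: "bij f \<Longrightarrow> cinner (pm f a) (pm f b) = cinner a b"
  unfolding cinner_def using infsum_reindex_bij_betw[of f UNIV UNIV "\<lambda>x. coord a x * cnj (coord b x)"]
  by (simp add: coord_pm)

lemma norm_pm: "bij f \<Longrightarrow> norm (pm f a) = norm a"
  by (simp add: norm_l2_def inner_l2_def cinner_pm)

lemma cbl_pm: "bij f \<Longrightarrow> cbl (pm f)"
  by (rule cbl_intro[of _ 1]) (auto intro!: l2_eqI simp: coord_pm norm_pm)

lemma pm_bv: "bij f \<Longrightarrow> pm f (bv (f x)) = bv x"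
  by (rule l2_eqI) (auto simp: coord_pm coord_bv bij_def inj_eq)

lemma adjo_pm: "bij f \<Longrightarrow> adjo (pm f) = pm (inv_into UNIV f)"
proof (rule adjo_unique[symmetric])
  fix a b assume f: "bij f"
  have "pm f (pm (inv_into UNIV f) b) = b"
    using f by (intro l2_eqI) (simp add: coord_pm bij_imp_bij_inv bij_is_inj)
  then show "cinner (pm f a) b = cinner a (pm (inv_into UNIV f) b)" using cinner_pm[OF f, of a "pm (inv_into UNIV f) b"] by simp
qed (rule cbl_pm)

lemma bij_left_add: "bij (\<lambda>x::'a::group_add. g + x)"
  by (rule bij_betw_byWitness[of _ "\<lambda>x. - g + x"]) (auto simp: add.assoc[symmetric])

lemma bij_right_add: "bij (\<lambda>x::'a::group_add. x + g)"
  by (rule bij_betw_byWitness[of _ "\<lambda>x. x + - g"]) (auto simp: add.assoc)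

definition lam :: "'a::group_add \<Rightarrow> 'a l2 \<Rightarrow> 'a l2" where "lam g = pm (\<lambda>x. - g + x)"
definition rho :: "'a::group_add \<Rightarrow> 'a l2 \<Rightarrow> 'a l2" where "rho g = pm (\<lambda>x. x + g)"

lemma coord_lam [simp]: "coord (lam g a) x = coord a (- g + x)"
  by (simp add: lam_def coord_pm bij_left_add)

lemma coord_rho [simp]: "coord (rho g a) x = coord a (x + g)"
  by (simp add: rho_def coord_pm bij_right_add)

lemma cbl_lam [simp]: "cbl (lam g)" and cbl_rho [simp]: "cbl (rho g)"
  by (simp_all add: lam_def rho_def cbl_pm bij_left_add bij_right_add)

lemma norm_lam [simp]: "norm (lam g a) = norm a" and norm_rho [simp]: "norm (rho g a) = norm a"
  by (simp_all add: lam_def rho_def norm_pm bij_left_add bij_right_add)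

lemma lam_lam [simp]: "lam g (lam h a) = lam (g + h) a"
  by (rule l2_eqI) (simp add: minus_add add.assoc[symmetric])

lemma lam_0 [simp]: "lam 0 a = a" and rho_0 [simp]: "rho 0 a = a"
  by (rule l2_eqI; simp)+

lemma lam_rho: "lam g (rho h a) = rho h (lam g a)"
  by (rule l2_eqI) (simp add: add.assoc)

lemma lam_bv [simp]: "lam g (bv x) = bv (g + x)"
  using pm_bv[OF bij_left_add[of "- g"], of "g + x"] by (simp add: lam_def add.assoc[symmetric])

lemma rho_bv: "rho g (bv x) = bv (x - g)"
  using pm_bv[OF bij_right_add[of g], of "x - g"] by (simp add: rho_def)

lemma inv_left_add: "inv_into UNIV (\<lambda>x::'a::group_add. g + x) = (\<lambda>x. - g + x)"
  by (rule inv_unique_comp) (auto simp: fun_eq_iff add.assoc[symmetric])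

lemma inv_right_add: "inv_into UNIV (\<lambda>x::'a::group_add. x + g) = (\<lambda>x. x + - g)"
  by (rule inv_unique_comp) (auto simp: fun_eq_iff add.assoc)

lemma adjo_lam: "adjo (lam g) = lam (- g)" and adjo_rho: "adjo (rho g) = rho (- g)"
  by (simp_all add: lam_def rho_def adjo_pm bij_left_add bij_right_add inv_left_add inv_right_add)

text \<open>Taken as the commutant of the right translations, so that membership is a commutation
  check; \<open>bicommut_lam\<close> identifies it with the algebra generated by the left
  translations.\<close>

definition Lvn :: "('a::group_add l2 \<Rightarrow> 'a l2) set" where "Lvn = commut (range rho)"

lemma Lvn_cbl: "x \<in> Lvn \<Longrightarrow> cbl x"
  by (simp add: Lvn_def commut_cbl)

lemma Lvn_rho: "x \<in> Lvn \<Longrightarrow> x (rho g a) = rho g (x a)"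
  by (simp add: Lvn_def commutD)

lemma LvnI: "cbl x \<Longrightarrow> (\<And>g a. x (rho g a) = rho g (x a)) \<Longrightarrow> x \<in> Lvn"
  unfolding Lvn_def by (rule commutI) auto

lemma lam_Lvn: "lam g \<in> Lvn"
  by (rule LvnI) (simp_all add: lam_rho)

lemma vna_Lvn: "vna Lvn"
  unfolding Lvn_def by (rule vna_commut) (auto simp: adjo_rho)

section \<open>Elements of the algebra as left convolution operators\<close>

lemma bij_minus_right: "bij (\<lambda>l::'a::group_add. m - l)"
  by (rule bij_betw_byWitness[of _ "\<lambda>l. - l + m"]) (auto simp: algebra_simps)

text \<open>With it \<open>cinner z (flip m a)\<close> is the sum of
  \<open>coord z l * coord a (m - l)\<close> over \<open>l\<close>, the value at \<open>m\<close> of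
  a convolution. It makes sense for all square-summable vectors, even when convolution by
  \<open>a\<close> is unbounded.\<close>

definition flip :: "'a::group_add \<Rightarrow> 'a l2 \<Rightarrow> 'a l2" where
  "flip m a = Abs_l2 (\<lambda>l. cnj (coord a (m - l)))"

lemma coord_flip: "coord (flip m a) l = cnj (coord a (m - l))"
  using coord_summable[of "pm (\<lambda>l. m - l) a"] unfolding flip_def
  by (subst Abs_l2_inverse) (simp_all add: coord_pm bij_minus_right)

lemma norm_flip: "norm (flip m a) = norm a"
proof -
  have "norm (flip m a) = norm (pm (\<lambda>l. m - l) a)"
    unfolding norm_l2_eq by (simp add: coord_flip coord_pm bij_minus_right)
  then show ?thesis by (simp add: norm_pm bij_minus_right)
qed

lemma bounded_linear_flip: "bounded_linear (\<lambda>a. cinner z (flip m a))"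
proof (rule bounded_linear_intro[of _ "norm z"])
  show "cinner z (flip m (a + b)) = cinner z (flip m a) + cinner z (flip m b)" for a b
    unfolding cinner_simps(2)[symmetric] by (rule arg_cong[of _ _ "cinner z"]) (auto intro!: l2_eqI simp: coord_flip)
  show "cinner z (flip m (r *\<^sub>R a)) = r *\<^sub>R cinner z (flip m a)" for r a
  proof -
    have "flip m (r *\<^sub>R a) = of_real r *\<^sub>C flip m a" by (auto intro!: l2_eqI simp: coord_flip)
    then show ?thesis by (simp add: cinner_simps scaleR_conv_of_real)
  qed
  show "norm (cinner z (flip m a)) \<le> norm a * norm z" for a
    using cinner_Cauchy_Schwarz[of z "flip m a"] by (simp add: norm_flip mult.commute)
qed

lemma cinner_flip_scaleC: "cinner z (flip m (c *\<^sub>C a)) = c * cinner z (flip m a)"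
proof -
  have "flip m (c *\<^sub>C a) = cnj c *\<^sub>C flip m a" by (auto intro!: l2_eqI simp: coord_flip)
  then show ?thesis by (simp add: cinner_simps)
qed

lemma Lvn_bv: "x \<in> Lvn \<Longrightarrow> x (bv k) = rho (- k) (x (bv 0))"
  by (subst Lvn_rho[symmetric]) (simp_all add: rho_bv)

text \<open>Commuting with right translations makes \<open>x\<close> the left convolution by
  \<open>x (bv 0)\<close>: this holds on basis vectors, and both sides are continuous and linear in
  \<open>z\<close>.\<close>

lemma Lvn_coord:
  assumes x: "x \<in> Lvn"
  shows "coord (x z) m = cinner z (flip m (x (bv 0)))"
proof -
  let ?S = "{z. coord (x z) m = cinner z (flip m (x (bv 0)))}"
  have c: "cbl x" using x by (rule Lvn_cbl)
  have "z \<in> ?S"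
  proof (rule dense_bv)
    show "csubspace ?S"
      using c by (auto simp: csubspace_def cbl_add cbl_zero cbl_scaleC cinner_simps)
    show "closed ?S"
      by (intro closed_Collect_eq linear_continuous_on bounded_linear_cinner_left
          bounded_linear_compose[OF bounded_linear_coord cbl_bounded_linear[OF c]])
    show "bv k \<in> ?S" for k
      using cinner_commute[of "bv k"] by (simp add: cinner_bv coord_flip Lvn_bv[OF x, of k])
  qed
  then show ?thesis by simp
qed

lemma Lvn_eqI:
  assumes "x \<in> Lvn" "y \<in> Lvn" "x (bv 0) = y (bv 0)"
  shows "x = y"
  by (intro ext l2_eqI) (simp add: Lvn_coord assms)

definition ccl :: "'a l2 set \<Rightarrow> 'a l2 set" where
  "ccl X = \<Inter>{S. csubspace S \<and> closed S \<and> X \<subseteq> S}"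

lemma cclD: "a \<in> ccl X \<Longrightarrow> csubspace S \<Longrightarrow> closed S \<Longrightarrow> X \<subseteq> S \<Longrightarrow> a \<in> S"
  by (auto simp: ccl_def)

lemma csubspace_ccl: "csubspace (ccl X)" and closed_ccl: "closed (ccl X)" and subset_ccl: "X \<subseteq> ccl X"
  unfolding ccl_def by (auto simp: csubspace_def intro!: closed_Inter)

text \<open>The commutation theorem for a left Hilbert algebra, in the form needed here: an operator that
  commutes with right translations is determined by its value at the identity, so membership
  in \<open>Q''\<close> can be tested on vectors.\<close>

lemma bicommutI_vector:
  assumes Q: "Q \<subseteq> Lvn" and x: "x \<in> Lvn" and cl: "x (bv 0) \<in> ccl ((\<lambda>q. q (bv 0)) ` Q)"
  shows "x \<in> bicommut Q"
proof (rule commutI)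
  show c: "cbl x" using x by (rule Lvn_cbl)
  fix T a assume T: "T \<in> commut Q"
  then have cT: "cbl T" by (rule commut_cbl)
  \<comment> \<open>The condition says that convolution by \<open>v\<close> commutes with
    \<open>T\<close>. Written through matrix coefficients it is meaningful for every vector
    \<open>v\<close> and is closed and linear in \<open>v\<close>.\<close>
  let ?S = "{v. \<forall>k m. coord (T (rho (- k) v)) m = cinner (T (bv k)) (flip m v)}"
  have "x (bv 0) \<in> ?S"
  proof (rule cclD[OF cl])
    show "csubspace ?S"
      using cT by (auto simp: csubspace_def cbl_add cbl_zero cbl_scaleC cinner_flip_scaleC
          linear_0[OF bounded_linear.linear[OF bounded_linear_flip]]
          linear_add[OF bounded_linear.linear[OF bounded_linear_flip]])
    show "closed ?S"
    proof -
      have "bounded_linear (\<lambda>v. coord (T (rho (- k) v)) m)" for k m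
        using bounded_linear_compose[OF bounded_linear_coord
            bounded_linear_compose[OF cbl_bounded_linear[OF cT] cbl_bounded_linear[OF cbl_rho]]] .
      then have "closed {v. coord (T (rho (- k) v)) m = cinner (T (bv k)) (flip m v)}" for k m
        by (intro closed_Collect_eq linear_continuous_on bounded_linear_flip)
      then have "closed (\<Inter>k. \<Inter>m. {v. coord (T (rho (- k) v)) m = cinner (T (bv k)) (flip m v)})"
        by (intro closed_INT ballI)
      then show ?thesis by (simp add: Collect_all_eq)
    qed
    have "coord (T (rho (- k) (q (bv 0)))) m = cinner (T (bv k)) (flip m (q (bv 0)))" if "q \<in> Q" for q k m
    proof -
      have "T (rho (- k) (q (bv 0))) = q (T (bv k))"
        using commutD[OF T that, of "bv k"] Lvn_bv[of q k] that Q by (simp add: subset_iff)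
      then show ?thesis using that Q by (auto simp: Lvn_coord)
    qed
    then show "(\<lambda>q. q (bv 0)) ` Q \<subseteq> ?S" by auto
  qed
  then have "T (x (bv k)) = x (T (bv k))" for k
    by (intro l2_eqI) (simp add: Lvn_bv[OF x, of k] Lvn_coord[OF x])
  then have "T \<circ> x = x \<circ> T"
    by (intro cbl_eqI cbl_comp cT c) simp
  then show "x (T a) = T (x a)" by (simp add: fun_eq_iff)
qed

text \<open>It serves twice: for the left translations themselves, and for the translations
  transported from the other group by the limit unitary.\<close>

lemma bicommut_eq_Lvn:
  assumes Q: "Q \<subseteq> Lvn" and dense: "\<And>g. bv g \<in> ccl ((\<lambda>q. q (bv 0)) ` Q)"
  shows "bicommut Q = Lvn"
proof
  show "Lvn \<subseteq> bicommut Q"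
    using bicommutI_vector[OF Q] dense_bv[OF csubspace_ccl closed_ccl dense] by blast
  show "bicommut Q \<subseteq> Lvn" by (rule vna_bicommut_subset[OF vna_Lvn Q])
qed

lemma bicommut_lam: "bicommut (range lam) = Lvn"
proof (rule bicommut_eq_Lvn)
  show "bv g \<in> ccl ((\<lambda>q. q (bv 0)) ` range lam)" for g :: 'a
    using subset_ccl[of "(\<lambda>q. q (bv 0)) ` range lam"] by (auto simp: image_image)
qed (auto simp: lam_Lvn)

section \<open>Transport to operators on extensional function spaces\<close>

text \<open>A bijection \<open>e\<close> from the carrier type to a type of class \<open>group_add\<close> identifies
  \<open>ell2 UNIV\<close> with the Hilbert space type and extensional operators with plain ones.\<close>

locale transport =
  fixes e :: "'b \<Rightarrow> 'a"
  assumes bij_e: "bij e"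
begin

definition J :: "'a l2 \<Rightarrow> 'b \<Rightarrow> complex" where "J a = (\<lambda>n. coord a (e n))"
definition K :: "('b \<Rightarrow> complex) \<Rightarrow> 'a l2" where "K f = Abs_l2 (\<lambda>x. f (inv_into UNIV e x))"

lemma ell2_UNIV: "f \<in> ell2 UNIV \<longleftrightarrow> (\<lambda>x. (cmod (f x))\<^sup>2) summable_on UNIV"
  by (simp add: ell2_def)

lemma inv_e [simp]: "inv_into UNIV e (e n) = n" "e (inv_into UNIV e x) = x"
  using bij_e by (simp_all add: bij_def surj_f_inv_f)

lemma J_ell2 [simp]: "J a \<in> ell2 UNIV"
  using coord_summable[of a] summable_on_reindex_bij_betw[OF bij_e, of "\<lambda>x. (cmod (coord a x))\<^sup>2"]
  by (simp add: ell2_UNIV J_def)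

lemma coord_K: "f \<in> ell2 UNIV \<Longrightarrow> coord (K f) x = f (inv_into UNIV e x)"
  using summable_on_reindex_bij_betw[OF bij_e, of "\<lambda>x. (cmod (f (inv_into UNIV e x)))\<^sup>2"]
  unfolding K_def by (subst Abs_l2_inverse) (auto simp: ell2_UNIV)

lemma K_J [simp]: "K (J a) = a"
  by (rule l2_eqI) (simp add: coord_K, simp add: J_def)

lemma J_K [simp]: "f \<in> ell2 UNIV \<Longrightarrow> J (K f) = f"
  by (simp add: J_def coord_K)

lemma J_inj: "J a = J b \<Longrightarrow> a = b"
  by (metis K_J)

lemma J_add: "J (a + b) = (\<lambda>x. J a x + J b x)" and J_scaleC: "J (c *\<^sub>C a) = (\<lambda>x. c * J a x)"
  by (simp_all add: J_def)

lemma ell2_inner_J: "ell2_inner UNIV (J a) (J b) = cinner a b"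
  using infsum_reindex_bij_betw[OF bij_e, of "\<lambda>x. coord a x * cnj (coord b x)"]
  by (simp add: ell2_inner_def J_def cinner_def)

lemma ell2_norm_J: "ell2_norm UNIV (J a) = norm a"
  using infsum_reindex_bij_betw[OF bij_e, of "\<lambda>x. (cmod (coord a x))\<^sup>2"]
  by (simp add: ell2_norm_def J_def norm_l2_eq)

lemma ell2E:
  assumes "f \<in> ell2 UNIV" obtains a where "f = J a"
  using J_K[OF assms] by metis

definition opn :: "('a l2 \<Rightarrow> 'a l2) \<Rightarrow> 'b oper" where
  "opn T = (\<lambda>f\<in>ell2 UNIV. J (T (K f)))"

lemma opn_J [simp]: "opn T (J a) = J (T a)"
  by (simp add: opn_def)

lemma opn_inj: "opn S = opn T \<Longrightarrow> S = T"
  by (metis opn_J J_inj ext)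

lemma opn_extensional: "opn T \<in> ell2 UNIV \<rightarrow>\<^sub>E ell2 UNIV"
  by (auto simp: opn_def)

lemma oper_eqI:
  assumes "S \<in> ell2 UNIV \<rightarrow>\<^sub>E A" "T \<in> ell2 UNIV \<rightarrow>\<^sub>E B" "\<And>a. S (J a) = T (J a)"
  shows "S = T"
proof
  fix f show "S f = T f"
    using assms by (cases "f \<in> ell2 UNIV") (auto elim: ell2E simp: PiE_def extensional_def)
qed

lemma opn_bounded:
  assumes T: "cbl T" shows "opn T \<in> bounded_ops UNIV"
proof -
  obtain C where C: "\<And>a. norm (T a) \<le> C * norm a" using cbl_bound[OF T] by blast
  have "opn T (\<lambda>x. f x + g x) = (\<lambda>x. opn T f x + opn T g x)" if fg: "f \<in> ell2 UNIV" "g \<in> ell2 UNIV" for f g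
  proof -
    obtain a b where "f = J a" "g = J b" using fg ell2E by metis
    then show ?thesis by (simp add: J_add[symmetric] cbl_add[OF T])
  qed
  moreover have "opn T (\<lambda>x. c * f x) = (\<lambda>x. c * opn T f x)" if f: "f \<in> ell2 UNIV" for c f
  proof -
    obtain a where "f = J a" using f ell2E by metis
    then show ?thesis by (simp add: J_scaleC[symmetric] cbl_scaleC[OF T])
  qed
  moreover have "\<forall>f\<in>ell2 UNIV. ell2_norm UNIV (opn T f) \<le> C * ell2_norm UNIV f"
    using C by (auto elim!: ell2E simp: ell2_norm_J)
  ultimately show ?thesis
    using opn_extensional by (auto simp: bounded_ops_def)
qed

lemma bounded_opsE:
  assumes S: "S \<in> bounded_ops UNIV" obtains T where "cbl T" "S = opn T"
proof -
  define T where "T = (\<lambda>a. K (S (J a)))"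
  have ext: "S \<in> ell2 UNIV \<rightarrow>\<^sub>E ell2 UNIV" using S by (simp add: bounded_ops_def)
  then have JT: "J (T a) = S (J a)" for a by (auto simp: T_def PiE_def Pi_def)
  obtain C where C: "\<forall>f\<in>ell2 UNIV. ell2_norm UNIV (S f) \<le> C * ell2_norm UNIV f"
    using S by (auto simp: bounded_ops_def)
  have "cbl T"
  proof (rule cbl_intro[of _ C])
    show "T (a + b) = T a + T b" for a b
      by (rule J_inj) (use S in \<open>simp add: JT J_add bounded_ops_def\<close>)
    show "T (c *\<^sub>C a) = c *\<^sub>C T a" for c a
      by (rule J_inj) (use S in \<open>simp add: JT J_scaleC bounded_ops_def\<close>)
    show "norm (T a) \<le> C * norm a" for a
      using C[rule_format, OF J_ell2[of a]] by (simp add: ell2_norm_J JT[symmetric])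
  qed
  moreover have "S = opn T"
    by (rule oper_eqI[OF ext opn_extensional]) (simp add: JT)
  ultimately show ?thesis using that by blast
qed

lemma bounded_ops_image: "M \<subseteq> bounded_ops UNIV \<Longrightarrow> \<exists>M'\<subseteq>Collect cbl. M = opn ` M'"
  by (rule exI[of _ "{T. cbl T \<and> opn T \<in> M}"]) (auto elim: bounded_opsE)

lemma compose_opn: "compose (ell2 UNIV) (opn S) (opn T) = opn (S \<circ> T)"
  by (rule oper_eqI[of _ UNIV _ UNIV]) (auto simp: compose_def opn_def)

lemma op_add_opn: "op_add UNIV (opn S) (opn T) = opn (\<lambda>a. S a + T a)"
  by (rule oper_eqI[of _ UNIV _ UNIV]) (auto simp: op_add_def opn_def J_add)

lemma op_scale_opn: "op_scale UNIV c (opn T) = opn (\<lambda>a. c *\<^sub>C T a)"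
  by (rule oper_eqI[of _ UNIV _ UNIV]) (auto simp: op_scale_def opn_def J_scaleC)

text \<open>The description by \<open>THE\<close> is justified here: a competitor is itself of the
  form \<open>opn S'\<close> and satisfies the equation that characterizes the adjoint.\<close>

lemma op_adj_opn:
  assumes T: "cbl T" shows "op_adj UNIV (opn T) = opn (adjo T)"
  unfolding op_adj_def
proof (rule the_equality)
  show "opn (adjo T) \<in> bounded_ops UNIV \<and>
      (\<forall>f\<in>ell2 UNIV. \<forall>g\<in>ell2 UNIV. ell2_inner UNIV (opn T f) g = ell2_inner UNIV f (opn (adjo T) g))"
    by (auto simp: opn_bounded cbl_adjo T elim!: ell2E simp: ell2_inner_J adjo)
next
  fix S assume S: "S \<in> bounded_ops UNIV \<and>
      (\<forall>f\<in>ell2 UNIV. \<forall>g\<in>ell2 UNIV. ell2_inner UNIV (opn T f) g = ell2_inner UNIV f (S g))"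
  then obtain S' where S': "cbl S'" "S = opn S'" using bounded_opsE by blast
  have "cinner (T a) b = cinner a (S' b)" for a b
    using S[THEN conjunct2, rule_format, OF J_ell2[of a] J_ell2[of b]] by (simp add: S' ell2_inner_J)
  then show "S = opn (adjo T)" using adjo_unique[OF T] S' by metis
qed

lemma commutant_opn:
  assumes "M \<subseteq> Collect cbl" shows "commutant UNIV (opn ` M) = opn ` commut M"
proof -
  have "T \<in> commutant UNIV (opn ` M) \<longleftrightarrow> T \<in> opn ` commut M" for T
  proof (cases "T \<in> bounded_ops UNIV")
    case True
    then obtain T' where T': "cbl T'" "T = opn T'" using bounded_opsE by blast
    have "T \<in> opn ` commut M \<longleftrightarrow> T' \<in> commut M" using T' opn_inj by blast
    then show ?thesis
      using True T' by (auto simp: commutant_def commut_def compose_opn dest: opn_inj)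
  next
    case False
    then show ?thesis using opn_bounded commut_cbl by (auto simp: commutant_def)
  qed
  then show ?thesis by blast
qed

lemma von_neumann_algebra_opn:
  assumes "M \<subseteq> Collect cbl" shows "von_neumann_algebra UNIV (opn ` M) \<longleftrightarrow> vna M"
proof -
  have inj: "inj opn" using opn_inj by (auto simp: inj_def)
  have "(\<forall>T\<in>opn ` M. op_adj UNIV T \<in> opn ` M) \<longleftrightarrow> (\<forall>T\<in>M. adjo T \<in> M)"
    using assms inj_image_mem_iff[OF inj] by (auto simp: op_adj_opn subset_iff)
  moreover have "commutant UNIV (commutant UNIV (opn ` M)) = opn ` M \<longleftrightarrow> bicommut M = M"
    using inj_image_eq_iff[OF inj] by (simp add: commutant_opn assms commut_subset)
  moreover have "opn ` M \<subseteq> bounded_ops UNIV" using assms opn_bounded by auto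
  ultimately show ?thesis using assms unfolding von_neumann_algebra_def vna_def by simp
qed

lemma von_neumann_algebraE:
  assumes "von_neumann_algebra UNIV M" obtains M' where "M = opn ` M'" "vna M'"
  using assms bounded_ops_image[of M] von_neumann_algebra_opn
  by (metis von_neumann_algebra_def)

text \<open>The intersection in \<open>vn_generated\<close> is attained: the double commutant of a
  self-adjoint set is one of the algebras intersected and is contained in all of them.\<close>

lemma vn_generated_opn:
  assumes "S \<subseteq> Collect cbl" "\<And>T. T \<in> S \<Longrightarrow> adjo T \<in> S"
  shows "vn_generated UNIV (opn ` S) = opn ` bicommut S"
proof
  have "von_neumann_algebra UNIV (opn ` bicommut S)"
    using vna_bicommut[OF assms] by (simp add: von_neumann_algebra_opn commut_subset)
  then show "vn_generated UNIV (opn ` S) \<subseteq> opn ` bicommut S"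
    using subset_bicommut[OF assms(1)] unfolding vn_generated_def by blast
  show "opn ` bicommut S \<subseteq> vn_generated UNIV (opn ` S)"
    unfolding vn_generated_def
  proof (rule Inter_greatest)
    fix M assume M: "M \<in> {M. von_neumann_algebra UNIV M \<and> opn ` S \<subseteq> M}"
    then obtain M' where M': "M = opn ` M'" "vna M'" using von_neumann_algebraE by blast
    then have "opn ` S \<subseteq> opn ` M'" using M by simp
    then have "S \<subseteq> M'" using opn_inj by blast
    then show "opn ` bicommut S \<subseteq> M" using vna_bicommut_subset[OF M'(2)] M'(1) by blast
  qed
qed

end

section \<open>Transport of groups to additive notation\<close>

locale group_transport = transport e for e :: "'b \<Rightarrow> 'a::group_add" +
  fixes G :: "'b monoid" (structure)
  assumes group_G: "group G" and carrier_G [simp]: "carrier G = UNIV"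
    and e_mult: "e (x \<otimes> y) = e x + e y"
begin

lemma e_one: "e \<one> = 0"
proof -
  have "e \<one> + e \<one> = e \<one>"
    using e_mult[of \<one> \<one>] monoid.r_one[OF group.is_monoid[OF group_G], of \<one>] by simp
  then show ?thesis using add_left_cancel[of "e \<one>" "e \<one>" 0] by simp
qed

lemma e_inv: "e (inv x) = - e x"
  using e_mult[of "inv x" x] group.l_inv[OF group_G, of x] e_one by (simp add: eq_neg_iff_add_eq_0)

lemma left_reg_opn: "left_reg G g = opn (lam (e g))"
proof (rule oper_eqI[of _ UNIV _ UNIV])
  show "left_reg G g (J a) = opn (lam (e g)) (J a)" for a
    unfolding opn_J using J_ell2[of a] by (simp add: left_reg_def, simp add: J_def e_mult e_inv)
qed (auto simp: left_reg_def opn_def)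

lemma conj_by_opn: "conj_by G g (opn T) = opn (lam (e g) \<circ> T \<circ> lam (- e g))"
  by (simp add: conj_by_def left_reg_opn op_adj_opn adjo_lam compose_opn o_assoc)

lemma vn_of_subgroup_opn:
  assumes "\<And>x. x \<in> N \<Longrightarrow> inv x \<in> N"
  shows "vn_of_subgroup G N = opn ` bicommut (lam ` e ` N)"
proof -
  have "adjo T \<in> lam ` e ` N" if "T \<in> lam ` e ` N" for T
    using that assms by (auto simp: adjo_lam e_inv[symmetric])
  then have "vn_generated UNIV (opn ` lam ` e ` N) = opn ` bicommut (lam ` e ` N)"
    by (intro vn_generated_opn) auto
  then show ?thesis by (simp add: vn_of_subgroup_def image_image left_reg_opn)
qed

lemma group_vn_opn: "group_vn G = opn ` Lvn"
  using vn_of_subgroup_opn[of UNIV] bij_e by (simp add: group_vn_def bicommut_lam bij_is_surj)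

text \<open>Invariance may be stated as an inclusion for each \<open>g\<close>, since conjugation by
  \<open>- g\<close> inverts conjugation by \<open>g\<close>.\<close>

lemma invariant_subalgebra_opn:
  assumes "P \<subseteq> Collect cbl"
  shows "invariant_subalgebra G (opn ` P) \<longleftrightarrow>
    vna P \<and> P \<subseteq> Lvn \<and> (\<forall>g. \<forall>T\<in>P. lam g \<circ> T \<circ> lam (- g) \<in> P)"
proof -
  have inj: "inj opn" using opn_inj by (auto simp: inj_def)
  have undo: "lam g \<circ> (lam (- g) \<circ> T \<circ> lam g) \<circ> lam (- g) = T" for g and T :: "'a l2 \<Rightarrow> 'a l2"
    by (simp add: fun_eq_iff)
  have "conj_by G g ` opn ` P = opn ` P \<longleftrightarrow> (\<lambda>T. lam (e g) \<circ> T \<circ> lam (- e g)) ` P = P" for g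
    unfolding inj_image_eq_iff[OF inj, symmetric] by (simp add: image_image conj_by_opn)
  then have "(\<forall>g\<in>carrier G. conj_by G g ` opn ` P = opn ` P) \<longleftrightarrow>
      (\<forall>g. (\<lambda>T. lam g \<circ> T \<circ> lam (- g)) ` P = P)"
    using bij_e by (simp add: bij_def) (metis surj_def)
  also have "\<dots> \<longleftrightarrow> (\<forall>g. \<forall>T\<in>P. lam g \<circ> T \<circ> lam (- g) \<in> P)"
  proof (intro iffI allI equalityI)
    fix g assume *: "\<forall>g. \<forall>T\<in>P. lam g \<circ> T \<circ> lam (- g) \<in> P"
    then show "(\<lambda>T. lam g \<circ> T \<circ> lam (- g)) ` P \<subseteq> P" by auto
    show "P \<subseteq> (\<lambda>T. lam g \<circ> T \<circ> lam (- g)) ` P"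
    proof
      fix T assume "T \<in> P"
      then have "lam (- g) \<circ> T \<circ> lam g \<in> P" using *[rule_format, of T "- g"] by simp
      then show "T \<in> (\<lambda>T. lam g \<circ> T \<circ> lam (- g)) ` P" using undo[of g T] by (metis imageI)
    qed
  qed blast
  finally show ?thesis
    unfolding invariant_subalgebra_def group_vn_opn
    using assms inj_image_subset_iff[OF inj] by (simp add: von_neumann_algebra_opn)
qed

lemma invariant_subalgebraE:
  assumes "invariant_subalgebra G P" obtains P' where "P = opn ` P'" "P' \<subseteq> Collect cbl"
  using assms bounded_ops_image[of P]
  unfolding invariant_subalgebra_def von_neumann_algebra_def by auto

end

lemma Wstar_equivalentI:
  fixes e :: "'c \<Rightarrow> 'a::group_add" and e' :: "'d \<Rightarrow> 'b::group_add"
    and \<psi> :: "('a l2 \<Rightarrow> 'a l2) \<Rightarrow> 'b l2 \<Rightarrow> 'b l2"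
  assumes G: "group_transport e G" and H: "group_transport e' H"
    and \<psi>: "bij_betw \<psi> Lvn Lvn"
    and add: "\<And>S T. S \<in> Lvn \<Longrightarrow> T \<in> Lvn \<Longrightarrow> \<psi> (\<lambda>a. S a + T a) = (\<lambda>a. \<psi> S a + \<psi> T a)"
    and scale: "\<And>c T. T \<in> Lvn \<Longrightarrow> \<psi> (\<lambda>a. c *\<^sub>C T a) = (\<lambda>a. c *\<^sub>C \<psi> T a)"
    and comp: "\<And>S T. S \<in> Lvn \<Longrightarrow> T \<in> Lvn \<Longrightarrow> \<psi> (S \<circ> T) = \<psi> S \<circ> \<psi> T"
    and adj: "\<And>T. T \<in> Lvn \<Longrightarrow> \<psi> (adjo T) = adjo (\<psi> T)"
  shows "Wstar_equivalent G H"
proof -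
  interpret G: group_transport e G by fact
  interpret H: group_transport e' H by fact
  define f where "f = inv_into UNIV G.opn"
  have f: "f (G.opn T) = T" for T
    unfolding f_def by (rule inv_f_f) (auto simp: inj_def intro: G.opn_inj)
  have "bij_betw (H.opn \<circ> \<psi> \<circ> f) (G.opn ` Lvn) (H.opn ` Lvn)"
  proof (intro bij_betw_trans)
    show "bij_betw f (G.opn ` Lvn) Lvn"
      by (rule bij_betw_byWitness[of _ G.opn]) (auto simp: f)
    show "bij_betw H.opn Lvn (H.opn ` Lvn)"
      by (auto simp: bij_betw_def inj_on_def intro: H.opn_inj)
  qed fact
  moreover have "\<psi> T \<in> Lvn" if "T \<in> Lvn" for T using \<psi> that bij_betwE by blast
  ultimately have "vn_isomorphism UNIV (G.opn ` Lvn) UNIV (H.opn ` Lvn) (H.opn \<circ> \<psi> \<circ> f)"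
    unfolding vn_isomorphism_def
    by (auto simp: G.op_add_opn H.op_add_opn G.op_scale_opn H.op_scale_opn G.compose_opn H.compose_opn
        G.op_adj_opn H.op_adj_opn f add scale comp adj Lvn_cbl)
  then show ?thesis
    unfolding Wstar_equivalent_def G.group_vn_opn H.group_vn_opn by auto
qed

section \<open>The real group ring\<close>

abbreviation lookup where "lookup \<equiv> Poly_Mapping.lookup"
abbreviation keys where "keys \<equiv> Poly_Mapping.keys"
abbreviation single where "single \<equiv> Poly_Mapping.single"
text \<open>The product of finitely supported functions over an additively written group is
  convolution, so the type is the group ring and \<open>u g\<close> are its canonical
  unitaries.\<close>

abbreviation u :: "'g \<Rightarrow> 'g \<Rightarrow>\<^sub>0 real" where "u g \<equiv> single g 1"

lemma poly_mapping_sum_single: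
  assumes "finite W" "keys a \<subseteq> W" shows "a = (\<Sum>k\<in>W. single k (lookup a k))"
proof (rule poly_mapping_eqI)
  fix x
  have "(\<Sum>k\<in>W. lookup (single k (lookup a k)) x) = (\<Sum>k\<in>W. if k = x then lookup a x else 0)"
    by (intro sum.cong) (auto simp: lookup_single when_def)
  then show "lookup a x = lookup (\<Sum>k\<in>W. single k (lookup a k)) x"
    using assms by (auto simp: lookup_sum in_keys_iff)
qed

lemma poly_mapping_induct_single [case_names single add]:
  assumes "\<And>k v. P (single k v)" "\<And>a b. P a \<Longrightarrow> P b \<Longrightarrow> P (a + b)"
  shows "P (a :: 'g \<Rightarrow>\<^sub>0 'v::comm_monoid_add)"
proof -
  have "P (\<Sum>k\<in>F. single k (lookup a k))" if "finite F" for F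
    using that
  proof induction
    case empty show ?case using assms(1)[of undefined 0] by simp
  qed (simp add: assms)
  from this[OF finite_keys, of a] show ?thesis
    by (subst poly_mapping_sum_single[OF finite_keys order_refl, of a])
qed

section \<open>Involution, trace and 2-norm on the group ring\<close>

definition star :: "('g::group_add \<Rightarrow>\<^sub>0 real) \<Rightarrow> 'g \<Rightarrow>\<^sub>0 real" where
  "star a = Poly_Mapping.map_key uminus a"

definition tr :: "('g::group_add \<Rightarrow>\<^sub>0 real) \<Rightarrow> real" where "tr a = lookup a 0"

lemma lookup_star [simp]: "lookup (star a) x = lookup a (- x)"
  by (simp add: star_def map_key.rep_eq)

lemma star_single [simp]: "star (single g r) = single (- g) r"
  by (rule poly_mapping_eqI) (auto simp: lookup_single when_def minus_equation_iff equation_minus_iff)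

lemma star_add [simp]: "star (a + b) = star a + star b" and star_diff [simp]: "star (a - b) = star a - star b"
  by (rule poly_mapping_eqI, simp add: lookup_add lookup_minus)+

lemma star_0 [simp]: "star 0 = 0" and star_1 [simp]: "star 1 = 1"
  by (rule poly_mapping_eqI, simp add: lookup_one when_def)+

lemma star_sum: "star (sum f A) = (\<Sum>i\<in>A. star (f i))"
  by (induction A rule: infinite_finite_induct) auto

lemma star_star [simp]: "star (star a) = a"
  by (rule poly_mapping_eqI) simp

lemma star_mult [simp]: "star (a * b) = star b * star a"
proof (induction a rule: poly_mapping_induct_single)
  case (single k v)
  show ?case
    by (induction b rule: poly_mapping_induct_single) (simp_all add: mult_single minus_add mult.commute algebra_simps)
qed (simp add: algebra_simps)

lemma tr_add [simp]: "tr (a + b) = tr a + tr b" and tr_diff [simp]: "tr (a - b) = tr a - tr b"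
  and tr_0 [simp]: "tr 0 = 0" and tr_1 [simp]: "tr 1 = 1" and tr_star [simp]: "tr (star a) = tr a"
  and tr_single: "tr (single g r) = (if g = 0 then r else 0)"
  by (simp_all add: tr_def lookup_add lookup_minus lookup_single when_def)

lemma tr_sum: "tr (sum f A) = (\<Sum>i\<in>A. tr (f i))"
  by (simp add: tr_def lookup_sum)

lemma tr_mult_commute: "tr (a * b) = tr (b * a)"
proof (induction a rule: poly_mapping_induct_single)
  case (single k v)
  have "k + l = 0 \<longleftrightarrow> l + k = 0" for l by (metis add.inverse_unique add.left_inverse add.right_inverse minus_minus)
  then show ?case
    by (induction b rule: poly_mapping_induct_single) (simp_all add: mult_single tr_single mult.commute algebra_simps)
qed (simp add: algebra_simps)

text \<open>The square of the 2-norm. The root is not taken, so estimates in the group ring are for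
  squares, and \<open>nrm_diff_le\<close>, from the parallelogram law, stands in for the triangle
  inequality.\<close>

definition nrm :: "('g::group_add \<Rightarrow>\<^sub>0 real) \<Rightarrow> real" where "nrm a = tr (a * star a)"

lemma tr_mult_star:
  assumes "finite W" "keys a \<subseteq> W" shows "tr (a * star b) = (\<Sum>k\<in>W. lookup a k * lookup b k)"
proof -
  have single: "tr (single k r * star b) = r * lookup b k" for k r
  proof (induction b rule: poly_mapping_induct_single)
    case (single l v)
    have "k - l = 0 \<longleftrightarrow> k = l" by simp
    then show ?case by (simp add: mult_single tr_single lookup_single when_def)
  qed (simp add: algebra_simps lookup_add)
  show ?thesis
    by (subst poly_mapping_sum_single[OF assms]) (simp add: sum_distrib_right tr_sum single)
qed

lemma nrm_eq: "nrm a = (\<Sum>k\<in>keys a. (lookup a k)\<^sup>2)"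
  by (simp add: nrm_def tr_mult_star[of "keys a"] power2_eq_square)

lemma nrm_nonneg [simp]: "nrm a \<ge> 0"
  by (simp add: nrm_eq sum_nonneg)

lemma nrm_diff_le: "nrm (a - b) \<le> 2 * nrm a + 2 * nrm b"
proof -
  have "nrm (a - b) + nrm (a + b) = 2 * nrm a + 2 * nrm b"
    by (simp add: nrm_def algebra_simps)
  then show ?thesis using nrm_nonneg[of "a + b"] by linarith
qed

definition uni :: "('g::group_add \<Rightarrow>\<^sub>0 real) \<Rightarrow> bool" where
  "uni a \<longleftrightarrow> a * star a = 1 \<and> star a * a = 1"

lemma uni_mult: "uni a \<Longrightarrow> uni b \<Longrightarrow> uni (a * b)"
  unfolding uni_def star_mult by (metis mult.assoc mult.right_neutral)

lemma uni_star: "uni a \<Longrightarrow> uni (star a)"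
  by (auto simp: uni_def)

lemma uni_1: "uni 1" by (simp add: uni_def)

lemma uni_u: "uni (u g)"
  by (simp add: uni_def mult_single single_one)

lemma nrm_mult_uni: "uni a \<Longrightarrow> nrm (a * b) = nrm b" "uni a \<Longrightarrow> nrm (b * a) = nrm b"
proof -
  assume a: "uni a"
  have "nrm (b * a) = tr (b * (a * star a) * star b)" by (simp add: nrm_def mult.assoc)
  then show "nrm (b * a) = nrm b" using a by (simp add: uni_def nrm_def)
  have "nrm (a * b) = tr ((a * (b * star b)) * star a)" by (simp add: nrm_def mult.assoc)
  also have "\<dots> = tr ((star a * a) * (b * star b))" by (subst tr_mult_commute) (simp add: mult.assoc)
  finally show "nrm (a * b) = nrm b" using a by (simp add: uni_def nrm_def)
qed

section \<open>Supports contained in subgroups\<close>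

definition subgrp :: "'g::group_add set \<Rightarrow> bool" where
  "subgrp W \<longleftrightarrow> 0 \<in> W \<and> (\<forall>x\<in>W. \<forall>y\<in>W. x + y \<in> W) \<and> (\<forall>x\<in>W. - x \<in> W)"

lemma subgrpD: "subgrp W \<Longrightarrow> 0 \<in> W" "subgrp W \<Longrightarrow> x \<in> W \<Longrightarrow> y \<in> W \<Longrightarrow> x + y \<in> W"
  "subgrp W \<Longrightarrow> x \<in> W \<Longrightarrow> - x \<in> W"
  by (auto simp: subgrp_def)

lemma keys_mult_subgrp: "subgrp W \<Longrightarrow> keys a \<subseteq> W \<Longrightarrow> keys b \<subseteq> W \<Longrightarrow> keys (a * b) \<subseteq> W"
  using keys_mult[of a b] by (force dest: subgrpD(2))

lemma keys_star_subgrp: "subgrp W \<Longrightarrow> keys a \<subseteq> W \<Longrightarrow> keys (star a) \<subseteq> W"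
  by (force simp: in_keys_iff subset_iff dest: subgrpD(3))

lemma keys_add_subset: "keys a \<subseteq> W \<Longrightarrow> keys b \<subseteq> W \<Longrightarrow> keys (a + b) \<subseteq> W"
  using keys_add[of a b] by blast

lemma keys_diff_subset: "keys a \<subseteq> W \<Longrightarrow> keys b \<subseteq> W \<Longrightarrow> keys (a - b) \<subseteq> W"
  for a b :: "'g \<Rightarrow>\<^sub>0 real"
  by (auto simp: in_keys_iff lookup_minus subset_iff) (metis diff_zero)

lemma keys_sum_subset: "(\<And>i. i \<in> A \<Longrightarrow> keys (f i) \<subseteq> W) \<Longrightarrow> keys (sum f A) \<subseteq> W"
  by (induction A rule: infinite_finite_induct) (simp_all add: keys_add_subset)

lemma keys_1_subgrp: "subgrp W \<Longrightarrow> keys (1 :: 'g::group_add \<Rightarrow>\<^sub>0 real) \<subseteq> W"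
  by (simp add: subgrpD)

lemma bij_betw_left_add:
  assumes "subgrp T" "x \<in> T" shows "bij_betw ((+) x) T T"
  by (rule bij_betw_byWitness[of _ "\<lambda>y. - x + y"])
    (use assms in \<open>auto simp: subgrpD add.assoc[symmetric]\<close>)

text \<open>The projections \<open>u k * p * u (- k)\<close> are pairwise orthogonal, so together with the
  \<open>u k\<close> they span a full matrix algebra indexed by \<open>T\<close>; permutations of \<open>T\<close> act in it
  as permutation matrices.\<close>

locale wandering =
  fixes T :: "'h::group_add set" and p :: "'h \<Rightarrow>\<^sub>0 real"
  assumes T: "subgrp T" "finite T"
    and p: "p * p = p" "star p = p"
    and wander: "k \<in> T \<Longrightarrow> k \<noteq> 0 \<Longrightarrow> p * u k * p = 0"
begin

text \<open>The elements \<open>u l * p * u (- k)\<close> are matrix units indexed by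
  \<open>T\<close>; this is the 0-1 matrix of the map \<open>v\<close>, and \<open>unit\<close> is
  the identity of the corner that they span.\<close>

definition pmat :: "('h \<Rightarrow> 'h) \<Rightarrow> 'h \<Rightarrow>\<^sub>0 real" where
  "pmat v = (\<Sum>k\<in>T. u (v k) * p * u (- k))"

abbreviation unit where "unit \<equiv> pmat id"

lemma middle: "k \<in> T \<Longrightarrow> l \<in> T \<Longrightarrow> p * u (- k) * u l * p = (if k = l then p else 0)"
  using wander[of "- k + l"] T p neg_eq_iff_add_eq_0[of "- k" l]
  by (auto simp: mult_single mult.assoc single_one subgrpD)

lemma pmat_mult:
  assumes w: "\<And>k. k \<in> T \<Longrightarrow> w k \<in> T"
  shows "pmat v * pmat w = pmat (v \<circ> w)"
proof -
  have "pmat v * pmat w = (\<Sum>l\<in>T. \<Sum>k\<in>T. u (v k) * (p * u (- k) * u (w l) * p) * u (- l))"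
    unfolding pmat_def sum_product by (subst sum.swap) (simp add: mult.assoc)
  also have "\<dots> = (\<Sum>l\<in>T. \<Sum>k\<in>T. if k = w l then u (v k) * p * u (- l) else 0)"
    by (intro sum.cong refl) (simp add: middle w)
  also have "\<dots> = pmat (v \<circ> w)"
    unfolding pmat_def by (intro sum.cong refl) (simp add: T w)
  finally show ?thesis .
qed

lemma star_pmat:
  assumes v: "bij_betw v T T" shows "star (pmat v) = pmat (inv_into T v)"
proof -
  have "star (pmat v) = (\<Sum>k\<in>T. u k * p * u (- v k))"
    by (simp add: pmat_def star_sum p mult.assoc)
  also have "\<dots> = (\<Sum>k\<in>T. (\<lambda>l. u (inv_into T v l) * p * u (- l)) (v k))"
    using v by (intro sum.cong) (auto simp: bij_betw_inv_into_left)
  also have "\<dots> = pmat (inv_into T v)"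
    unfolding pmat_def by (rule sum.reindex_bij_betw[OF v])
  finally show ?thesis .
qed

lemma pmat_cong: "(\<And>k. k \<in> T \<Longrightarrow> v k = w k) \<Longrightarrow> pmat v = pmat w"
  by (simp add: pmat_def)

lemma star_unit: "star unit = unit"
proof -
  have "inv_into T id k = k" if "k \<in> T" for k using inv_into_f_f[of id T k] that by simp
  then show ?thesis using star_pmat[of id] pmat_cong[of "inv_into T id" id] by simp
qed

text \<open>A permutation matrix is unitary in the corner cut out by \<open>unit\<close>; adding the
  complementary projection makes it unitary in the whole group ring.\<close>

lemma pmat_unitary:
  assumes v: "bij_betw v T T" shows "uni (pmat v + (1 - unit))"
proof -
  define w where "w = inv_into T v"
  have vT: "\<And>k. k \<in> T \<Longrightarrow> v k \<in> T" and wT: "\<And>k. k \<in> T \<Longrightarrow> w k \<in> T"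
    using v bij_betwE[OF bij_betw_inv_into[OF v]] by (auto simp: w_def dest: bij_betwE)
  have m: "pmat v * pmat w = unit" "pmat w * pmat v = unit"
    using v vT wT by (auto simp: pmat_mult w_def bij_betw_inv_into_left bij_betw_inv_into_right intro!: pmat_cong)
  have i: "pmat x * unit = pmat x" "unit * unit = unit" "unit * pmat v = pmat v" "unit * pmat w = pmat w" for x
    using vT wT by (simp_all add: pmat_mult)
  have s: "star (pmat v) = pmat w" "star unit = unit"
    using star_pmat[OF v] star_unit by (simp_all add: w_def)
  show ?thesis
    by (simp add: uni_def s algebra_simps m i)
qed

lemma pmat_shift:
  assumes x: "x \<in> T" and v: "\<And>k. k \<in> T \<Longrightarrow> v (x + k) = y + v k"
  shows "pmat v * u x = u y * pmat v"
proof -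
  have "pmat v * u x = (\<Sum>k\<in>T. u (v k) * p * u (- k + x))"
    by (simp add: pmat_def sum_distrib_right mult_single mult.assoc)
  also have "\<dots> = (\<Sum>k\<in>T. u (v (x + k)) * p * u (- (x + k) + x))"
    by (rule sum.reindex_bij_betw[OF bij_betw_left_add[OF T(1) x], symmetric])
  also have "\<dots> = (\<Sum>k\<in>T. u (y + v k) * p * u (- k))"
    by (intro sum.cong refl) (simp add: v minus_add add.assoc)
  also have "\<dots> = u y * pmat v"
    by (simp add: pmat_def sum_distrib_left mult.assoc[symmetric] mult_single)
  finally show ?thesis .
qed

lemma unit_commute: "x \<in> T \<Longrightarrow> unit * u x = u x * unit"
  by (rule pmat_shift) auto

text \<open>Inside the corner the intertwining is exact by \<open>pmat_shift\<close>. On the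
  complement the unitary acts as the identity, where \<open>u x\<close> and \<open>u y\<close> are
  not intertwined, and only their difference survives.\<close>

lemma conj_defect:
  assumes "x \<in> T" "y \<in> T" and v: "\<And>k. k \<in> T \<Longrightarrow> v (x + k) = y + v k"
  shows "(pmat v + (1 - unit)) * u x - u y * (pmat v + (1 - unit)) = (1 - unit) * (u x - u y)"
  using pmat_shift[of x v y] assms(1) v unit_commute[OF assms(2)] by (simp add: algebra_simps)

text \<open>\<open>1 - unit\<close> is a projection, so its squared 2-norm is its trace, and each
  conjugate of \<open>p\<close> contributes \<open>tr p\<close> to the trace of
  \<open>unit\<close>.\<close>

lemma nrm_defect: "nrm (1 - unit) = 1 - real (card T) * tr p"
proof -
  have "tr (u k * p * u (- k)) = tr p" for k
    by (subst tr_mult_commute) (simp add: mult.assoc[symmetric] mult_single single_one)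
  then have "tr unit = real (card T) * tr p" by (simp add: pmat_def tr_sum)
  then show ?thesis by (simp add: nrm_def star_unit algebra_simps pmat_mult)
qed

lemma keys_pmat:
  assumes "subgrp W" "keys p \<subseteq> W" "T \<subseteq> W" "\<And>k. k \<in> T \<Longrightarrow> v k \<in> W"
  shows "keys (pmat v) \<subseteq> W"
  unfolding pmat_def using assms
  by (intro keys_sum_subset keys_mult_subgrp) (auto simp: subgrpD)

end

section \<open>Linear extension of maps between groups\<close>

definition push :: "('g \<Rightarrow> 'h) \<Rightarrow> ('g \<Rightarrow>\<^sub>0 real) \<Rightarrow> 'h \<Rightarrow>\<^sub>0 real" where
  "push \<phi> a = (\<Sum>k\<in>keys a. single (\<phi> k) (lookup a k))"

lemma push_eq:
  assumes "finite W" "keys a \<subseteq> W" shows "push \<phi> a = (\<Sum>k\<in>W. single (\<phi> k) (lookup a k))"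
  unfolding push_def by (rule sum.mono_neutral_left) (use assms in \<open>auto simp: in_keys_iff\<close>)

lemma push_add: "push \<phi> (a + b) = push \<phi> a + push \<phi> b"
  using keys_add[of a b]
  by (simp add: push_eq[of "keys a \<union> keys b"] lookup_add single_add sum.distrib)

lemma push_single [simp]: "push \<phi> (single k r) = single (\<phi> k) r"
  by (simp add: push_def)

lemma push_0 [simp]: "push \<phi> 0 = 0"
  by (simp add: push_def)

lemma push_sum: "push \<phi> (sum f A) = (\<Sum>i\<in>A. push \<phi> (f i))"
  by (induction A rule: infinite_finite_induct) (simp_all add: push_add)

lemma push_push: "push \<psi> (push \<phi> a) = push (\<psi> \<circ> \<phi>) a"
  by (simp add: push_def[of \<phi>] push_sum) (simp add: push_def)

lemma push_id: "(\<And>k. k \<in> keys a \<Longrightarrow> \<phi> k = k) \<Longrightarrow> push \<phi> a = a"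
  using poly_mapping_sum_single[OF finite_keys order_refl, of a] by (simp add: push_def)

lemma keys_push: "keys (push \<phi> a) \<subseteq> \<phi> ` keys a"
  unfolding push_def by (rule keys_sum_subset) auto

text \<open>Relative to a subset because \<open>to_al s\<close> is meaningful only on matrices that
  the coordinate permutation brings into the affine group; elsewhere its value is arbitrary.\<close>

definition hom_on :: "'g::group_add set \<Rightarrow> ('g \<Rightarrow> 'h::group_add) \<Rightarrow> bool" where
  "hom_on W \<phi> \<longleftrightarrow> (\<forall>x\<in>W. \<forall>y\<in>W. \<phi> (x + y) = \<phi> x + \<phi> y)"

lemma hom_on_0: "subgrp W \<Longrightarrow> hom_on W \<phi> \<Longrightarrow> \<phi> 0 = 0"
  using add_left_cancel[of "\<phi> 0" "\<phi> 0" 0] unfolding hom_on_def subgrp_def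
  by (metis add.right_neutral)

lemma hom_on_uminus: "subgrp W \<Longrightarrow> hom_on W \<phi> \<Longrightarrow> x \<in> W \<Longrightarrow> \<phi> (- x) = - \<phi> x"
proof -
  assume *: "subgrp W" "hom_on W \<phi>" "x \<in> W"
  then have "\<phi> (- x + x) = \<phi> (- x) + \<phi> x" by (simp add: hom_on_def subgrpD del: add.left_inverse)
  then show ?thesis using hom_on_0[OF *(1,2)] by (simp add: eq_neg_iff_add_eq_0)
qed

lemma push_mult:
  assumes "hom_on W \<phi>" "keys a \<subseteq> W" "keys b \<subseteq> W"
  shows "push \<phi> (a * b) = push \<phi> a * push \<phi> b"
proof -
  have "a * b = (\<Sum>k\<in>keys a. \<Sum>l\<in>keys b. single (k + l) (lookup a k * lookup b l))"
    by (subst poly_mapping_sum_single[OF finite_keys order_refl, of a],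
        subst poly_mapping_sum_single[OF finite_keys order_refl, of b])
      (simp add: sum_product mult_single)
  then show ?thesis
    using assms by (auto simp: push_sum push_def[of \<phi> a] push_def[of \<phi> b] sum_product mult_single hom_on_def
        subset_iff intro!: sum.cong)
qed

lemma push_star:
  assumes "subgrp W" "hom_on W \<phi>" "keys a \<subseteq> W"
  shows "push \<phi> (star a) = star (push \<phi> a)"
proof -
  have "star a = (\<Sum>k\<in>keys a. single (- k) (lookup a k))"
    by (subst poly_mapping_sum_single[OF finite_keys order_refl, of a]) (simp add: star_sum)
  then show ?thesis
    using assms by (auto simp: push_sum push_def[of \<phi> a] star_sum hom_on_uminus subset_iff intro!: sum.cong)
qed

lemma push_one: "subgrp W \<Longrightarrow> hom_on W \<phi> \<Longrightarrow> push \<phi> 1 = 1"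
  using hom_on_0[of W \<phi>] push_single[of \<phi> 0 1] by simp

lemma push_uni:
  assumes "subgrp W" "hom_on W \<phi>" "keys a \<subseteq> W" "uni a"
  shows "uni (push \<phi> a)"
proof -
  show ?thesis
    using assms push_one[OF assms(1,2)] push_mult[OF assms(2)] keys_star_subgrp[OF assms(1,3)] unfolding uni_def
    by (metis push_star)
qed

text \<open>Left translation through an injective homomorphism is a free action, so \<open>X\<close>
  and \<open>Y\<close> are unions of orbits that all have the size of \<open>W\<close>. Equal
  cardinality gives equally many orbits, and they are matched one at a time by induction.\<close>

lemma equivariant_bijection:
  fixes \<alpha> \<beta> :: "'g::group_add \<Rightarrow> 'h::group_add"
  assumes W: "subgrp W" "hom_on W \<alpha>" "inj_on \<alpha> W" "hom_on W \<beta>" "inj_on \<beta> W"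
    and X: "finite X" "finite Y" "card X = card Y"
      "\<And>w x. w \<in> W \<Longrightarrow> x \<in> X \<Longrightarrow> \<alpha> w + x \<in> X" "\<And>w x. w \<in> W \<Longrightarrow> x \<in> Y \<Longrightarrow> \<beta> w + x \<in> Y"
  shows "\<exists>v. bij_betw v X Y \<and> (\<forall>w\<in>W. \<forall>x\<in>X. v (\<alpha> w + x) = \<beta> w + v x)"
  using X
proof (induction "card X" arbitrary: X Y rule: less_induct)
  case less
  show ?case
  proof (cases "X = {}")
    case True
    then show ?thesis using less.prems by (auto simp: bij_betw_def)
  next
    case False
    then have "Y \<noteq> {}" using less.prems(1-3) by auto
    then obtain x y where xy: "x \<in> X" "y \<in> Y" using False by blast
    define A B where "A = (\<lambda>w. \<alpha> w + x) ` W" and "B = (\<lambda>w. \<beta> w + y) ` W"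
    have sub: "A \<subseteq> X" "B \<subseteq> Y" using less.prems xy by (auto simp: A_def B_def)
    have inj: "inj_on (\<lambda>w. \<alpha> w + x) W" "inj_on (\<lambda>w. \<beta> w + y) W"
      using W(3,5) by (auto simp: inj_on_def)
    have card: "card A = card W" "card B = card W" by (simp_all add: A_def B_def card_image inj)
    have fin: "finite A" "finite B" using sub less.prems finite_subset by blast+
    have xA: "x \<in> A" using hom_on_0[OF W(1,2)] subgrpD(1)[OF W(1)] by (force simp: A_def)
    \<comment> \<open>Orbits are closed under translating back as well, so the complement of an
      orbit is again invariant.\<close>
    have closed: "k \<in> Z" if w: "w \<in> W" and wk: "\<gamma> w + k \<in> (\<lambda>w. \<gamma> w + z) ` W" and h: "hom_on W \<gamma>"
      and Z: "(\<lambda>w. \<gamma> w + z) ` W = Z" for w k \<gamma> z and Z :: "'h set"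
    proof -
      obtain w' where w': "w' \<in> W" "\<gamma> w + k = \<gamma> w' + z" using wk by blast
      have "k = - \<gamma> w + (\<gamma> w' + z)" by (simp add: w'(2)[symmetric] add.assoc[symmetric])
      also have "\<dots> = \<gamma> (- w + w') + z"
      proof -
        have "\<gamma> (- w + w') = - \<gamma> w + \<gamma> w'"
          using h w' subgrpD(3)[OF W(1) w] hom_on_uminus[OF W(1) h w] by (simp add: hom_on_def)
        then show ?thesis by (simp only: add.assoc)
      qed
      finally show ?thesis using Z w' w W(1) by (auto simp: subgrpD)
    qed
    have clA: "k \<in> A" if "w \<in> W" "\<alpha> w + k \<in> A" for w k
      using closed[OF that(1) _ W(2) refl] that(2) unfolding A_def .
    have clB: "k \<in> B" if "w \<in> W" "\<beta> w + k \<in> B" for w k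
      using closed[OF that(1) _ W(4) refl] that(2) unfolding B_def .
    have "card (X - A) < card X" using xA xy less.prems by (intro psubset_card_mono) auto
    moreover have "finite (X - A)" "finite (Y - B)" using less.prems by simp_all
    moreover have "card (X - A) = card (Y - B)"
      using sub fin card less.prems by (simp add: card_Diff_subset)
    moreover have "\<alpha> w + k \<in> X - A" if "w \<in> W" "k \<in> X - A" for w k
      using that less.prems(4)[of w k] clA[OF that(1), of k] by blast
    moreover have "\<beta> w + k \<in> Y - B" if "w \<in> W" "k \<in> Y - B" for w k
      using that less.prems(5)[of w k] clB[OF that(1), of k] by blast
    ultimately have "\<exists>v. bij_betw v (X - A) (Y - B) \<and> (\<forall>w\<in>W. \<forall>k\<in>X - A. v (\<alpha> w + k) = \<beta> w + v k)"
      by (rule less.hyps)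
    then obtain v where v: "bij_betw v (X - A) (Y - B)"
        "\<forall>w\<in>W. \<forall>k\<in>X - A. v (\<alpha> w + k) = \<beta> w + v k" by blast
    \<comment> \<open>The inverse of the orbit map: it recovers the group element from a point of
      the orbit of \<open>x\<close>.\<close>
    define i where "i = inv_into W (\<lambda>w. \<alpha> w + x)"
    have i: "i (\<alpha> w + x) = w" if "w \<in> W" for w
      unfolding i_def using inv_into_f_f[OF inj(1) that] .
    define v' where "v' k = (if k \<in> A then \<beta> (i k) + y else v k)" for k
    have "bij_betw v' A B"
    proof (rule bij_betw_cong[THEN iffD1])
      show "bij_betw ((\<lambda>w. \<beta> w + y) \<circ> i) A B"
      proof (rule bij_betw_trans)
        show "bij_betw i A W"
          unfolding i_def A_def by (intro bij_betw_inv_into inj_on_imp_bij_betw inj)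
        show "bij_betw (\<lambda>w. \<beta> w + y) W B"
          unfolding B_def by (intro inj_on_imp_bij_betw inj)
      qed
    qed (simp add: v'_def)
    moreover have "bij_betw v' (X - A) (Y - B)"
      by (rule bij_betw_cong[THEN iffD1, OF _ v(1)]) (simp add: v'_def)
    ultimately have "bij_betw v' (A \<union> (X - A)) (B \<union> (Y - B))"
      by (rule bij_betw_combine) auto
    then have "bij_betw v' X Y" using sub by (simp add: Un_absorb1)
    moreover have "v' (\<alpha> w + k) = \<beta> w + v' k" if w: "w \<in> W" and k: "k \<in> X" for w k
    proof (cases "k \<in> A")
      case True
      then obtain w' where w': "w' \<in> W" "k = \<alpha> w' + x" by (auto simp: A_def)
      have ww: "w + w' \<in> W" using W(1) w w' by (simp add: subgrpD)
      have "\<alpha> w + k = \<alpha> (w + w') + x" using W(2) w w' by (simp add: hom_on_def add.assoc)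
      then have "v' (\<alpha> w + k) = \<beta> (w + w') + y" using ww i[OF ww] by (simp add: v'_def A_def)
      moreover have "v' k = \<beta> w' + y" using True i[OF w'(1)] w'(2) by (simp add: v'_def)
      ultimately show ?thesis using W(4) w w' by (simp add: hom_on_def add.assoc)
    next
      case False
      then have "\<alpha> w + k \<notin> A" using clA[OF w, of k] by blast
      then show ?thesis using False v(2) w k by (simp add: v'_def)
    qed
    ultimately show ?thesis by blast
  qed
qed

text \<open>The unitary comes from an equivariant permutation of \<open>T\<close>, so the two
  embeddings are intertwined exactly on the corner. The remaining error has \<open>1 - unit\<close>
  as a factor. Since \<open>push\<close> keeps unitaries unitary, its squared norm is at most
  \<open>2 + 2\<close> times that of \<open>1 - unit\<close>, for all unitaries \<open>y\<close> of
  the group ring of \<open>W\<close> at once and not only for group elements.\<close>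

lemma approx_conjugate:
  assumes W: "subgrp W" "hom_on W \<alpha>" "inj_on \<alpha> W" "hom_on W \<beta>" "inj_on \<beta> W"
    and sub: "\<alpha> ` W \<subseteq> T" "\<beta> ` W \<subseteq> T" and wan: "wandering T p"
    and W': "subgrp W'" "T \<subseteq> W'" "keys p \<subseteq> W'"
    and e: "1 - real (card T) * tr p \<le> e"
  shows "\<exists>v. uni v \<and> keys v \<subseteq> W' \<and>
    (\<forall>y. keys y \<subseteq> W \<and> uni y \<longrightarrow> nrm (v * push \<alpha> y * star v - push \<beta> y) \<le> 4 * e)"
proof -
  interpret wandering T p by (rule wan)
  have "\<exists>v. bij_betw v T T \<and> (\<forall>w\<in>W. \<forall>x\<in>T. v (\<alpha> w + x) = \<beta> w + v x)"
    by (rule equivariant_bijection[OF W T(2) T(2) refl]) (use sub subgrpD(2)[OF T(1)] in auto)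
  then obtain v where v: "bij_betw v T T" "\<And>w x. w \<in> W \<Longrightarrow> x \<in> T \<Longrightarrow> v (\<alpha> w + x) = \<beta> w + v x"
    by blast
  define V where "V = pmat v + (1 - unit)"
  have uV: "uni V" unfolding V_def by (rule pmat_unitary[OF v(1)])
  have kV: "keys V \<subseteq> W'"
    unfolding V_def using v(1) W' keys_1_subgrp[OF W'(1)]
    by (intro keys_add_subset keys_diff_subset keys_pmat) (auto dest: bij_betwE)
  have defect: "V * push \<alpha> y - push \<beta> y * V = (1 - unit) * (push \<alpha> y - push \<beta> y)" if "keys y \<subseteq> W" for y
  proof -
    have "V * u (\<alpha> k) - u (\<beta> k) * V = (1 - unit) * (u (\<alpha> k) - u (\<beta> k))" if "k \<in> W" for k
      unfolding V_def using that sub v(2)[OF that] by (intro conj_defect) auto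
    \<comment> \<open>The identity passes from group elements to their multiples by
      \<open>?c\<close>, a scalar written as a central element of the group ring.\<close>
    then have *: "V * single (\<alpha> k) r - single (\<beta> k) r * V = (1 - unit) * (single (\<alpha> k) r - single (\<beta> k) r)"
      if "k \<in> W" for k r
    proof -
      let ?c = "single 0 r :: 'b \<Rightarrow>\<^sub>0 real"
      have c: "?c * a = a * ?c" for a
        by (induction a rule: poly_mapping_induct_single) (simp_all add: mult_single mult.commute algebra_simps)
      have s: "single h r = ?c * u h" for h by (simp add: mult_single)
      have m: "a * (?c * b) = ?c * (a * b)" for a b by (simp only: mult.assoc[symmetric] c[of a])
      have "V * single (\<alpha> k) r - single (\<beta> k) r * V = ?c * (V * u (\<alpha> k) - u (\<beta> k) * V)"
        unfolding s[of "\<alpha> k"] s[of "\<beta> k"] by (simp only: m right_diff_distrib mult.assoc)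
      also have "\<dots> = (1 - unit) * (?c * u (\<alpha> k) - ?c * u (\<beta> k))"
        using \<open>k \<in> W\<close> \<open>\<And>k. k \<in> W \<Longrightarrow> V * u (\<alpha> k) - u (\<beta> k) * V = (1 - unit) * (u (\<alpha> k) - u (\<beta> k))\<close>
        by (simp only: m right_diff_distrib)
      finally show ?thesis unfolding s[of "\<alpha> k", symmetric] s[of "\<beta> k", symmetric] .
    qed
    have "V * push \<alpha> y - push \<beta> y * V
        = (\<Sum>k\<in>keys y. V * single (\<alpha> k) (lookup y k) - single (\<beta> k) (lookup y k) * V)"
      by (simp add: push_def sum_distrib_left sum_distrib_right sum_subtractf)
    also have "\<dots> = (\<Sum>k\<in>keys y. (1 - unit) * (single (\<alpha> k) (lookup y k) - single (\<beta> k) (lookup y k)))"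
      using that * by (intro sum.cong) auto
    also have "\<dots> = (1 - unit) * (push \<alpha> y - push \<beta> y)"
      by (simp add: push_def sum_distrib_left[symmetric] sum_subtractf)
    finally show ?thesis .
  qed
  have "nrm (V * push \<alpha> y * star V - push \<beta> y) \<le> 4 * e" if y: "keys y \<subseteq> W" "uni y" for y
  proof -
    have "V * push \<alpha> y * star V - push \<beta> y = (V * push \<alpha> y - push \<beta> y * V) * star V"
      using uV by (simp add: uni_def left_diff_distrib mult.assoc)
    then have "nrm (V * push \<alpha> y * star V - push \<beta> y) = nrm ((1 - unit) * push \<alpha> y - (1 - unit) * push \<beta> y)"
      using nrm_mult_uni(2)[OF uni_star[OF uV]] defect[OF y(1)] by (simp add: right_diff_distrib)
    also have "\<dots> \<le> 2 * nrm ((1 - unit) * push \<alpha> y) + 2 * nrm ((1 - unit) * push \<beta> y)"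
      by (rule nrm_diff_le)
    also have "\<dots> = 4 * nrm (1 - unit)"
      by (simp add: nrm_mult_uni(2)[OF push_uni[OF W(1,2) y]] nrm_mult_uni(2)[OF push_uni[OF W(1,4) y]])
    finally show ?thesis using e by (simp add: nrm_defect)
  qed
  then show ?thesis using uV kV by blast
qed

section \<open>Group ring elements as operators\<close>

definition Lop :: "('g::group_add \<Rightarrow>\<^sub>0 real) \<Rightarrow> 'g l2 \<Rightarrow> 'g l2" where
  "Lop a x = (\<Sum>k\<in>keys a. complex_of_real (lookup a k) *\<^sub>C lam k x)"

lemma Lop_eq:
  assumes "finite W" "keys a \<subseteq> W" shows "Lop a x = (\<Sum>k\<in>W. complex_of_real (lookup a k) *\<^sub>C lam k x)"
  unfolding Lop_def by (rule sum.mono_neutral_left) (use assms in \<open>auto simp: in_keys_iff\<close>)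

lemma Lop_single [simp]: "Lop (single k r) x = complex_of_real r *\<^sub>C lam k x"
  by (simp add: Lop_def)

lemma Lop_add: "Lop (a + b) x = Lop a x + Lop b x"
  using keys_add[of a b]
  by (simp add: Lop_eq[of "keys a \<union> keys b"] lookup_add scaleC_distrib sum.distrib)

lemma cbl_Lop: "cbl (Lop a)"
proof (induction a rule: poly_mapping_induct_single)
  case (single k v)
  have "Lop (single k v) = (\<lambda>x. complex_of_real v *\<^sub>C lam k x)" by (rule ext) simp
  then show ?case using cbl_cmult[OF cbl_lam] by metis
next
  case (add a b)
  then show ?case using cbl_plus[of "Lop a" "Lop b"] by (simp add: Lop_add[abs_def])
qed

lemma Lop_mult: "Lop (a * b) x = Lop a (Lop b x)"
proof (induction a rule: poly_mapping_induct_single)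
  case (single k v)
  show ?case
    by (induction b rule: poly_mapping_induct_single)
      (simp_all add: mult_single cbl_scaleC cbl_add Lop_add algebra_simps scaleC_distrib)
qed (simp add: algebra_simps Lop_add)

lemma Lop_1 [simp]: "Lop 1 x = x"
  using Lop_single[of 0 1 x] by simp

lemma Lop_rho: "Lop a (rho h x) = rho h (Lop a x)"
  by (simp add: Lop_def lam_rho cbl_sum cbl_scaleC)

lemma adjo_Lop: "adjo (Lop a) = Lop (star a)"
proof (rule adjo_unique[OF cbl_Lop, symmetric])
  fix x y
  show "cinner (Lop a x) y = cinner x (Lop (star a) y)"
  proof (induction a rule: poly_mapping_induct_single)
    case (single k v)
    have "cinner (lam k x) y = cinner x (lam (- k) y)" using adjo[OF cbl_lam] by (simp add: adjo_lam)
    then show ?case by (simp add: cinner_simps)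
  qed (simp add: Lop_add cinner_simps)
qed

lemma cinner_Lop: "cinner (Lop a x) y = cinner x (Lop (star a) y)"
  using adjo[OF cbl_Lop] by (simp add: adjo_Lop)

lemma norm_Lop_uni: "uni a \<Longrightarrow> norm (Lop a x) = norm x"
proof -
  assume a: "uni a"
  have "cinner (Lop a x) (Lop a x) = cinner x x"
    using a by (simp add: cinner_Lop Lop_mult[symmetric] uni_def)
  then have "complex_of_real ((norm (Lop a x))\<^sup>2) = of_real ((norm x)\<^sup>2)" by (simp only: cinner_norm)
  then have "(norm (Lop a x))\<^sup>2 = (norm x)\<^sup>2" using of_real_eq_iff by blast
  then show ?thesis by simp
qed

abbreviation emb :: "('g::group_add \<Rightarrow>\<^sub>0 real) \<Rightarrow> 'g l2" where "emb a \<equiv> Lop a (bv 0)"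

lemma coord_emb: "coord (emb a) x = of_real (lookup a x)"
  by (induction a rule: poly_mapping_induct_single)
    (auto simp: coord_bv lookup_single when_def Lop_add lookup_add)

lemma cinner_emb: "cinner (emb a) (emb b) = of_real (tr (star b * a))"
proof -
  have "cinner (emb a) (emb b) = cinner (emb (star b * a)) (bv 0)"
    using cinner_Lop[of "star b"] by (simp add: Lop_mult)
  then show ?thesis by (simp add: cinner_bv coord_emb tr_def)
qed

text \<open>Relates the squared 2-norm computed in the group ring to the Hilbert space norm in which
  limits are taken.\<close>

lemma norm_emb: "(norm (emb a))\<^sup>2 = nrm a"
proof -
  have "complex_of_real ((norm (emb a))\<^sup>2) = of_real (nrm a)"
    unfolding cinner_norm[symmetric] by (simp add: cinner_emb nrm_def tr_mult_commute)
  then show ?thesis using of_real_eq_iff by blast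
qed

lemma Lop_diff: "Lop (a - b) x = Lop a x - Lop b x"
  using Lop_add[of "a - b" b x] by (simp add: algebra_simps)

section \<open>Unitary operators from orthonormal bases\<close>

text \<open>Totality is phrased as a closed-subspace principle so that it can be used like
  \<open>dense_bv\<close>. The basis is indexed by the type underlying the other Hilbert space,
  which makes \<open>U\<close> a unitary between the two.\<close>

locale orthonormal_basis =
  fixes \<eta> :: "'g \<Rightarrow> 'h l2"
  assumes ortho: "cinner (\<eta> g) (\<eta> g') = (if g = g' then 1 else 0)"
    and total: "csubspace S \<Longrightarrow> closed S \<Longrightarrow> range \<eta> \<subseteq> S \<Longrightarrow> a \<in> S"
begin

definition U :: "'h l2 \<Rightarrow> 'g l2" where "U z = Abs_l2 (\<lambda>g. cinner z (\<eta> g))"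

text \<open>\<open>a\<close> is the projection of \<open>z\<close> to the span of the
  \<open>\<eta> g\<close> with \<open>g\<close> in \<open>F\<close>; Cauchy-Schwarz for
  \<open>z\<close> and \<open>a\<close> shows that it is no longer than \<open>z\<close>.\<close>

lemma Bessel:
  assumes F: "finite F"
  shows "(\<Sum>g\<in>F. (cmod (cinner z (\<eta> g)))\<^sup>2) \<le> (norm z)\<^sup>2"
proof -
  define c where "c g = cinner z (\<eta> g)" for g
  define a where "a = (\<Sum>g\<in>F. c g *\<^sub>C \<eta> g)"
  define S where "S = (\<Sum>g\<in>F. (cmod (c g))\<^sup>2)"
  have S0: "S \<ge> 0" by (simp add: S_def sum_nonneg)
  have za: "cinner z a = of_real S"
    by (simp add: a_def cinner_sum S_def c_def[symmetric] mult_cnj_cmod mult.commute)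
  have "cinner (\<eta> g) a = (\<Sum>g'\<in>F. if g = g' then cnj (c g') else 0)" for g
    unfolding a_def cinner_sum by (intro sum.cong) (auto simp: ortho)
  then have "cinner (\<eta> g) a = cnj (c g)" if "g \<in> F" for g using that F by simp
  then have "cinner a (\<eta> g) = c g" if "g \<in> F" for g
    using that cinner_commute[of a "\<eta> g"] by simp
  then have "cinner a a = of_real S"
    by (subst (2) a_def) (simp add: cinner_sum S_def mult_cnj_cmod mult.commute)
  then have aa: "(norm a)\<^sup>2 = S" unfolding cinner_norm using of_real_eq_iff by blast
  have "S \<le> norm z * norm a" using cinner_Cauchy_Schwarz[of z a] S0 by (simp add: za)
  then have "norm a * norm a \<le> norm z * norm a" using aa by (simp add: power2_eq_square)
  then have "norm a \<le> norm z" by (cases "norm a = 0") (simp_all add: mult_le_cancel_right)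
  then have "(norm a)\<^sup>2 \<le> (norm z)\<^sup>2" by (simp add: power_mono)
  then show ?thesis by (simp add: aa S_def c_def)
qed

lemma coord_U: "coord (U z) g = cinner z (\<eta> g)"
  using summable_squares_of_bounded(1)[OF Bessel[of _ z]] unfolding U_def by (simp add: Abs_l2_inverse)

lemma cbl_U: "cbl U"
proof (rule cbl_intro[of _ 1])
  show "norm (U a) \<le> 1 * norm a" for a
    using summable_squares_of_bounded(2)[OF Bessel[of _ a]]
    by (simp add: norm_l2_sq[of "U a", symmetric] coord_U[symmetric] power2_le_iff_abs_le)
qed (auto intro!: l2_eqI simp: coord_U cinner_simps)

abbreviation "V \<equiv> adjo U"

lemma cbl_V: "cbl V"
  by (rule cbl_adjo[OF cbl_U])

lemma V_bv [simp]: "V (bv g) = \<eta> g"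
proof (rule l2_eqI)
  fix x
  have "coord (V (bv g)) x = cnj (coord (U (bv x)) g)"
    unfolding coord_adjo[OF cbl_U] by (subst cinner_commute) (simp add: cinner_bv)
  also have "\<dots> = coord (\<eta> g) x"
    unfolding coord_U by (subst cinner_commute) (simp add: cinner_bv)
  finally show "coord (V (bv g)) x = coord (\<eta> g) x" .
qed

lemma U_\<eta> [simp]: "U (\<eta> g) = bv g"
  by (rule l2_eqI) (auto simp: coord_U ortho coord_bv)

lemma V_U [simp]: "V (U z) = z"
proof -
  have "z \<in> {a. (V \<circ> U) a = id a}"
    by (rule total[OF csubspace_cbl_eq[OF cbl_comp[OF cbl_V cbl_U] cbl_id(1)]]) auto
  then show ?thesis by simp
qed

lemma U_V [simp]: "U (V a) = a"
  using cbl_eqI[OF cbl_comp[OF cbl_U cbl_V] cbl_id(1)] by (simp add: fun_eq_iff)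

lemma norm_U [simp]: "norm (U z) = norm z"
proof -
  have "complex_of_real ((norm (U z))\<^sup>2) = of_real ((norm z)\<^sup>2)"
    unfolding cinner_norm[symmetric] using adjo[OF cbl_U, of z "U z"] by simp
  then have "(norm (U z))\<^sup>2 = (norm z)\<^sup>2" using of_real_eq_iff by blast
  then show ?thesis by simp
qed

end

section \<open>Limits of approximately compatible towers\<close>

lemma half_power_sum_le: "(\<Sum>i<k. (1/2::real) ^ (n + i)) \<le> 2 * (1/2) ^ n"
proof -
  have "(\<Sum>i<k. (1/2::real) ^ (n + i)) = (1/2) ^ n * (\<Sum>i<k. (1/2) ^ i)"
    by (simp add: power_add sum_distrib_left)
  also have "(\<Sum>i<k. (1/2::real) ^ i) \<le> 2" by (simp add: geometric_sum)
  finally show ?thesis by simp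
qed

text \<open>\<open>\<phi> n\<close> embeds the stage \<open>W n\<close> in the other group. The
  images increase, but the embeddings are not restrictions of each other; \<open>v (Suc n)\<close>
  nearly conjugates the new one to the old one. The bound is required for all unitaries of the group
  ring of \<open>W n\<close>, because the totality of the limit vectors uses it beyond group
  elements.\<close>

locale tower =
  fixes W :: "nat \<Rightarrow> 'g::group_add set" and \<phi> :: "nat \<Rightarrow> 'g \<Rightarrow> 'h::group_add"
    and v :: "nat \<Rightarrow> 'h \<Rightarrow>\<^sub>0 real"
  assumes W: "subgrp (W n)" "W n \<subseteq> W (Suc n)" "\<exists>n. g \<in> W n"
    and \<phi>: "hom_on (W n) (\<phi> n)" "inj_on (\<phi> n) (W n)"
      "\<phi> n ` W n \<subseteq> \<phi> (Suc n) ` W (Suc n)" "\<exists>n. h \<in> \<phi> n ` W n"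
    and v: "uni (v n)" "keys (v n) \<subseteq> \<phi> n ` W n"
    and approx: "keys y \<subseteq> W n \<Longrightarrow> uni y \<Longrightarrow>
      nrm (v (Suc n) * push (\<phi> (Suc n)) y * star (v (Suc n)) - push (\<phi> n) y) \<le> (1/4) ^ n"
begin

text \<open>Accumulates all corrections. The new factor stands on the right, next to the embedding,
  so that the step from \<open>\<theta> n\<close> to \<open>\<theta> (Suc n)\<close> is the error in
  \<open>approx\<close> conjugated by the unitary \<open>z n\<close>.\<close>

primrec z :: "nat \<Rightarrow> 'h \<Rightarrow>\<^sub>0 real" where
  "z 0 = 1"
| "z (Suc n) = z n * v (Suc n)"

lemma W_mono: "m \<le> n \<Longrightarrow> W m \<subseteq> W n"
  using W(2) by (rule lift_Suc_mono_le)

lemma image_mono: "m \<le> n \<Longrightarrow> \<phi> m ` W m \<subseteq> \<phi> n ` W n"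
  using \<phi>(3) by (rule lift_Suc_mono_le)

lemma subgrp_image: "subgrp (\<phi> n ` W n)"
  unfolding subgrp_def
proof (intro conjI ballI)
  show "0 \<in> \<phi> n ` W n" using hom_on_0[OF W(1) \<phi>(1)] subgrpD(1)[OF W(1)] by (metis imageI)
  show "x + y \<in> \<phi> n ` W n" if "x \<in> \<phi> n ` W n" "y \<in> \<phi> n ` W n" for x y
    using that \<phi>(1)[of n] subgrpD(2)[OF W(1)[of n]] by (auto simp: hom_on_def) (metis imageI)
  show "- x \<in> \<phi> n ` W n" if "x \<in> \<phi> n ` W n" for x
    using that hom_on_uminus[OF W(1) \<phi>(1)] subgrpD(3)[OF W(1)[of n]] by (auto) (metis imageI)
qed

lemma uni_z: "uni (z n)"
  by (induction n) (simp_all add: uni_1 uni_mult v)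

lemma keys_z: "keys (z n) \<subseteq> \<phi> n ` W n"
proof (induction n)
  case 0 show ?case using keys_1_subgrp[OF subgrp_image] by simp
next
  case (Suc n)
  then have "keys (z n) \<subseteq> \<phi> (Suc n) ` W (Suc n)" using \<phi>(3)[of n] by (rule subset_trans)
  then show ?case using keys_mult_subgrp[OF subgrp_image _ v(2)] by simp
qed

definition \<theta> :: "nat \<Rightarrow> ('g \<Rightarrow>\<^sub>0 real) \<Rightarrow> 'h \<Rightarrow>\<^sub>0 real" where
  "\<theta> n y = z n * push (\<phi> n) y * star (z n)"

lemma \<theta>_uni: "keys y \<subseteq> W n \<Longrightarrow> uni y \<Longrightarrow> uni (\<theta> n y)"
  unfolding \<theta>_def by (intro uni_mult uni_star uni_z push_uni[OF W(1) \<phi>(1)])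

lemma \<theta>_mult:
  assumes "keys x \<subseteq> W n" "keys y \<subseteq> W n" shows "\<theta> n (x * y) = \<theta> n x * \<theta> n y"
proof -
  have "\<theta> n x * \<theta> n y = z n * push (\<phi> n) x * (star (z n) * z n) * push (\<phi> n) y * star (z n)"
    by (simp add: \<theta>_def mult.assoc)
  also have "star (z n) * z n = 1" using uni_z[of n] by (simp add: uni_def)
  finally show ?thesis by (simp add: \<theta>_def push_mult[OF \<phi>(1) assms] mult.assoc)
qed

lemma \<theta>_star: "keys x \<subseteq> W n \<Longrightarrow> star (\<theta> n x) = \<theta> n (star x)"
  by (simp add: \<theta>_def push_star[OF W(1) \<phi>(1)] mult.assoc)

lemma tr_\<theta>_u: "g \<in> W n \<Longrightarrow> tr (\<theta> n (u g)) = (if g = 0 then 1 else 0)"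
proof -
  assume g: "g \<in> W n"
  have "tr (\<theta> n (u g)) = tr (push (\<phi> n) (u g) * (star (z n) * z n))"
    unfolding \<theta>_def by (subst mult.assoc, subst tr_mult_commute) (simp add: mult.assoc)
  also have "\<dots> = (if \<phi> n g = 0 then 1 else 0)"
    using uni_z[of n] by (simp add: uni_def tr_single)
  also have "\<phi> n g = 0 \<longleftrightarrow> g = 0"
    using \<phi>(2)[of n] g hom_on_0[OF W(1) \<phi>(1), of n] subgrpD(1)[OF W(1)[of n]] by (metis inj_onD)
  finally show ?thesis .
qed

lemma \<theta>_step:
  assumes "keys y \<subseteq> W n" "uni y"
  shows "norm (emb (\<theta> (Suc n) y) - emb (\<theta> n y)) \<le> (1/2) ^ n"
proof -
  have "\<theta> (Suc n) y - \<theta> n y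
      = z n * (v (Suc n) * push (\<phi> (Suc n)) y * star (v (Suc n)) - push (\<phi> n) y) * star (z n)"
    by (simp add: \<theta>_def mult.assoc right_diff_distrib left_diff_distrib)
  then have "nrm (\<theta> (Suc n) y - \<theta> n y) \<le> (1/4) ^ n"
    using approx[OF assms] by (simp add: nrm_mult_uni uni_z uni_star)
  also have "(1/4::real) ^ n = ((1/2) ^ n)\<^sup>2"
    by (simp add: power_mult[symmetric] mult.commute[of n] power_mult power_divide)
  finally show ?thesis
    by (simp add: norm_emb[symmetric] Lop_diff power2_le_iff_abs_le)
qed

lemma \<theta>_far:
  assumes "keys y \<subseteq> W n" "uni y"
  shows "norm (emb (\<theta> (n + k) y) - emb (\<theta> n y)) \<le> (\<Sum>i<k. (1/2) ^ (n + i))"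
proof (induction k)
  case (Suc k)
  have "keys y \<subseteq> W (n + k)" using assms(1) W_mono[of n "n + k"] by auto
  then have "norm (emb (\<theta> (Suc (n + k)) y) - emb (\<theta> (n + k) y)) \<le> (1/2) ^ (n + k)"
    using assms by (intro \<theta>_step)
  then show ?case
    using Suc norm_triangle_ineq[of "emb (\<theta> (Suc (n + k)) y) - emb (\<theta> (n + k) y)" "emb (\<theta> (n + k) y) - emb (\<theta> n y)"]
    by simp
qed simp

lemma \<theta>_near:
  assumes "keys y \<subseteq> W n" "uni y" "n \<le> m"
  shows "norm (emb (\<theta> m y) - emb (\<theta> n y)) \<le> 2 * (1/2) ^ n"
  using \<theta>_far[OF assms(1,2), of "m - n"] half_power_sum_le[of n "m - n"] assms(3) by simp

section \<open>The limit orthonormal basis\<close>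

definition \<eta> :: "'g \<Rightarrow> 'h l2" where "\<eta> g = lim (\<lambda>n. emb (\<theta> n (u g)))"

lemma half_power_small: "e > 0 \<Longrightarrow> \<exists>n. n \<ge> m \<and> 2 * (1/2::real) ^ n < e"
proof -
  assume "e > 0"
  have "(\<lambda>n. 2 * (1/2::real) ^ n) \<longlonglongrightarrow> 2 * 0" by (intro tendsto_intros LIMSEQ_power_zero) auto
  then have "\<forall>\<^sub>F n in sequentially. 2 * (1/2::real) ^ n < e" 
    by (rule order_tendstoD(2)) (use \<open>e > 0\<close> in simp)
  then have "\<forall>\<^sub>F n in sequentially. n \<ge> m \<and> 2 * (1/2::real) ^ n < e"
    using eventually_ge_at_top by (rule eventually_conj[rotated])
  then show ?thesis by (rule eventually_happens'[OF sequentially_bot])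
qed

lemma \<eta>_lim: "(\<lambda>n. emb (\<theta> n (u g))) \<longlonglongrightarrow> \<eta> g"
proof -
  obtain m where m: "g \<in> W m" using W(3) by blast
  have "Cauchy (\<lambda>n. emb (\<theta> n (u g)))"
  proof (rule metric_CauchyI)
    fix e :: real assume "e > 0"
    then obtain N where N: "N \<ge> m" "2 * (1/2::real) ^ N < e / 2" using half_power_small[of "e/2" m] by auto
    have k: "keys (u g) \<subseteq> W N" using m W_mono[OF N(1)] by auto
    have "dist (emb (\<theta> i (u g))) (emb (\<theta> N (u g))) < e / 2" if "i \<ge> N" for i
      using \<theta>_near[OF k uni_u that] N(2) by (simp add: dist_norm)
    then have "\<forall>i\<ge>N. \<forall>j\<ge>N. dist (emb (\<theta> i (u g))) (emb (\<theta> j (u g))) < e"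
      by (metis dist_triangle_half_l)
    then show "\<exists>M. \<forall>i\<ge>M. \<forall>j\<ge>M. dist (emb (\<theta> i (u g))) (emb (\<theta> j (u g))) < e" by blast
  qed
  then show ?thesis unfolding \<eta>_def by (simp add: Cauchy_convergent_iff convergent_LIMSEQ_iff)
qed

lemma eventually_W: "\<forall>\<^sub>F n in sequentially. g \<in> W n"
proof -
  obtain m where m: "g \<in> W m" using W(3) by blast
  then show ?thesis using W_mono by (intro eventually_sequentiallyI[of m]) blast
qed

lemma \<eta>_0: "\<eta> 0 = bv 0"
proof -
  have "emb (\<theta> n (u 0)) = bv 0" for n
    using uni_z[of n] by (simp add: \<theta>_def uni_def push_one[OF W(1) \<phi>(1)])
  then have "(\<lambda>n. bv 0) \<longlonglongrightarrow> \<eta> 0" using \<eta>_lim[of 0] by (simp only:)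
  then show ?thesis by (simp add: LIMSEQ_const_iff)
qed

lemma tendsto_cinner:
  assumes "X \<longlonglongrightarrow> (a :: 'b l2)" "Y \<longlonglongrightarrow> b" shows "(\<lambda>n. cinner (X n) (Y n)) \<longlonglongrightarrow> cinner a b"
proof -
  have "cinner x y = Complex (inner x y) (inner x (\<i> *\<^sub>C y))" for x y :: "'b l2"
    by (simp add: complex_eq_iff Re_cinner Im_cinner)
  then show ?thesis
    by (simp only:) (intro tendsto_Complex tendsto_inner assms bounded_linear.tendsto[OF bounded_linear_scaleC])
qed

text \<open>On \<open>W n\<close> each \<open>\<theta> n\<close> is multiplicative and preserves
  star and trace, so the approximating vectors are exactly orthonormal as soon as both elements have
  entered \<open>W n\<close>.\<close>

lemma \<eta>_ortho: "cinner (\<eta> g) (\<eta> g') = (if g = g' then 1 else 0)"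
proof -
  have "\<forall>\<^sub>F n in sequentially. cinner (emb (\<theta> n (u g))) (emb (\<theta> n (u g'))) = (if g = g' then 1 else 0)"
    using eventually_W[of g] eventually_W[of g']
  proof eventually_elim
    case (elim n)
    have "star (\<theta> n (u g')) * \<theta> n (u g) = \<theta> n (u (- g' + g))"
      using elim subgrpD(3)[OF W(1)[of n]]
      by (simp add: \<theta>_star \<theta>_mult[symmetric] mult_single)
    moreover have "- g' + g \<in> W n" using elim W(1)[of n] by (simp add: subgrpD)
    moreover have "- g' + g = 0 \<longleftrightarrow> g = g'" using neg_eq_iff_add_eq_0[of "- g'" g] by auto
    ultimately show ?case by (simp add: cinner_emb tr_\<theta>_u)
  qed
  then have "(\<lambda>n. cinner (emb (\<theta> n (u g))) (emb (\<theta> n (u g')))) \<longlonglongrightarrow> (if g = g' then 1 else 0)"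
    by (rule tendsto_eventually)
  then show ?thesis using tendsto_cinner[OF \<eta>_lim[of g] \<eta>_lim[of g']] LIMSEQ_unique by blast
qed

lemma emb_\<theta>_expand: "emb (\<theta> n y) = (\<Sum>k\<in>keys y. complex_of_real (lookup y k) *\<^sub>C emb (\<theta> n (u k)))"
proof (induction y rule: poly_mapping_induct_single)
  case (single k r)
  have "single k r = u k * single 0 r" for k :: 'h by (simp add: mult_single)
  moreover have c: "a * single 0 r = single 0 r * a" for a :: "'h \<Rightarrow>\<^sub>0 real"
    by (induction a rule: poly_mapping_induct_single) (simp_all add: mult_single mult.commute algebra_simps)
  ultimately have "\<theta> n (single k r) = single 0 r * \<theta> n (u k)"
    unfolding \<theta>_def push_single by (metis mult.assoc)
  then show ?case by (simp add: Lop_mult)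
next
  case (add a b)
  have f: "finite (keys a \<union> keys b)" by simp
  have ext: "(\<Sum>k\<in>keys c. complex_of_real (lookup c k) *\<^sub>C emb (\<theta> n (u k)))
      = (\<Sum>k\<in>keys a \<union> keys b. complex_of_real (lookup c k) *\<^sub>C emb (\<theta> n (u k)))"
    if "keys c \<subseteq> keys a \<union> keys b" for c
    using that by (intro sum.mono_neutral_left) (auto simp: in_keys_iff)
  have "emb (\<theta> n (a + b)) = emb (\<theta> n a) + emb (\<theta> n b)"
    by (simp add: \<theta>_def push_add algebra_simps Lop_add)
  then show ?case
    by (subst ext[OF keys_add]) (simp add: add ext lookup_add scaleC_distrib sum.distrib)
qed

text \<open>The backward half of the intertwining: every \<open>u h\<close> is the exact value of
  some \<open>\<theta> n\<close> at a unitary \<open>y\<close> of the group ring, and the later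
  corrections move it by at most \<open>2 * (1/2) ^ n\<close>. Hence \<open>bv h\<close> is
  approximated by combinations of the \<open>\<eta> k\<close>.\<close>

lemma \<eta>_total:
  assumes S: "csubspace S" "closed S" "range \<eta> \<subseteq> S" shows "a \<in> S"
proof (rule dense_bv[OF S(1,2)])
  fix h
  have "\<exists>b\<in>S. dist b (bv h) < e" if e: "e > 0" for e
  proof -
    obtain m where m: "h \<in> \<phi> m ` W m" using \<phi>(4) by blast
    obtain n where n: "n \<ge> m" "2 * (1/2::real) ^ n < e" using half_power_small[OF e, of m] by blast
    define i where "i = inv_into (W n) (\<phi> n)"
    \<comment> \<open>Conjugating \<open>h\<close> back by \<open>z n\<close> stays in the group
      ring of the image of \<open>W n\<close>, because \<open>z n\<close> is supported there. Hence
      \<open>b\<close> has a preimage under \<open>push (\<phi> n)\<close>, in general not a group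
      element.\<close>
    define b where "b = star (z n) * u h * z n"
    have hn: "h \<in> \<phi> n ` W n" using m image_mono[OF n(1)] by blast
    have kb: "keys b \<subseteq> \<phi> n ` W n"
      unfolding b_def using hn keys_z[of n]
      by (intro keys_mult_subgrp keys_star_subgrp subgrp_image) auto
    have ub: "uni b" unfolding b_def by (intro uni_mult uni_star uni_z uni_u)
    have i: "\<phi> n (i x) = x" "i x \<in> W n" if "x \<in> \<phi> n ` W n" for x
      using that by (simp_all add: i_def f_inv_into_f inv_into_into)
    have ihom: "hom_on (\<phi> n ` W n) i"
      unfolding hom_on_def
    proof (intro ballI)
      fix x y assume xy: "x \<in> \<phi> n ` W n" "y \<in> \<phi> n ` W n"
      then have xy': "x + y \<in> \<phi> n ` W n" using subgrp_image by (simp add: subgrpD)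
      have "\<phi> n (i (x + y)) = \<phi> n (i x + i y)"
        using i[OF xy(1)] i[OF xy(2)] i[OF xy'] \<phi>(1)[of n] by (simp add: hom_on_def)
      then show "i (x + y) = i x + i y"
        using \<phi>(2)[of n] i xy xy' W(1)[of n] by (meson inj_onD subgrpD(2))
    qed
    define y where "y = push i b"
    have ky: "keys y \<subseteq> W n" using keys_push[of i b] kb i(2) by (auto simp: y_def)
    have uy: "uni y" unfolding y_def by (rule push_uni[OF subgrp_image ihom kb ub])
    have "push (\<phi> n) y = b"
      unfolding y_def push_push using kb i(1) by (intro push_id) auto
    then have "\<theta> n y = (z n * star (z n)) * u h * (z n * star (z n))"
      by (simp add: \<theta>_def b_def mult.assoc)
    then have "emb (\<theta> n y) = bv h" using uni_z[of n] by (simp add: uni_def)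
    then have near: "norm (emb (\<theta> k y) - bv h) \<le> 2 * (1/2) ^ n" if "k \<ge> n" for k
      using \<theta>_near[OF ky uy that] by simp
    define c where "c = (\<Sum>k\<in>keys y. complex_of_real (lookup y k) *\<^sub>C \<eta> k)"
    have "(\<lambda>k. emb (\<theta> k y)) \<longlonglongrightarrow> c"
      unfolding c_def emb_\<theta>_expand[of _ y]
      by (intro tendsto_sum bounded_linear.tendsto[OF bounded_linear_scaleC] \<eta>_lim)
    then have "(\<lambda>k. norm (emb (\<theta> k y) - bv h)) \<longlonglongrightarrow> norm (c - bv h)"
      by (intro tendsto_intros)
    then have "norm (c - bv h) \<le> 2 * (1/2) ^ n"
      by (rule tendsto_upperbound) (use near in \<open>auto intro: eventually_sequentiallyI\<close>)
    moreover have "c \<in> S"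
    proof -
      have "\<eta> k \<in> S" for k using S(3) by auto
      then show ?thesis unfolding c_def using S(1) by (intro csubspace_sum) (auto simp: csubspace_def)
    qed
    ultimately show ?thesis using n(2) by (auto simp: dist_norm intro!: bexI[of _ c])
  qed
  then have "bv h \<in> closure S" by (simp add: closure_approachable)
  then show "bv h \<in> S" using S by simp
qed

sublocale basis: orthonormal_basis \<eta>
  by unfold_locales (rule \<eta>_ortho, rule \<eta>_total)

abbreviation "U \<equiv> basis.U"
abbreviation "V \<equiv> adjo basis.U"

text \<open>The operators are isometries once \<open>g\<close> is in \<open>W n\<close>, so it
  suffices to treat the vectors \<open>\<eta> k\<close>; there multiplicativity of
  \<open>\<theta> n\<close> reduces the claim to convergence to \<open>\<eta> (g + k)\<close>. As a
  strong limit of group ring operators, the transported translation still commutes with right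
  translations.\<close>

lemma transported_limit: "(\<lambda>n. Lop (\<theta> n (u g)) x) \<longlonglongrightarrow> V (lam g (U x))"
proof -
  let ?T = "\<lambda>x. V (lam g (U x))"
  let ?S = "{x. (\<lambda>n. Lop (\<theta> n (u g)) x) \<longlonglongrightarrow> ?T x}"
  have cT: "cbl ?T"
    using cbl_comp[OF cbl_comp[OF basis.cbl_V cbl_lam[of g]] basis.cbl_U] by (simp add: o_def)
  have nV: "norm (V a) = norm a" for a using basis.norm_U[of "V a"] by simp
  have iso: "norm (Lop (\<theta> n (u g)) x) = norm x" if "g \<in> W n" for n x
    using that by (intro norm_Lop_uni \<theta>_uni uni_u) simp
  have "x \<in> ?S"
  proof (rule \<eta>_total)
    show "csubspace ?S"
      unfolding csubspace_def
      by (auto simp: cbl_add[OF cbl_Lop] cbl_add[OF cT] cbl_zero[OF cbl_Lop] cbl_zero[OF cT]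
          cbl_scaleC[OF cbl_Lop] cbl_scaleC[OF cT] intro!: tendsto_add bounded_linear.tendsto[OF bounded_linear_scaleC])
    show "closed ?S"
    proof (rule closure_subset_eq[THEN iffD1], rule subsetI)
      fix x assume x: "x \<in> closure ?S"
      have "\<forall>\<^sub>F n in sequentially. dist (Lop (\<theta> n (u g)) x) (?T x) < e" if e: "e > 0" for e
      proof -
        have "\<forall>e>0. \<exists>y\<in>?S. dist y x < e" using x by (simp only: closure_approachable)
        moreover have "e / 3 > 0" using e by simp
        ultimately obtain y where y: "y \<in> ?S" "dist y x < e / 3" by blast
        have "\<forall>\<^sub>F n in sequentially. dist (Lop (\<theta> n (u g)) y) (?T y) < e / 3"
          using y(1) e by (auto dest!: tendstoD[of _ _ _ "e/3"])
        then show ?thesis using eventually_W[of g]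
        proof eventually_elim
          case (elim n)
          have "dist (Lop (\<theta> n (u g)) x) (Lop (\<theta> n (u g)) y) = norm (x - y)"
            using iso[OF elim(2)] by (simp add: dist_norm cbl_diff[OF cbl_Lop, symmetric])
          moreover have "dist (?T y) (?T x) = norm (y - x)"
            by (simp add: dist_norm cbl_diff[OF cT, symmetric] nV)
          ultimately show ?case
            using elim(1) y(2) dist_triangle_third[of "Lop (\<theta> n (u g)) x" "Lop (\<theta> n (u g)) y" e "?T y" "?T x"]
            by (simp add: dist_norm norm_minus_commute)
        qed
      qed
      then show "x \<in> ?S" by (simp add: tendstoI)
    qed
    show "range \<eta> \<subseteq> ?S"
    proof clarify
      fix k
      have "\<forall>\<^sub>F n in sequentially. norm (Lop (\<theta> n (u g)) (\<eta> k) - emb (\<theta> n (u (g + k)))) = norm (\<eta> k - emb (\<theta> n (u k)))"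
        using eventually_W[of g] eventually_W[of k]
      proof eventually_elim
        case (elim n)
        have "emb (\<theta> n (u (g + k))) = Lop (\<theta> n (u g)) (emb (\<theta> n (u k)))"
          using elim \<theta>_mult[of "u g" n "u k"] by (simp add: mult_single Lop_mult)
        then show ?case using iso[OF elim(1)] by (simp add: cbl_diff[OF cbl_Lop, symmetric])
      qed
      then have ev: "\<forall>\<^sub>F n in sequentially. norm (Lop (\<theta> n (u g)) (\<eta> k) - emb (\<theta> n (u (g + k)))) = norm (\<eta> k - emb (\<theta> n (u k)))" .
      have "(\<lambda>n. norm (\<eta> k - emb (\<theta> n (u k)))) \<longlonglongrightarrow> norm (\<eta> k - \<eta> k)"
        by (intro tendsto_intros \<eta>_lim)
      then have "(\<lambda>n. norm (\<eta> k - emb (\<theta> n (u k)))) \<longlonglongrightarrow> 0" by simp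
      then have "(\<lambda>n. norm (Lop (\<theta> n (u g)) (\<eta> k) - emb (\<theta> n (u (g + k))))) \<longlonglongrightarrow> 0"
        by (rule tendsto_cong[OF ev, THEN iffD2])
      then have "(\<lambda>n. (Lop (\<theta> n (u g)) (\<eta> k) - emb (\<theta> n (u (g + k)))) + emb (\<theta> n (u (g + k)))) \<longlonglongrightarrow> 0 + \<eta> (g + k)"
        by (intro tendsto_add \<eta>_lim) (rule tendsto_norm_zero_cancel)
      then show "(\<lambda>n. Lop (\<theta> n (u g)) (\<eta> k)) \<longlonglongrightarrow> ?T (\<eta> k)" by simp
    qed
  qed
  then show ?thesis by simp
qed

definition Tg :: "'g \<Rightarrow> 'h l2 \<Rightarrow> 'h l2" where "Tg g x = V (lam g (U x))"

lemma Tg_Lvn: "Tg g \<in> Lvn"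
proof (rule LvnI)
  show "cbl (Tg g)"
    using cbl_comp[OF cbl_comp[OF basis.cbl_V cbl_lam[of g]] basis.cbl_U]
    by (simp add: Tg_def[abs_def] o_def)
  fix h x
  have "(\<lambda>n. Lop (\<theta> n (u g)) (rho h x)) \<longlonglongrightarrow> rho h (Tg g x)"
    unfolding Lop_rho Tg_def
    by (intro bounded_linear.tendsto[OF cbl_bounded_linear[OF cbl_rho]] transported_limit)
  then show "Tg g (rho h x) = rho h (Tg g x)"
    using transported_limit[of g "rho h x"] LIMSEQ_unique unfolding Tg_def by blast
qed

lemma bicommut_Tg: "bicommut (range Tg) = Lvn"
proof (rule bicommut_eq_Lvn)
  have Tg0: "Tg g (bv 0) = \<eta> g" for g
    using basis.U_\<eta>[of 0] by (simp add: Tg_def \<eta>_0)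
  show "bv h \<in> ccl ((\<lambda>q. q (bv 0)) ` range Tg)" for h
    by (rule \<eta>_total[OF csubspace_ccl closed_ccl])
      (use subset_ccl[of "(\<lambda>q. q (bv 0)) ` range Tg"] in \<open>simp add: image_image Tg0\<close>)
qed (auto simp: Tg_Lvn)

section \<open>The isomorphism implemented by the limit unitary\<close>

definition \<psi> :: "('g l2 \<Rightarrow> 'g l2) \<Rightarrow> 'h l2 \<Rightarrow> 'h l2" where "\<psi> x = V \<circ> x \<circ> U"

text \<open>\<open>Tg g\<close> commutes with \<open>rho h\<close>, so \<open>rho h\<close> carried
  to the other space commutes with all left translations, hence with everything that they
  generate.\<close>

lemma \<psi>_Lvn:
  assumes x: "x \<in> Lvn" shows "\<psi> x \<in> Lvn"
proof (rule LvnI)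
  show "cbl (\<psi> x)"
    unfolding \<psi>_def by (intro cbl_comp basis.cbl_V basis.cbl_U Lvn_cbl x)
  fix h a
  have "U \<circ> rho h \<circ> V \<in> commut (range lam)"
  proof (rule commutI)
    show "cbl (U \<circ> rho h \<circ> V)" by (intro cbl_comp basis.cbl_V basis.cbl_U cbl_rho)
    fix S :: "'g l2 \<Rightarrow> 'g l2" and a assume "S \<in> range lam"
    then obtain g where g: "S = lam g" by blast
    have "U (Tg g (rho h (V a))) = U (rho h (Tg g (V a)))" by (simp add: Lvn_rho[OF Tg_Lvn])
    then show "(U \<circ> rho h \<circ> V) (S a) = S ((U \<circ> rho h \<circ> V) a)" by (simp add: Tg_def g)
  qed
  then have "x (U (rho h (V (U a)))) = U (rho h (V (x (U a))))"
    using commutD[of x "commut (range lam)" "U \<circ> rho h \<circ> V" "U a"] x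
    by (simp add: bicommut_lam)
  then show "\<psi> x (rho h a) = rho h (\<psi> x a)" by (simp add: \<psi>_def)
qed

text \<open>The mirror image; here the transported translations have to generate all of
  \<open>Lvn\<close>, which is \<open>bicommut_Tg\<close>.\<close>

lemma \<psi>_inverse_Lvn:
  assumes y: "y \<in> Lvn" shows "U \<circ> y \<circ> V \<in> Lvn"
proof (rule LvnI)
  show "cbl (U \<circ> y \<circ> V)" by (intro cbl_comp basis.cbl_V basis.cbl_U Lvn_cbl y)
  fix k a
  have "V \<circ> rho k \<circ> U \<in> commut (range Tg)"
  proof (rule commutI)
    show "cbl (V \<circ> rho k \<circ> U)" by (intro cbl_comp basis.cbl_V basis.cbl_U cbl_rho)
  qed (auto simp: Tg_def lam_rho)
  then have "y (V (rho k (U (V a)))) = V (rho k (U (y (V a))))"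
    using commutD[of y "commut (range Tg)" "V \<circ> rho k \<circ> U" "V a"] y by (simp add: bicommut_Tg)
  then show "(U \<circ> y \<circ> V) (rho k a) = rho k ((U \<circ> y \<circ> V) a)" by simp
qed

lemma bij_\<psi>: "bij_betw \<psi> Lvn Lvn"
proof (rule bij_betw_byWitness[of _ "\<lambda>y. U \<circ> y \<circ> V"])
  show "\<forall>x\<in>Lvn. U \<circ> \<psi> x \<circ> V = x" "\<forall>y\<in>Lvn. \<psi> (U \<circ> y \<circ> V) = y"
    by (auto simp: \<psi>_def fun_eq_iff)
qed (auto simp: \<psi>_Lvn \<psi>_inverse_Lvn)

lemma Wstar:
  assumes "group_transport (e :: 'b \<Rightarrow> 'g) G" "group_transport (e' :: 'c \<Rightarrow> 'h) H"
  shows "Wstar_equivalent G H"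
proof (rule Wstar_equivalentI[OF assms(1,2) bij_\<psi>])
  show "\<psi> (adjo T) = adjo (\<psi> T)" if "T \<in> Lvn" for T
    using that by (simp add: \<psi>_def adjo_comp cbl_comp basis.cbl_V basis.cbl_U Lvn_cbl adjo_adjo o_assoc)
qed (auto simp: \<psi>_def fun_eq_iff cbl_add[OF basis.cbl_V] cbl_scaleC[OF basis.cbl_V])

end

section \<open>Finitary linear groups over the field with two elements\<close>

declare add_bit_eq_xor [simp del] mult_bit_eq_and [simp del]

type_synonym vec = "nat \<Rightarrow> bit"

lemma bit_add_self [simp]: "(a::bit) + a = 0"
  by (cases a) simp_all

lemma vec_add_self [simp]: "(x::vec) + x = 0"
  by (simp add: fun_eq_iff plus_fun_def zero_fun_def)

definition unit_vec :: "nat \<Rightarrow> vec" where "unit_vec j = (\<lambda>k. if k = j then 1 else 0)"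

text \<open>The identity matrix with \<open>v\<close> added to column \<open>N\<close>. For
  \<open>v N = 0\<close> it is a transvection, in characteristic two an involution.\<close>

definition tau :: "vec \<Rightarrow> nat \<Rightarrow> vec \<Rightarrow> vec" where
  "tau v N x = (\<lambda>k. x k + x N * v k)"

lemma tau_alt: "tau v N x = x + (if x N = 1 then v else 0)"
proof
  fix k show "tau v N x k = (x + (if x N = 1 then v else 0)) k"
    by (cases "x N") (simp_all add: tau_def plus_fun_def zero_fun_def)
qed

definition bounded_supp :: "vec \<Rightarrow> bool" where "bounded_supp v \<longleftrightarrow> (\<exists>d. \<forall>k\<ge>d. v k = 0)"

lemma bounded_supp_add: "bounded_supp v \<Longrightarrow> bounded_supp w \<Longrightarrow> bounded_supp (v + w)"
proof -
  assume "bounded_supp v" "bounded_supp w"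
  then obtain a b where "\<forall>k\<ge>a. v k = 0" "\<forall>k\<ge>b. w k = 0" by (auto simp: bounded_supp_def)
  then have "\<forall>k\<ge>max a b. (v + w) k = 0" by (simp add: plus_fun_def)
  then show ?thesis unfolding bounded_supp_def by blast
qed

lemma bounded_supp_unit_vec [simp]: "bounded_supp (unit_vec i)"
  unfolding bounded_supp_def unit_vec_def by (rule exI[of _ "Suc i"]) auto

lemma tau_tau [simp]: "v N = 0 \<Longrightarrow> tau v N (tau v N x) = x"
proof
  fix k assume "v N = 0"
  then show "tau v N (tau v N x) k = x k"
    by (cases "x N"; cases "x k"; cases "v k") (simp_all add: tau_def)
qed

inductive_set FL :: "(vec \<Rightarrow> vec) set" where
  FL_id: "id \<in> FL"
| FL_tau: "h \<in> FL \<Longrightarrow> bounded_supp v \<Longrightarrow> v N = 0 \<Longrightarrow> tau v N \<circ> h \<in> FL"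

lemma tau_FL: "bounded_supp v \<Longrightarrow> v N = 0 \<Longrightarrow> tau v N \<in> FL"
  using FL_tau[OF FL_id] by simp

lemma FL_comp: "g \<in> FL \<Longrightarrow> h \<in> FL \<Longrightarrow> g \<circ> h \<in> FL"
  by (induction rule: FL.induct) (auto simp: o_assoc[symmetric] FL_tau)

lemma FL_inverse: "h \<in> FL \<Longrightarrow> bij h \<and> inv_into UNIV h \<in> FL"
proof (induction rule: FL.induct)
  case FL_id
  show ?case using FL.FL_id bij_id inv_id by metis
next
  case (FL_tau h v N)
  have b: "bij (tau v N)" by (rule o_bij[of "tau v N"]) (auto simp: fun_eq_iff FL_tau)
  moreover have "inv_into UNIV (tau v N) = tau v N"
    by (rule inv_unique_comp) (auto simp: fun_eq_iff FL_tau)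
  ultimately have "inv_into UNIV (tau v N \<circ> h) = inv_into UNIV h \<circ> tau v N" "bij (tau v N \<circ> h)"
    using o_inv_distrib[of "tau v N" h] bij_comp[of h "tau v N"] FL_tau by metis+
  then show ?case using FL_comp tau_FL FL_tau by metis
qed

lemma FL_linear: "h \<in> FL \<Longrightarrow> h (x + y) = h x + h y"
proof (induction arbitrary: x y rule: FL.induct)
  case (FL_tau h v N)
  then show ?case
    by (auto simp: tau_def fun_eq_iff plus_fun_def algebra_simps)
qed simp

lemma FL_zero: "h \<in> FL \<Longrightarrow> h 0 = 0"
  using FL_linear[of h 0 0] by simp

text \<open>The block form diag(A, 1) with A of size \<open>d\<close>: the first clause makes the
  lower rows trivial, the second the right columns.\<close>

definition supp :: "nat \<Rightarrow> (vec \<Rightarrow> vec) \<Rightarrow> bool" where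
  "supp d h \<longleftrightarrow> (\<forall>x. \<forall>k\<ge>d. h x k = x k) \<and> (\<forall>x. (\<forall>j<d. x j = 0) \<longrightarrow> h x = x)"

lemma supp_mono: "supp d h \<Longrightarrow> d \<le> d' \<Longrightarrow> supp d' h"
  by (auto simp: supp_def)

lemma supp_id [simp]: "supp d id" by (simp add: supp_def)

lemma supp_comp: "supp d g \<Longrightarrow> supp d h \<Longrightarrow> supp d (g \<circ> h)"
  by (auto simp: supp_def)

lemma supp_inv:
  assumes "bij h" "supp d h" shows "supp d (inv_into UNIV h)"
proof -
  have hi: "h (inv_into UNIV h x) = x" "inv_into UNIV h (h x) = x" for x
    using assms(1) by (simp_all add: bij_is_surj surj_f_inv_f bij_is_inj)
  have "inv_into UNIV h x k = x k" if "k \<ge> d" for x k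
    using assms(2) hi(1)[of x] that unfolding supp_def by metis
  moreover have "inv_into UNIV h x = x" if "\<forall>j<d. x j = 0" for x
    using assms(2) hi(2)[of x] that unfolding supp_def by metis
  ultimately show ?thesis unfolding supp_def by blast
qed

lemma supp_tau: "N < d \<Longrightarrow> \<forall>k\<ge>d. v k = 0 \<Longrightarrow> supp d (tau v N)"
  by (auto simp: supp_def tau_def)

lemma FL_supp: "h \<in> FL \<Longrightarrow> \<exists>d. supp d h"
proof (induction rule: FL.induct)
  case (FL_tau h v N)
  then obtain a b where "\<forall>k\<ge>a. v k = 0" "supp b h" by (auto simp: bounded_supp_def)
  then have "supp (max (max a (Suc N)) b) (tau v N)" "supp (max (max a (Suc N)) b) h"
    by (auto intro!: supp_tau intro: supp_mono)
  then show ?case using supp_comp by blast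
qed (use supp_id in blast)

lemma supp_below:
  assumes h: "h \<in> FL" "supp d h" and xy: "\<forall>j<d. x j = y j" "k < d" shows "h x k = h y k"
proof -
  have "h (x + y) = x + y" using h(2) xy(1) by (simp add: supp_def plus_fun_def)
  then have "(h x + h y) k = (x + y) k" unfolding FL_linear[OF h(1)] by (rule fun_cong)
  then have "h x k + h y k = 0" using xy by (simp only: plus_fun_def) simp
  then show ?thesis by (cases "h x k"; cases "h y k") auto
qed

definition V :: "nat \<Rightarrow> vec set" where "V d = {x. \<forall>k\<ge>d. x k = 0}"

lemma supp_V: "supp d h \<Longrightarrow> x \<in> V d \<Longrightarrow> h x \<in> V d"
  by (auto simp: supp_def V_def)

definition trunc :: "nat \<Rightarrow> vec \<Rightarrow> vec" where "trunc d x = (\<lambda>k. if k < d then x k else 0)"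

lemma trunc_V: "trunc d x \<in> V d"
  by (simp add: trunc_def V_def)

lemma supp_trunc:
  assumes "h \<in> FL" "supp d h" shows "h x = h (trunc d x) + (x + trunc d x)"
proof -
  have "h (x + trunc d x) = x + trunc d x" using assms(2) by (auto simp: supp_def trunc_def plus_fun_def)
  moreover have "h x = h (trunc d x) + h (x + trunc d x)"
    using FL_linear[OF assms(1), of "trunc d x" "x + trunc d x"]
    by (simp add: add.left_commute[of "trunc d x"])
  ultimately show ?thesis by simp
qed

lemma card_functions_zero_outside:
  fixes A :: "'b::zero set"
  assumes "finite I" "finite A"
  shows "finite {y. (\<forall>i. i \<notin> I \<longrightarrow> y i = 0) \<and> (\<forall>i\<in>I. y i \<in> A)}"
    "card {y. (\<forall>i. i \<notin> I \<longrightarrow> y i = 0) \<and> (\<forall>i\<in>I. y i \<in> A)} = card A ^ card I"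
proof -
  let ?Y = "{y. (\<forall>i. i \<notin> I \<longrightarrow> y i = 0) \<and> (\<forall>i\<in>I. y i \<in> A)}"
  have b: "bij_betw (\<lambda>y. restrict y I) ?Y (I \<rightarrow>\<^sub>E A)"
    by (rule bij_betw_byWitness[of _ "\<lambda>f i. if i \<in> I then f i else 0"]) (auto simp: fun_eq_iff PiE_def extensional_def)
  then show "finite ?Y" using bij_betw_finite[OF b] finite_PiE[of I "\<lambda>_. A"] assms by simp
  show "card ?Y = card A ^ card I"
    using bij_betw_same_card[OF b] card_PiE[of I "\<lambda>_. A"] assms by simp
qed

lemma bit_UNIV: "(UNIV :: bit set) = {0, 1}"
  using bit.exhaust by auto

lemma V_eq: "V d = {y. (\<forall>i. i \<notin> {..<d} \<longrightarrow> y i = 0) \<and> (\<forall>i\<in>{..<d}. y i \<in> UNIV)}"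
  by (auto simp: V_def)

lemma finite_V [simp]: "finite (V d)" and card_V: "card (V d) = 2 ^ d"
  using card_functions_zero_outside[of "{..<d}" "UNIV :: bit set"] by (simp_all add: V_eq bit_UNIV numeral_2_eq_2)

text \<open>By linearity such a matrix is determined by its restriction to the finite set
  \<open>V d\<close>.\<close>

lemma finite_FL_supp: "finite {h \<in> FL. supp d h}"
proof (rule inj_on_finite)
  show "inj_on (\<lambda>h. restrict h (V d)) {h \<in> FL. supp d h}"
  proof (rule inj_onI)
    fix g h assume gh: "g \<in> {h \<in> FL. supp d h}" "h \<in> {h \<in> FL. supp d h}" "restrict g (V d) = restrict h (V d)"
    have "g (trunc d x) = h (trunc d x)" for x
      using fun_cong[OF gh(3), of "trunc d x"] by (simp add: trunc_V)
    moreover have "g x = g (trunc d x) + (x + trunc d x)" "h x = h (trunc d x) + (x + trunc d x)" for x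
      using gh(1,2) by (intro supp_trunc; simp)+
    ultimately show "g = h" by (intro ext) (metis (no_types))
  qed
  show "(\<lambda>h. restrict h (V d)) ` {h \<in> FL. supp d h} \<subseteq> V d \<rightarrow>\<^sub>E V d"
    by (auto intro: supp_V)
qed (intro finite_PiE finite_V)

lemma FL_eq_Union: "FL = (\<Union>d. {h \<in> FL. supp d h})"
  using FL_supp by blast

lemma countable_FL: "countable FL"
  by (subst FL_eq_Union, rule countable_UN, simp) (rule countable_finite[OF finite_FL_supp])

text \<open>The subgroup whose matrices have trivial first two rows: a semidirect product of
  two copies of the finitely supported vectors with the finitary linear group.\<close>

definition AL :: "(vec \<Rightarrow> vec) set" where
  "AL = {h \<in> FL. \<forall>x. h x 0 = x 0 \<and> h x 1 = x 1}"

lemma AL_FL: "h \<in> AL \<Longrightarrow> h \<in> FL"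
  by (simp add: AL_def)

lemma AL_id: "id \<in> AL" by (simp add: AL_def FL_id)

lemma AL_comp: "g \<in> AL \<Longrightarrow> h \<in> AL \<Longrightarrow> g \<circ> h \<in> AL"
  by (simp add: AL_def FL_comp del: One_nat_def)

lemma AL_inverse: "h \<in> AL \<Longrightarrow> inv_into UNIV h \<in> AL"
proof -
  assume h: "h \<in> AL"
  then have "bij h" "inv_into UNIV h \<in> FL" using FL_inverse AL_FL by blast+
  moreover have "h (inv_into UNIV h x) = x" for x
    using \<open>bij h\<close> by (simp add: bij_is_surj surj_f_inv_f)
  then have "inv_into UNIV h x 0 = x 0 \<and> inv_into UNIV h x 1 = x 1" for x
    using h unfolding AL_def by (metis (mono_tags, lifting) mem_Collect_eq)
  ultimately show ?thesis by (simp add: AL_def)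
qed

section \<open>The two matrix groups as additively written types\<close>

typedef fl = FL morphisms fl_fun Abs_fl by (rule exI[of _ id]) (rule FL_id)
typedef al = AL morphisms al_fun Abs_al by (rule exI[of _ id]) (rule AL_id)

instantiation fl :: group_add
begin
definition "zero_fl = Abs_fl id"
definition "plus_fl g h = Abs_fl (fl_fun g \<circ> fl_fun h)"
definition "uminus_fl g = Abs_fl (inv_into UNIV (fl_fun g))"
definition "minus_fl (g::fl) h = g + - h"
lemma fl_fun_simps: "fl_fun 0 = id" "fl_fun (g + h) = fl_fun g \<circ> fl_fun h" "fl_fun (- g) = inv_into UNIV (fl_fun g)"
  using fl_fun[of g] fl_fun[of h] FL_inverse[of "fl_fun g"]
  by (simp_all add: zero_fl_def plus_fl_def uminus_fl_def Abs_fl_inverse FL_id FL_comp)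
instance
proof
  fix a b c :: fl
  have "inj (fl_fun a)" using FL_inverse[OF fl_fun] bij_is_inj by blast
  then show "- a + a = 0"
    by (simp add: fl_fun_inject[symmetric] fl_fun_simps)
qed (simp_all add: fl_fun_inject[symmetric] fl_fun_simps minus_fl_def o_assoc)
end

instantiation al :: group_add
begin
definition "zero_al = Abs_al id"
definition "plus_al g h = Abs_al (al_fun g \<circ> al_fun h)"
definition "uminus_al g = Abs_al (inv_into UNIV (al_fun g))"
definition "minus_al (g::al) h = g + - h"
lemma al_fun_simps: "al_fun 0 = id" "al_fun (g + h) = al_fun g \<circ> al_fun h" "al_fun (- g) = inv_into UNIV (al_fun g)"
  using al_fun[of g] al_fun[of h] AL_inverse[of "al_fun g"]
  by (simp_all add: zero_al_def plus_al_def uminus_al_def Abs_al_inverse AL_id AL_comp)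
instance
proof
  fix a b c :: al
  have "inj (al_fun a)" using FL_inverse[OF AL_FL[OF al_fun]] bij_is_inj by blast
  then show "- a + a = 0"
    by (simp add: al_fun_inject[symmetric] al_fun_simps)
qed (simp_all add: al_fun_inject[symmetric] al_fun_simps minus_al_def o_assoc)
end

lemma al_fun_FL: "al_fun h \<in> FL" using al_fun AL_FL by blast

lemma al_fun_inv: "al_fun h (al_fun (- h) x) = x" "al_fun (- h) (al_fun h x) = x"
  using al_fun_simps(2)[of h "- h"] al_fun_simps(2)[of "- h" h] by (simp_all add: al_fun_simps(1) fun_eq_iff)

lemma fl_fun_inv: "fl_fun h (fl_fun (- h) x) = x" "fl_fun (- h) (fl_fun h x) = x"
  using fl_fun_simps(2)[of h "- h"] fl_fun_simps(2)[of "- h" h] by (simp_all add: fl_fun_simps(1) fun_eq_iff)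

definition Hd :: "nat \<Rightarrow> al set" where "Hd d = {h. supp d (al_fun h)}"

lemma subgrp_Hd: "subgrp (Hd d)"
  unfolding subgrp_def Hd_def
  using FL_inverse[OF al_fun_FL] by (auto simp: al_fun_simps supp_comp supp_inv)

lemma Hd_mono: "d \<le> d' \<Longrightarrow> Hd d \<subseteq> Hd d'"
  using supp_mono by (auto simp: Hd_def)

lemma finite_Hd: "finite (Hd d)"
proof (rule inj_on_finite)
  show "inj_on al_fun (Hd d)" by (auto simp: inj_on_def al_fun_inject)
  show "al_fun ` Hd d \<subseteq> {h \<in> FL. supp d h}" by (auto simp: Hd_def al_fun_FL)
qed (rule finite_FL_supp)

lemma Hd_UNIV: "\<exists>d. h \<in> Hd d"
  using FL_supp[OF al_fun_FL] by (simp add: Hd_def)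

section \<open>Wandering projections from unipotent subgroups\<close>

definition sg :: "bit \<Rightarrow> real" where "sg b = (if b = 0 then 1 else -1)"

lemma sg_add: "sg (a + b) = sg a * sg b"
  by (cases a; cases b) (simp_all add: sg_def)

lemma sg_0 [simp]: "sg 0 = 1" and sg_1 [simp]: "sg 1 = -1"
  by (simp_all add: sg_def)

text \<open>\<open>d\<close> is the matrix size of the acting finite group and \<open>m\<close> the
  number of new rows. Since \<open>d\<close> is at least 2, the new rows avoid 0 and 1, and the
  block matrices stay in the affine group; a large \<open>m\<close> makes most characters
  free.\<close>

locale unipotent =
  fixes d m :: nat
  assumes d: "d \<ge> 2"
begin

definition I where "I = {d..<d+m}"

definition funcl :: "(vec \<Rightarrow> bit) \<Rightarrow> bool" where
  "funcl f \<longleftrightarrow> (\<forall>x y. f (x + y) = f x + f y) \<and> (\<forall>x. (\<forall>j<d. x j = 0) \<longrightarrow> f x = 0)"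

text \<open>\<open>B\<close> consists of the block matrices with rows in \<open>I\<close> and columns below \<open>d\<close>, each row
  seen as a linear functional; \<open>Y\<close> parametrizes the characters of the group \<open>\<beta> ` B\<close>.\<close>

definition B :: "(nat \<Rightarrow> vec \<Rightarrow> bit) set" where
  "B = {F. (\<forall>i. i \<notin> I \<longrightarrow> F i = 0) \<and> (\<forall>i\<in>I. funcl (F i))}"

definition Y :: "(nat \<Rightarrow> vec) set" where
  "Y = {y. (\<forall>i. i \<notin> I \<longrightarrow> y i = 0) \<and> (\<forall>i\<in>I. y i \<in> V d)}"

definition bmap :: "(nat \<Rightarrow> vec \<Rightarrow> bit) \<Rightarrow> vec \<Rightarrow> vec" where
  "bmap F x = (\<lambda>i. x i + F i x)"

lemma funcl_add: "funcl f \<Longrightarrow> funcl g \<Longrightarrow> funcl (f + g)"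
  by (simp add: funcl_def plus_fun_def algebra_simps)

lemma funcl_0: "funcl 0" by (simp add: funcl_def zero_fun_def)

lemma B_funcl: "F \<in> B \<Longrightarrow> funcl (F i)"
  using funcl_0 by (cases "i \<in> I") (auto simp: B_def)

lemma B_low: "F \<in> B \<Longrightarrow> i < d \<Longrightarrow> F i = 0"
  by (auto simp: B_def I_def)

lemma B_add: "F \<in> B \<Longrightarrow> G \<in> B \<Longrightarrow> F + G \<in> B"
  by (auto simp: B_def plus_fun_def[of F] intro: funcl_add)

lemma B_0: "0 \<in> B"
  by (auto simp: B_def zero_fun_def[where 'a=nat] funcl_0)

lemma funcl_0_val: "funcl f \<Longrightarrow> f 0 = 0"
  by (simp add: funcl_def)

lemma funcl_expand:
  assumes "funcl f" shows "f x = (\<Sum>j<d. f (unit_vec j) * x j)"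
proof -
  have "f (trunc c x) = (\<Sum>j<c. f (unit_vec j) * x j)" for c
  proof (induction c)
    case 0
    have "trunc 0 x = 0" by (simp add: trunc_def zero_fun_def)
    then show ?case using funcl_0_val[OF assms] by (simp only: lessThan_0 sum.empty)
  next
    case (Suc c)
    have "trunc (Suc c) x = trunc c x + (if x c = 1 then unit_vec c else 0)"
    proof
      fix k show "trunc (Suc c) x k = (trunc c x + (if x c = 1 then unit_vec c else 0)) k"
        by (cases "x c") (auto simp: trunc_def unit_vec_def plus_fun_def less_Suc_eq)
    qed
    then have "f (trunc (Suc c) x) = f (trunc c x) + f (if x c = 1 then unit_vec c else 0)"
      using assms by (simp add: funcl_def)
    also have "f (if x c = 1 then unit_vec c else 0) = f (unit_vec c) * x c"
      using funcl_0_val[OF assms] by (cases "x c") simp_all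
    finally show ?case using Suc by simp
  qed
  from this[of d] have t: "f (trunc d x) = (\<Sum>j<d. f (unit_vec j) * x j)" .
  have "\<forall>j<d. (x + trunc d x) j = 0" by (simp add: trunc_def plus_fun_def)
  then have "f (x + trunc d x) = 0" using assms unfolding funcl_def by blast
  moreover have "f (x + trunc d x) = f x + f (trunc d x)" using assms unfolding funcl_def by blast
  ultimately have "f x + f (trunc d x) = 0" by simp
  then have "f x = f (trunc d x)" by (cases "f x"; cases "f (trunc d x)") auto
  then show ?thesis using t by simp
qed

lemma funcl_cong: "funcl f \<Longrightarrow> (\<And>j. j < d \<Longrightarrow> x j = y j) \<Longrightarrow> f x = f y"
  using funcl_expand[of f x] funcl_expand[of f y] by simp

text \<open>The block is built column by column, each column being a transvection: its entries are
  in rows from \<open>d\<close> on while its index is below \<open>d\<close>, so its diagonal entry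
  is zero.\<close>

lemma bmap_FL:
  assumes F: "F \<in> B" shows "bmap F \<in> FL"
proof -
  define g where "g c x = (\<lambda>i. x i + (\<Sum>j<c. F i (unit_vec j) * x j))" for c x
  have "g c \<in> FL" if "c \<le> d" for c
    using that
  proof (induction c)
    case 0
    have "g 0 = id" by (rule ext) (simp add: g_def)
    then show ?case using FL_id by metis
  next
    case (Suc c)
    define v where "v = (\<lambda>i. F i (unit_vec c))"
    have Fc: "F c = 0" using B_low[OF F] Suc by simp
    then have vc: "v c = 0" by (simp add: v_def zero_fun_def)
    have "\<forall>k\<ge>d+m. v k = 0" using F by (auto simp: v_def B_def I_def zero_fun_def)
    then have bv: "bounded_supp v" unfolding bounded_supp_def by blast
    have "g (Suc c) = tau v c \<circ> g c"
      by (intro ext) (simp add: g_def tau_def v_def Fc zero_fun_def algebra_simps)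
    then show ?case using FL_tau[OF Suc.IH bv vc] Suc.prems by (metis Suc_leD)
  qed
  from this[of d] have "g d \<in> FL" by simp
  moreover have "g d = bmap F"
    by (intro ext) (simp add: g_def bmap_def funcl_expand[OF B_funcl[OF F], symmetric])
  ultimately show ?thesis by simp
qed

lemma bmap_supp: "F \<in> B \<Longrightarrow> supp (d + m) (bmap F)"
proof -
  assume F: "F \<in> B"
  then have "F i x = 0" if "i \<ge> d + m" for i x using that by (auto simp: B_def I_def zero_fun_def)
  moreover have "F i x = 0" if "\<forall>j<d+m. x j = 0" for i x
    using B_funcl[OF F, of i] that by (simp add: funcl_def)
  ultimately show ?thesis by (simp add: supp_def bmap_def)
qed

lemma bmap_AL: "F \<in> B \<Longrightarrow> bmap F \<in> AL"
  using bmap_FL[of F] B_low[of F 0] B_low[of F 1] d by (simp add: AL_def bmap_def zero_fun_def)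

definition bel :: "(nat \<Rightarrow> vec \<Rightarrow> bit) \<Rightarrow> al" where "bel F = Abs_al (bmap F)"

lemma al_fun_bel: "F \<in> B \<Longrightarrow> al_fun (bel F) = bmap F"
  by (simp add: bel_def Abs_al_inverse bmap_AL)

lemma bel_Hd: "F \<in> B \<Longrightarrow> bel F \<in> Hd (d + m)"
  by (simp add: Hd_def al_fun_bel bmap_supp)

lemma bmap_low: "F \<in> B \<Longrightarrow> j < d \<Longrightarrow> bmap F x j = x j"
  using B_low[of F j] by (simp add: bmap_def zero_fun_def)

text \<open>\<open>F\<close> reads only coordinates below \<open>d\<close>, which
  \<open>bmap G\<close> leaves alone, so composition adds the blocks.\<close>

lemma bel_add:
  assumes F: "F \<in> B" "G \<in> B" shows "bel F + bel G = bel (F + G)"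
proof -
  have "bmap F (bmap G x) = bmap (F + G) x" for x
  proof
    fix i
    have "F i (bmap G x) = F i x" by (rule funcl_cong[OF B_funcl[OF F(1)]]) (simp add: bmap_low[OF F(2)])
    then show "bmap F (bmap G x) i = bmap (F + G) x i"
      unfolding bmap_def[of F] bmap_def[of "F + G"] by (simp add: bmap_def plus_fun_def algebra_simps)
  qed
  then show ?thesis
    by (simp add: al_fun_inject[symmetric] al_fun_simps al_fun_bel F B_add fun_eq_iff)
qed

lemma bel_eq_0: "F \<in> B \<Longrightarrow> bel F = 0 \<longleftrightarrow> F = 0"
proof
  assume F: "F \<in> B" "bel F = 0"
  then have "bmap F x = x" for x using al_fun_bel[of F] al_fun_simps(1) by simp
  then have "x i + F i x = x i" for x i unfolding bmap_def by metis
  then have "F i x = 0" for i x using add_left_cancel[of "x i" "F i x" 0] by simp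
  then show "F = 0" by (simp add: fun_eq_iff zero_fun_def)
next
  assume F: "F \<in> B" "F = 0"
  then have "bmap F = id" by (simp add: bmap_def zero_fun_def fun_eq_iff)
  then show "bel F = 0" using al_fun_bel[OF F(1)] by (simp add: al_fun_inject[symmetric] al_fun_simps)
qed

lemma F_self [simp]: "(F :: nat \<Rightarrow> vec \<Rightarrow> bit) + F = 0"
  by (simp add: fun_eq_iff plus_fun_def zero_fun_def)

lemma bel_uminus: "F \<in> B \<Longrightarrow> - bel F = bel F"
  using bel_add[of F F] bel_eq_0[OF B_0] by (simp add: eq_neg_iff_add_eq_0 minus_equation_iff neg_eq_iff_add_eq_0)

lemma Y_V: "y \<in> Y \<Longrightarrow> y i \<in> V d"
  by (cases "i \<in> I") (auto simp: Y_def V_def)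

lemma Y_add: "y \<in> Y \<Longrightarrow> y' \<in> Y \<Longrightarrow> y + y' \<in> Y"
  by (auto simp: Y_def V_def plus_fun_def)

lemma finite_I [simp]: "finite I" and card_I: "card I = m" by (simp_all add: I_def)

lemma finite_Y: "finite Y" and card_Y: "card Y = (2 ^ d) ^ m"
  using card_functions_zero_outside[of I "V d"] by (simp_all add: Y_def card_V card_I)

text \<open>Reads off the matrix entries of the functionals. It gives
  \<open>card B \<le> card Y\<close>, by which a proportion of characters bounds a trace from
  below.\<close>

lemma B_inj: "inj_on (\<lambda>F i j. if j < d then F i (unit_vec j) else 0) B"
proof (rule inj_onI)
  fix F G assume FG: "F \<in> B" "G \<in> B"
    "(\<lambda>i j. if j < d then F i (unit_vec j) else 0) = (\<lambda>i j. if j < d then G i (unit_vec j) else 0)"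
  have "F i (unit_vec j) = G i (unit_vec j)" if "j < d" for i j
    using fun_cong[OF fun_cong[OF FG(3), of i], of j] that by simp
  then have "(\<Sum>j<d. F i (unit_vec j) * x j) = (\<Sum>j<d. G i (unit_vec j) * x j)" for i x by simp
  then show "F = G"
    using funcl_expand[OF B_funcl[OF FG(1)]] funcl_expand[OF B_funcl[OF FG(2)]] by (intro ext) metis
qed

lemma B_into: "(\<lambda>F i j. if j < d then F i (unit_vec j) else 0) ` B \<subseteq> Y"
  by (auto simp: B_def Y_def V_def zero_fun_def fun_eq_iff)

lemma finite_B: "finite B" and card_B: "card B \<le> card Y"
  using inj_on_finite[OF B_inj B_into finite_Y] card_inj_on_le[OF B_inj B_into finite_Y] by auto

lemma card_B_pos: "card B > 0"
  using B_0 finite_B card_gt_0_iff by blast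

section \<open>Characters of the block group and their spectral projections\<close>

definition pair :: "(nat \<Rightarrow> vec \<Rightarrow> bit) \<Rightarrow> (nat \<Rightarrow> vec) \<Rightarrow> bit" where
  "pair F y = (\<Sum>i\<in>I. F i (y i))"

lemma pair_add_left: "pair (F + G) y = pair F y + pair G y"
  by (simp add: pair_def plus_fun_def sum.distrib)

lemma pair_add_right: "F \<in> B \<Longrightarrow> pair F (y + y') = pair F y + pair F y'"
  using B_funcl[of F] by (simp add: pair_def plus_fun_def[of y] sum.distrib funcl_def)

lemma sum_shift_B: "G \<in> B \<Longrightarrow> (\<Sum>F\<in>B. f (F + G)) = (\<Sum>F\<in>B. f F)"
  by (rule sum.reindex_bij_witness[of _ "\<lambda>F. F + G" "\<lambda>F. F + G"])
    (auto simp: B_add add.assoc)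

text \<open>Orthogonality of characters: translating the sum by some \<open>G\<close> at which the
  character is -1 changes its sign.\<close>

lemma character_sum:
  assumes y: "y \<in> Y" shows "(\<Sum>F\<in>B. sg (pair F y)) = (if y = 0 then real (card B) else 0)"
proof (cases "y = 0")
  case True
  have "pair F y = 0" if "F \<in> B" for F
    using funcl_0_val[OF B_funcl[OF that]] by (simp add: pair_def True zero_fun_def[where 'a=nat])
  then show ?thesis using True by simp
next
  case False
  then obtain i where i: "y i \<noteq> 0" by (auto simp: fun_eq_iff zero_fun_def[where 'a=nat])
  then have iI: "i \<in> I" using y by (auto simp: Y_def)
  obtain j where j: "y i j \<noteq> 0" using i by (metis ext zero_fun_def)
  then have jd: "j < d" using Y_V[OF y, of i] by (auto simp: V_def not_le[symmetric])
  \<comment> \<open>The block matrix with its only nonzero entry at a place where \<open>y\<close>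
    does not vanish.\<close>
  define G where "G = (\<lambda>i' x. if i' = i then x j else (0::bit))"
  have G: "G \<in> B" using iI jd by (auto simp: G_def B_def funcl_def zero_fun_def plus_fun_def)
  have "pair G y = (\<Sum>i'\<in>I. if i' = i then y i j else 0)"
    unfolding pair_def by (intro sum.cong) (auto simp: G_def)
  then have "pair G y = 1" using iI j by simp
  then have "(\<Sum>F\<in>B. sg (pair F y)) = (\<Sum>F\<in>B. - sg (pair F y))"
    using sum_shift_B[OF G, of "\<lambda>F. sg (pair F y)"] by (simp add: pair_add_left sg_add)
  then show ?thesis using False by (simp add: sum_negf)
qed

text \<open>The spectral projection of the character \<open>sg (pair F y)\<close> in the group
  algebra of the block group.\<close>

definition q :: "(nat \<Rightarrow> vec) \<Rightarrow> al \<Rightarrow>\<^sub>0 real" where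
  "q y = (\<Sum>F\<in>B. single (bel F) (sg (pair F y) / card B))"

lemma q_mult:
  assumes y: "y \<in> Y" "y' \<in> Y" shows "q y * q y' = (if y = y' then q y else 0)"
proof -
  let ?n = "real (card B)"
  have n: "?n \<noteq> 0" using card_B_pos by simp
  have "q y * q y' = (\<Sum>F\<in>B. \<Sum>G\<in>B. single (bel (F + G)) (sg (pair F y) * sg (pair G y') / ?n\<^sup>2))"
    unfolding q_def sum_product by (intro sum.cong refl) (simp add: mult_single bel_add power2_eq_square)
  also have "\<dots> = (\<Sum>F\<in>B. \<Sum>G\<in>B. single (bel G) (sg (pair F y) * sg (pair (G + F) y') / ?n\<^sup>2))"
  proof (rule sum.cong[OF refl])
    fix F assume F: "F \<in> B"
    have "(G + F) + F = G" for G by (simp add: add.assoc)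
    then show "(\<Sum>G\<in>B. single (bel (F + G)) (sg (pair F y) * sg (pair G y') / ?n\<^sup>2))
        = (\<Sum>G\<in>B. single (bel G) (sg (pair F y) * sg (pair (G + F) y') / ?n\<^sup>2))"
      by (subst sum_shift_B[OF F, symmetric]) (simp add: add.commute[of F])
  qed
  also have "\<dots> = (\<Sum>G\<in>B. \<Sum>F\<in>B. single (bel G) (sg (pair G y') / ?n\<^sup>2 * sg (pair F (y + y'))))"
    by (subst sum.swap) (intro sum.cong refl, simp add: pair_add_left pair_add_right sg_add mult_ac)
  also have "\<dots> = (\<Sum>G\<in>B. single (bel G) (sg (pair G y') / ?n\<^sup>2 * (\<Sum>F\<in>B. sg (pair F (y + y')))))"
    by (intro sum.cong refl poly_mapping_eqI) (simp add: lookup_sum lookup_single when_def sum_distrib_left)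
  also have "\<dots> = (if y = y' then q y else 0)"
  proof -
    have "y + y' = 0 \<longleftrightarrow> y = y'"
    proof
      assume *: "y + y' = 0"
      have "y i j = y' i j" for i j
        using fun_cong[OF fun_cong[OF *, of i], of j] by (cases "y i j"; cases "y' i j") (auto simp: plus_fun_def zero_fun_def)
      then show "y = y'" by (simp add: fun_eq_iff)
    qed (simp add: fun_eq_iff plus_fun_def zero_fun_def)
    then show ?thesis
      using n by (auto simp: character_sum[OF Y_add[OF y]] q_def power2_eq_square)
  qed
  finally show ?thesis .
qed

lemma star_q: "star (q y) = q y"
  unfolding q_def star_sum by (intro sum.cong) (simp_all add: bel_uminus)

lemma tr_q: "y \<in> Y \<Longrightarrow> tr (q y) = 1 / card B"
proof -
  assume "y \<in> Y"
  have "tr (q y) = (\<Sum>F\<in>B. if F = 0 then 1 / card B else 0)"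
    unfolding q_def tr_sum
    by (intro sum.cong) (auto simp: tr_single bel_eq_0 pair_def zero_fun_def)
  then show ?thesis using B_0 finite_B by simp
qed

lemma keys_q: "keys (q y) \<subseteq> Hd (d + m)"
  unfolding q_def by (intro keys_sum_subset) (auto simp: bel_Hd)

section \<open>The action on characters and its fundamental domains\<close>

definition act :: "al \<Rightarrow> (nat \<Rightarrow> vec) \<Rightarrow> nat \<Rightarrow> vec" where "act k y = (\<lambda>i. al_fun k (y i))"

lemma act_Y: "k \<in> Hd d \<Longrightarrow> y \<in> Y \<Longrightarrow> act k y \<in> Y"
  using FL_zero[OF al_fun_FL[of k]] by (auto simp: Y_def act_def Hd_def supp_V)

lemma act_add: "act (k + l) y = act k (act l y)"
  by (simp add: act_def al_fun_simps)

lemma act_0 [simp]: "act 0 y = y"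
  by (simp add: act_def al_fun_simps)

text \<open>Conjugation by \<open>k\<close> composes each row functional with the inverse of
  \<open>k\<close>, since the block has no rows below \<open>d\<close> and \<open>k\<close> is
  trivial from \<open>d\<close> on. On the other side of the pairing this is the action of
  \<open>k\<close> on \<open>y\<close>.\<close>

lemma conj_q:
  assumes k: "k \<in> Hd d" shows "u k * q y * u (- k) = q (act k y)"
proof -
  have sk: "supp d (al_fun k)" using k by (simp add: Hd_def)
  have ski: "supp d (al_fun (- k))" using subgrpD(3)[OF subgrp_Hd k] by (simp add: Hd_def)
  define c where "c l F = (\<lambda>i x. F i (al_fun l x))" for l :: al and F :: "nat \<Rightarrow> vec \<Rightarrow> bit"
  have c_B: "c l F \<in> B" if "F \<in> B" "l \<in> Hd d" for l F
  proof -
    have "funcl (\<lambda>x. F i (al_fun l x))" for i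
      using B_funcl[OF that(1), of i] FL_linear[OF al_fun_FL[of l]] that(2)
      by (auto simp: funcl_def Hd_def supp_def)
    then show ?thesis using that(1) by (auto simp: B_def c_def zero_fun_def)
  qed
  have cc: "c k (c (- k) F) = F" "c (- k) (c k F) = F" for F
    by (simp_all add: c_def al_fun_inv)
  have kk: "- k \<in> Hd d" using subgrpD(3)[OF subgrp_Hd k] .
  have conj: "k + bel F - k = bel (c (- k) F)" if F: "F \<in> B" for F
  proof -
    have "al_fun k (bmap F (al_fun (- k) x)) i = bmap (c (- k) F) x i" for x i
    proof (cases "i < d")
      case True
      have "al_fun k (bmap F (al_fun (- k) x)) i = al_fun k (al_fun (- k) x) i"
        by (rule supp_below[OF al_fun_FL sk _ True]) (simp add: bmap_low[OF F])
      then show ?thesis using True bmap_low[OF c_B[OF F kk], of i x] by (simp add: al_fun_inv)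
    next
      case False
      then have "al_fun k (bmap F (al_fun (- k) x)) i = bmap F (al_fun (- k) x) i"
        using sk by (simp add: supp_def)
      also have "\<dots> = bmap (c (- k) F) x i"
        using ski False by (simp add: bmap_def c_def supp_def)
      finally show ?thesis .
    qed
    then have "al_fun k \<circ> bmap F \<circ> al_fun (- k) = bmap (c (- k) F)" by (simp add: fun_eq_iff)
    then have "al_fun (k + bel F + - k) = al_fun (bel (c (- k) F))"
      using F c_B[OF F kk] by (simp only: al_fun_simps(2) al_fun_bel)
    then show ?thesis by (simp add: al_fun_inject)
  qed
  have "u k * q y * u (- k) = (\<Sum>F\<in>B. single (k + bel F - k) (sg (pair F y) / card B))"
    by (simp add: q_def sum_distrib_left sum_distrib_right mult_single)
  also have "\<dots> = (\<Sum>F\<in>B. single (bel (c (- k) F)) (sg (pair F y) / card B))"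
    by (intro sum.cong refl) (simp add: conj)
  also have "\<dots> = (\<Sum>F\<in>B. single (bel F) (sg (pair (c k F) y) / card B))"
    by (rule sum.reindex_bij_witness[of _ "c k" "c (- k)"]) (auto simp: cc c_B k kk)
  also have "\<dots> = q (act k y)"
    by (simp add: q_def pair_def c_def act_def)
  finally show ?thesis .
qed

text \<open>\<open>u k\<close> carries the projection of \<open>D\<close> to that of the translate
  of \<open>D\<close> by \<open>k\<close>, a disjoint set of characters, hence to an orthogonal
  projection.\<close>

lemma wandering_fundamental_domain:
  assumes D: "D \<subseteq> Y" "\<And>k y. k \<in> Hd d \<Longrightarrow> k \<noteq> 0 \<Longrightarrow> y \<in> D \<Longrightarrow> act k y \<notin> D"
  shows "wandering (Hd d) (sum q D)" "tr (sum q D) = real (card D) / card B"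
proof -
  have fin: "finite D" using D(1) finite_Y finite_subset by blast
  show "wandering (Hd d) (sum q D)"
  proof
    show "sum q D * sum q D = sum q D"
    proof -
      have "sum q D * sum q D = (\<Sum>y\<in>D. \<Sum>y'\<in>D. if y = y' then q y else 0)"
        unfolding sum_product using D(1) by (intro sum.cong refl) (auto simp: q_mult subset_iff)
      then show ?thesis using fin by simp
    qed
    show "star (sum q D) = sum q D" by (simp add: star_sum star_q)
    fix k assume k: "k \<in> Hd d" "k \<noteq> 0"
    have "sum q D * (u k * sum q D * u (- k)) = (\<Sum>y\<in>D. \<Sum>y'\<in>D. q y * q (act k y'))"
      by (simp add: sum_distrib_left[of "u k"] sum_distrib_right conj_q[OF k(1)]) (simp add: sum_distrib_left)
    also have "\<dots> = 0"
      using D k act_Y[OF k(1)] by (intro sum.neutral ballI) (auto simp: q_mult subset_iff)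
    finally have "sum q D * (u k * sum q D * u (- k)) * u k = 0" by simp
    then show "sum q D * u k * sum q D = 0"
      by (simp add: mult.assoc mult_single)
  qed (simp_all add: subgrp_Hd finite_Hd)
  show "tr (sum q D) = real (card D) / card B"
    using D(1) by (simp add: tr_sum tr_q subset_iff)
qed

text \<open>The fixed vectors of a nontrivial \<open>k\<close> in \<open>V d\<close> form a proper
  subspace, at most half of the whole. A tuple is fixed iff its \<open>m\<close> components are, so
  at most the fraction \<open>1 / 2 ^ m\<close> of \<open>Y\<close> is fixed.\<close>

lemma card_fixed_points:
  assumes k: "k \<in> Hd d" "k \<noteq> 0"
  shows "2 ^ m * card {y \<in> Y. act k y = y} \<le> card Y"
proof -
  let ?A = "{x \<in> V d. al_fun k x = x}"
  have sk: "supp d (al_fun k)" using k by (simp add: Hd_def)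
  have "\<exists>x\<in>V d. al_fun k x \<noteq> x"
  proof (rule ccontr)
    assume "\<not> ?thesis"
    then have "al_fun k (trunc d x) = trunc d x" for x using trunc_V by blast
    then have "al_fun k x = x" for x
      using supp_trunc[OF al_fun_FL sk, of x] by (simp add: add.left_commute[of "trunc d x"])
    then show False using k(2) by (simp add: al_fun_inject[symmetric] al_fun_simps fun_eq_iff)
  qed
  then obtain w where w: "w \<in> V d" "al_fun k w \<noteq> w" by blast
  have fA: "finite ?A" by simp
  \<comment> \<open>Translating by a moved vector \<open>w\<close> gives a coset disjoint from the
    fixed subspace.\<close>
  have "2 * card ?A = card (?A \<union> (\<lambda>x. w + x) ` ?A)"
  proof -
    have "?A \<inter> (\<lambda>x. w + x) ` ?A = {}" using w(2) by (auto simp: FL_linear[OF al_fun_FL])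
    moreover have "card ((\<lambda>x. w + x) ` ?A) = card ?A" by (intro card_image) (auto simp: inj_on_def)
    ultimately show ?thesis using card_Un_disjoint[OF fA finite_imageI[OF fA]] by simp
  qed
  also have "\<dots> \<le> card (V d)"
    using w(1) by (intro card_mono finite_V) (auto simp: V_def plus_fun_def)
  finally have "2 * card ?A \<le> 2 ^ d" by (simp add: card_V)
  then have "(2 * card ?A) ^ m \<le> (2 ^ d) ^ m" by (rule power_mono) simp
  moreover have "{y \<in> Y. act k y = y} = {y. (\<forall>i. i \<notin> I \<longrightarrow> y i = 0) \<and> (\<forall>i\<in>I. y i \<in> ?A)}"
    using FL_zero[OF al_fun_FL[of k]] by (auto simp: Y_def act_def fun_eq_iff[of "\<lambda>i. al_fun k (y i)" for y])
  ultimately show ?thesis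
    using card_functions_zero_outside(2)[OF finite_I fA] by (simp add: card_Y card_I power_mult_distrib)
qed

text \<open>After numbering \<open>Y\<close>, the set \<open>D\<close> takes the point of least
  number from each free orbit; strictness excludes points with nontrivial stabilizer. Translates of
  \<open>D\<close> cover the free points, and \<open>card_fixed_points\<close> bounds the others.
  The count is multiplied by \<open>2 ^ m\<close> to stay within natural numbers.\<close>

lemma fundamental_domain:
  "\<exists>D\<subseteq>Y. (\<forall>k\<in>Hd d. k \<noteq> 0 \<longrightarrow> (\<forall>y\<in>D. act k y \<notin> D)) \<and>
     2 ^ m * card Y \<le> card (Hd d) * card Y + 2 ^ m * (card (Hd d) * card D)"
proof -
  obtain f :: "(nat \<Rightarrow> vec) \<Rightarrow> nat" where f: "inj_on f Y" using finite_imp_inj_to_nat_seg[OF finite_Y] by blast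
  define D where "D = {y \<in> Y. \<forall>k\<in>Hd d. k \<noteq> 0 \<longrightarrow> f y < f (act k y)}"
  have DY: "D \<subseteq> Y" by (auto simp: D_def)
  have neg: "- k \<in> Hd d" if "k \<in> Hd d" for k using subgrpD(3)[OF subgrp_Hd that] .
  have wander: "act k y \<notin> D" if "k \<in> Hd d" "k \<noteq> 0" "y \<in> D" for k y
  proof
    assume "act k y \<in> D"
    then have "f (act k y) < f (act (- k) (act k y))" using neg[OF that(1)] that(2) by (simp add: D_def)
    moreover have "act (- k) (act k y) = y" by (simp add: act_add[symmetric])
    moreover have "f y < f (act k y)" using that by (simp add: D_def)
    ultimately show False by simp
  qed
  define N where "N = (\<Union>k\<in>Hd d - {0}. {y \<in> Y. act k y = y})"
  have free: "Y - N \<subseteq> (\<Union>k\<in>Hd d. act k ` D)"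
  proof
    fix y assume y: "y \<in> Y - N"
    obtain k where k: "k \<in> Hd d" "\<And>l. l \<in> Hd d \<Longrightarrow> f (act k y) \<le> f (act l y)"
      using ex_has_least_nat[of "\<lambda>k. k \<in> Hd d" 0 "\<lambda>k. f (act k y)"] subgrpD(1)[OF subgrp_Hd[of d]] by blast
    have "f (act k y) < f (act l (act k y))" if l: "l \<in> Hd d" "l \<noteq> 0" for l
    proof -
      have "f (act k y) \<le> f (act l (act k y))"
        using k(2)[OF subgrpD(2)[OF subgrp_Hd l(1) k(1)]] by (simp add: act_add)
      moreover have "f (act k y) \<noteq> f (act l (act k y))"
      proof
        assume "f (act k y) = f (act l (act k y))"
        moreover have "act k y \<in> Y" using act_Y[OF k(1)] y by blast
        ultimately have "act k y = act l (act k y)" using inj_onD[OF f] act_Y[OF l(1)] by blast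
        then have "act (- k) (act k y) = act (- k) (act l (act k y))" by simp
        then have "act (- k + l + k) y = y" by (simp add: act_add[symmetric] add.assoc)
        moreover have "- k + l + k \<in> Hd d"
          using subgrp_Hd[of d] neg[OF k(1)] k(1) l(1) by (simp add: subgrpD)
        moreover have "- k + l + k \<noteq> 0"
        proof
          assume "- k + l + k = 0"
          then have "k + (- k + l + k) + - k = 0" by simp
          then show False using l(2) by (simp add: add.assoc)
        qed
        ultimately show False using y by (auto simp: N_def)
      qed
      ultimately show ?thesis by simp
    qed
    then have "act k y \<in> D" using act_Y[OF k(1)] y by (auto simp: D_def)
    moreover have "y = act (- k) (act k y)" by (simp add: act_add[symmetric])
    ultimately show "y \<in> (\<Union>k\<in>Hd d. act k ` D)" using neg[OF k(1)] by blast
  qed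
  have finD: "finite D" using DY finite_Y finite_subset by blast
  have "card (\<Union>k\<in>Hd d. act k ` D) \<le> (\<Sum>k\<in>Hd d. card (act k ` D))" by (rule card_UN_le[OF finite_Hd])
  also have "\<dots> \<le> (\<Sum>k\<in>Hd d. card D)" by (intro sum_mono card_image_le finD)
  finally have "card (\<Union>k\<in>Hd d. act k ` D) \<le> card (Hd d) * card D" by simp
  moreover have "finite (\<Union>k\<in>Hd d. act k ` D)" using finD finite_Hd by simp
  ultimately have 1: "card (Y - N) \<le> card (Hd d) * card D"
    using card_mono[OF _ free] le_trans by blast
  have "card N \<le> (\<Sum>k\<in>Hd d - {0}. card {y \<in> Y. act k y = y})"
    unfolding N_def by (rule card_UN_le) (simp add: finite_Hd)
  then have "2 ^ m * card N \<le> (\<Sum>k\<in>Hd d - {0}. 2 ^ m * card {y \<in> Y. act k y = y})"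
    by (simp add: sum_distrib_left[symmetric])
  also have "\<dots> \<le> (\<Sum>k\<in>Hd d - {0}. card Y)" by (intro sum_mono card_fixed_points) auto
  also have "\<dots> \<le> card (Hd d) * card Y" using card_mono[OF finite_Hd, of "Hd d - {0}" d] by simp
  finally have 2: "2 ^ m * card N \<le> card (Hd d) * card Y" .
  have "N \<subseteq> Y" by (auto simp: N_def)
  then have "card Y = card (Y - N) + card N"
    using card_Diff_subset[of N Y] card_mono[OF finite_Y, of N] finite_subset[OF _ finite_Y] by simp
  then have "2 ^ m * card Y = 2 ^ m * card (Y - N) + 2 ^ m * card N" by (simp add: distrib_left)
  also have "\<dots> \<le> 2 ^ m * (card (Hd d) * card D) + card (Hd d) * card Y"
    using 1 2 by (intro add_mono mult_le_mono2)
  finally have "2 ^ m * card Y \<le> card (Hd d) * card Y + 2 ^ m * (card (Hd d) * card D)" by simp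
  then show ?thesis using DY wander by blast
qed

end

text \<open>The defect is at most \<open>card (Hd d) / 2 ^ m\<close>, the bound for the proportion
  of characters that are not free, and \<open>m\<close> is chosen accordingly.\<close>

lemma wandering_exists:
  assumes d: "d \<ge> 2" and e: "e > 0"
  shows "\<exists>m p. wandering (Hd d) p \<and> keys p \<subseteq> Hd (d + m) \<and> 1 - real (card (Hd d)) * tr p \<le> e"
proof -
  obtain m where m: "real (card (Hd d)) / 2 ^ m \<le> e"
  proof -
    obtain m where "real (card (Hd d)) / e < 2 ^ m" using real_arch_pow[of 2] by auto
    then have "real (card (Hd d)) / 2 ^ m \<le> e" using e by (simp add: field_simps)
    then show ?thesis using that by blast
  qed
  interpret unipotent d m by unfold_locales (rule d)
  obtain D where D: "D \<subseteq> Y" "\<And>k y. k \<in> Hd d \<Longrightarrow> k \<noteq> 0 \<Longrightarrow> y \<in> D \<Longrightarrow> act k y \<notin> D"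
    and le: "2 ^ m * card Y \<le> card (Hd d) * card Y + 2 ^ m * (card (Hd d) * card D)"
    using fundamental_domain by blast
  have Ypos: "real (card Y) > 0" by (simp add: card_Y)
  have "real (2 ^ m * card Y) \<le> real (card (Hd d) * card Y + 2 ^ m * (card (Hd d) * card D))"
    using le by (simp only: of_nat_le_iff)
  then have "1 - real (card (Hd d)) * (real (card D) / card Y) \<le> real (card (Hd d)) / 2 ^ m"
    using Ypos by (simp add: field_simps)
  moreover have "real (card D) / card Y \<le> real (card D) / card B"
    using card_B card_B_pos by (intro divide_left_mono) auto
  then have "real (card (Hd d)) * (real (card D) / card Y) \<le> real (card (Hd d)) * tr (sum q D)"
    using wandering_fundamental_domain(2)[OF D(1)] D(2) by (intro mult_left_mono) auto
  ultimately have "1 - real (card (Hd d)) * tr (sum q D) \<le> e" using m by linarith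
  moreover have "keys (sum q D) \<subseteq> Hd (d + m)" by (intro keys_sum_subset keys_q)
  ultimately show ?thesis using wandering_fundamental_domain(1)[OF D] by blast
qed

section \<open>Conjugation by coordinate permutations\<close>

text \<open>Conjugation by a permutation matrix. It is applied to involutions
  \<open>\<sigma>\<close>, hence no inverse in the formula.\<close>

definition cj :: "(nat \<Rightarrow> nat) \<Rightarrow> (vec \<Rightarrow> vec) \<Rightarrow> vec \<Rightarrow> vec" where
  "cj \<sigma> h x = h (x \<circ> \<sigma>) \<circ> \<sigma>"

definition fin_involution :: "(nat \<Rightarrow> nat) \<Rightarrow> bool" where
  "fin_involution \<sigma> \<longleftrightarrow> (\<forall>k. \<sigma> (\<sigma> k) = k) \<and> (\<exists>d. \<forall>k\<ge>d. \<sigma> k = k)"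

lemma fin_involution_comp: "fin_involution \<sigma> \<Longrightarrow> x \<circ> \<sigma> \<circ> \<sigma> = x"
  by (simp add: fin_involution_def fun_eq_iff)

lemma cj_comp: "fin_involution \<sigma> \<Longrightarrow> cj \<sigma> (g \<circ> h) = cj \<sigma> g \<circ> cj \<sigma> h"
  by (simp add: cj_def fun_eq_iff[of "cj \<sigma> (g \<circ> h)"] fin_involution_comp)

lemma cj_id: "fin_involution \<sigma> \<Longrightarrow> cj \<sigma> id = id"
  by (simp add: cj_def[abs_def] fin_involution_comp fun_eq_iff[of _ id])

lemma cj_cj: "fin_involution \<sigma> \<Longrightarrow> cj \<sigma> (cj \<sigma> h) = h"
  by (simp add: cj_def[abs_def] fin_involution_comp)

lemma cj_tau:
  assumes "fin_involution \<sigma>" shows "cj \<sigma> (tau v N) = tau (v \<circ> \<sigma>) (\<sigma> N)"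
  using assms by (intro ext) (simp add: cj_def tau_def fin_involution_def)

lemma bounded_supp_perm:
  assumes "fin_involution \<sigma>" "bounded_supp v" shows "bounded_supp (v \<circ> \<sigma>)"
proof -
  obtain a b where "\<forall>k\<ge>a. \<sigma> k = k" "\<forall>k\<ge>b. v k = 0"
    using assms by (auto simp: fin_involution_def bounded_supp_def)
  then have "\<forall>k\<ge>max a b. (v \<circ> \<sigma>) k = 0" by simp
  then show ?thesis unfolding bounded_supp_def by blast
qed

lemma cj_FL: "h \<in> FL \<Longrightarrow> fin_involution \<sigma> \<Longrightarrow> cj \<sigma> h \<in> FL"
proof (induction rule: FL.induct)
  case FL_id
  then show ?case by (metis cj_id FL.FL_id)
next
  case (FL_tau h v N)
  then have "tau (v \<circ> \<sigma>) (\<sigma> N) \<circ> cj \<sigma> h \<in> FL"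
    by (intro FL.FL_tau bounded_supp_perm) (auto simp: fin_involution_def)
  then show ?case using FL_tau.prems by (metis cj_comp cj_tau)
qed

lemma cj_supp:
  assumes \<sigma>: "fin_involution \<sigma>" "\<forall>k\<ge>d. \<sigma> k = k" and h: "supp d h"
  shows "supp d (cj \<sigma> h)"
proof -
  have below: "\<sigma> j < d" if "j < d" for j
    using that \<sigma> unfolding fin_involution_def by (metis not_le)
  have "cj \<sigma> h x k = x k" if "k \<ge> d" for x k
    using that \<sigma>(2) h by (simp add: cj_def supp_def)
  moreover have "cj \<sigma> h x = x" if "\<forall>j<d. x j = 0" for x
  proof -
    have "h (x \<circ> \<sigma>) = x \<circ> \<sigma>" using that below h by (simp add: supp_def)
    then show ?thesis using fin_involution_comp[OF \<sigma>(1)] by (simp add: cj_def)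
  qed
  ultimately show ?thesis unfolding supp_def by blast
qed

text \<open>Brings the trivial rows \<open>s\<close> and \<open>s + 1\<close> of a matrix supported
  below \<open>s\<close> to positions 0 and 1, at the price of support \<open>s + 2\<close>. For
  \<open>s\<close> at least 2 the two pairs of coordinates are disjoint.\<close>

definition sw :: "nat \<Rightarrow> nat \<Rightarrow> nat" where
  "sw s i = (if i = 0 then s else if i = 1 then s + 1 else if i = s then 0 else if i = s + 1 then 1 else i)"

lemma sw_involution: "s \<ge> 2 \<Longrightarrow> fin_involution (sw s)"
  unfolding fin_involution_def by (auto simp: sw_def intro!: exI[of _ "s + 2"])

lemma sw_fixed: "s \<ge> 2 \<Longrightarrow> \<forall>k\<ge>s+2. sw s k = k"
  by (simp add: sw_def)

definition to_fl :: "nat \<Rightarrow> al \<Rightarrow> fl" where "to_fl s h = Abs_fl (cj (sw s) (al_fun h))"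
definition to_al :: "nat \<Rightarrow> fl \<Rightarrow> al" where "to_al s g = Abs_al (cj (sw s) (fl_fun g))"

lemma fl_fun_to_fl: "s \<ge> 2 \<Longrightarrow> fl_fun (to_fl s h) = cj (sw s) (al_fun h)"
  by (simp add: to_fl_def Abs_fl_inverse cj_FL al_fun_FL sw_involution)

lemma to_al_to_fl: "s \<ge> 2 \<Longrightarrow> to_al s (to_fl s h) = h"
  by (simp add: to_al_def fl_fun_to_fl cj_cj sw_involution al_fun_inverse)

lemma to_fl_add: "s \<ge> 2 \<Longrightarrow> to_fl s (h + k) = to_fl s h + to_fl s k"
  by (simp add: fl_fun_inject[symmetric] fl_fun_simps(2) fl_fun_to_fl al_fun_simps(2) cj_comp sw_involution)

lemma to_al_supp:
  assumes s: "s \<ge> 2" and g: "supp s (fl_fun g)"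
  shows "to_al s g \<in> Hd (s + 2)" "to_fl s (to_al s g) = g"
proof -
  have "cj (sw s) (fl_fun g) x 0 = x 0 \<and> cj (sw s) (fl_fun g) x 1 = x 1" for x
    using s g by (simp add: cj_def supp_def sw_def)
  then have "cj (sw s) (fl_fun g) \<in> AL"
    using cj_FL[OF fl_fun sw_involution[OF s]] by (simp add: AL_def)
  then have f: "al_fun (to_al s g) = cj (sw s) (fl_fun g)"
    by (simp add: to_al_def Abs_al_inverse)
  show "to_al s g \<in> Hd (s + 2)"
    using cj_supp[OF sw_involution[OF s] sw_fixed[OF s], of "fl_fun g"] supp_mono[OF g] by (simp add: Hd_def f)
  show "to_fl s (to_al s g) = g"
    by (simp add: to_fl_def f cj_cj sw_involution s fl_fun_inverse)
qed

section \<open>The two groups have isomorphic von Neumann algebras\<close>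

text \<open>Both embeddings of \<open>W n\<close> land in \<open>Hd (s (Suc n) + 2)\<close>: the old
  one has image \<open>Hd (s (Suc n))\<close>, and as elements of \<open>W n\<close> are supported
  below \<open>s (Suc n)\<close>, the next permutation adds only two coordinates. A projection
  wandering for this group needs further coordinates, and the next stage is made large enough to
  contain them.\<close>

lemma fl_al_tower: "\<exists>(W :: nat \<Rightarrow> fl set) (\<phi> :: nat \<Rightarrow> fl \<Rightarrow> al) v. tower W \<phi> v"
proof -
  have "\<forall>d n. d \<ge> 2 \<longrightarrow> (\<exists>m p. wandering (Hd d) p \<and> keys p \<subseteq> Hd (d + m)
      \<and> 1 - real (card (Hd d)) * tr p \<le> (1/4) ^ n)"
    using wandering_exists by simp
  then obtain m p where mp: "\<And>d n. d \<ge> 2 \<Longrightarrow> wandering (Hd d) (p d n) \<and> keys (p d n) \<subseteq> Hd (d + m d n)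
      \<and> 1 - real (card (Hd d)) * tr (p d n) \<le> (1/4) ^ n" by metis
  \<comment> \<open>The start 2 keeps the exchanged pairs of coordinates disjoint. Each stage adds 2
    for the permutation and \<open>m (k + 2) n\<close> for the block that carries the wandering
    projection.\<close>
  define s where "s = rec_nat 2 (\<lambda>n k. k + 2 + m (k + 2) n)"
  have s_Suc: "s (Suc n) = s n + 2 + m (s n + 2) n" for n by (simp add: s_def)
  have s2: "s n \<ge> 2" for n by (induction n) (simp_all add: s_Suc, simp add: s_def)
  have s_ge: "s n \<ge> n" for n by (induction n) (simp_all add: s_Suc)
  define W where "W n = to_fl (s n) ` Hd (s (Suc n))" for n
  define \<phi> where "\<phi> n = to_al (s n)" for n
  have inv: "\<phi> n (to_fl (s n) h) = h" for n h by (simp add: \<phi>_def to_al_to_fl s2)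
  have image: "\<phi> n ` W n = Hd (s (Suc n))" for n by (simp add: W_def image_image inv)
  have hom: "hom_on (W n) (\<phi> n)" for n
    unfolding hom_on_def W_def by (auto simp: to_fl_add[symmetric] s2 inv)
  have inj: "inj_on (\<phi> n) (W n)" for n
    unfolding W_def by (auto simp: inj_on_def inv)
  have hom_fl: "hom_on UNIV (to_fl (s n))" for n by (simp add: hom_on_def to_fl_add s2)
  have sub: "subgrp (W n)" for n
    unfolding subgrp_def
  proof (intro conjI ballI)
    have U: "subgrp (UNIV :: al set)" by (simp add: subgrp_def)
    show "0 \<in> W n"
      using hom_on_0[OF U hom_fl, of n] subgrpD(1)[OF subgrp_Hd] unfolding W_def by (metis imageI)
    show "x + y \<in> W n" if "x \<in> W n" "y \<in> W n" for x y
      using that subgrpD(2)[OF subgrp_Hd] unfolding W_def by (auto simp: to_fl_add[symmetric] s2)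
    show "- x \<in> W n" if "x \<in> W n" for x
      using that subgrpD(3)[OF subgrp_Hd] unfolding W_def
      by (auto simp: hom_on_uminus[OF U hom_fl UNIV_I, symmetric])
  qed
  have small: "g \<in> W n \<and> \<phi> n g \<in> Hd (s n + 2)" if "supp (s n) (fl_fun g)" for g n
  proof -
    have h: "to_al (s n) g \<in> Hd (s n + 2)" "to_fl (s n) (to_al (s n) g) = g"
      using to_al_supp[OF s2 that] by auto
    then have "to_al (s n) g \<in> Hd (s (Suc n))" using Hd_mono[of "s n + 2" "s (Suc n)"] by (auto simp: s_Suc)
    then show ?thesis using h unfolding W_def \<phi>_def by (metis imageI)
  qed
  have W_supp: "supp (s (Suc n)) (fl_fun g)" if g: "g \<in> W n" for g n
  proof -
    obtain h where h: "h \<in> Hd (s (Suc n))" "g = to_fl (s n) h" using g by (auto simp: W_def)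
    have "\<forall>k\<ge>s (Suc n). sw (s n) k = k" using sw_fixed[OF s2, of n] by (simp add: s_Suc)
    then show ?thesis using cj_supp[OF sw_involution[OF s2]] h by (simp add: fl_fun_to_fl s2 Hd_def)
  qed
  have mono: "W n \<subseteq> W (Suc n)" for n using W_supp small by blast
  have exh: "\<exists>n. g \<in> W n" for g
  proof -
    obtain d where "supp d (fl_fun g)" using FL_supp fl_fun by blast
    then show ?thesis using small supp_mono s_ge by blast
  qed
  have imono: "\<phi> n ` W n \<subseteq> \<phi> (Suc n) ` W (Suc n)" for n
    unfolding image by (rule Hd_mono) (simp add: s_Suc[of "Suc n"])
  have iexh: "\<exists>n. h \<in> \<phi> n ` W n" for h
  proof -
    obtain d where "h \<in> Hd d" using Hd_UNIV by blast
    then have "h \<in> Hd (s (Suc d))" using Hd_mono[of d "s (Suc d)"] s_ge[of "Suc d"] by auto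
    then show ?thesis unfolding image by blast
  qed
  \<comment> \<open>The factor 4 of \<open>approx_conjugate\<close> is absorbed by demanding
    accuracy \<open>(1/4) ^ Suc n\<close>.\<close>
  have "\<exists>v. uni v \<and> keys v \<subseteq> \<phi> (Suc n) ` W (Suc n) \<and> (\<forall>y. keys y \<subseteq> W n \<and> uni y \<longrightarrow>
      nrm (v * push (\<phi> (Suc n)) y * star v - push (\<phi> n) y) \<le> 4 * (1/4) ^ Suc n)" for n
  proof (rule approx_conjugate[OF sub])
    let ?d = "s (Suc n) + 2"
    show "hom_on (W n) (\<phi> (Suc n))" using hom[of "Suc n"] mono[of n] by (auto simp: hom_on_def)
    show "inj_on (\<phi> (Suc n)) (W n)" using inj mono by (rule inj_on_subset)
    show "\<phi> (Suc n) ` W n \<subseteq> Hd ?d" using W_supp small by blast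
    show "\<phi> n ` W n \<subseteq> Hd ?d" unfolding image by (rule Hd_mono) simp
    have p: "wandering (Hd ?d) (p ?d (Suc n)) \<and> keys (p ?d (Suc n)) \<subseteq> Hd (?d + m ?d (Suc n))
      \<and> 1 - real (card (Hd ?d)) * tr (p ?d (Suc n)) \<le> (1/4) ^ Suc n" by (rule mp) simp
    then show "wandering (Hd ?d) (p ?d (Suc n))" "keys (p ?d (Suc n)) \<subseteq> \<phi> (Suc n) ` W (Suc n)"
      "1 - real (card (Hd ?d)) * tr (p ?d (Suc n)) \<le> (1/4) ^ Suc n"
      by (simp_all add: image s_Suc[of "Suc n"])
    show "subgrp (\<phi> (Suc n) ` W (Suc n))" unfolding image by (rule subgrp_Hd)
    show "Hd ?d \<subseteq> \<phi> (Suc n) ` W (Suc n)" unfolding image by (rule Hd_mono) (simp add: s_Suc[of "Suc n"])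
  qed (rule hom, rule inj)
  then obtain v where v: "\<And>n. uni (v n) \<and> keys (v n) \<subseteq> \<phi> (Suc n) ` W (Suc n) \<and> (\<forall>y. keys y \<subseteq> W n \<and> uni y \<longrightarrow>
      nrm (v n * push (\<phi> (Suc n)) y * star (v n) - push (\<phi> n) y) \<le> 4 * (1/4) ^ Suc n)" by metis
  \<comment> \<open>The unitary comparing stages \<open>n\<close> and \<open>Suc n\<close> is
    supported in stage \<open>Suc n\<close>, hence the shifted index and the filler 1 at 0.\<close>
  define v' where "v' n = (case n of 0 \<Rightarrow> 1 | Suc n \<Rightarrow> v n)" for n
  have "tower W \<phi> v'"
  proof
    show "uni (v' n)" for n using v by (simp add: v'_def uni_1 split: nat.split)
    show "keys (v' n) \<subseteq> \<phi> n ` W n" for n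
      using v subgrpD(1)[OF subgrp_Hd] by (simp add: v'_def image split: nat.split)
    show "nrm (v' (Suc n) * push (\<phi> (Suc n)) y * star (v' (Suc n)) - push (\<phi> n) y) \<le> (1/4) ^ n"
      if "keys y \<subseteq> W n" "uni y" for n y
      using v[of n] that by (simp add: v'_def)
  qed (rule sub mono exh hom inj imono iexh)+
  then show ?thesis by blast
qed

lemma Wstar_fl_al:
  assumes "group_transport (e :: 'b \<Rightarrow> fl) G" "group_transport (e' :: 'c \<Rightarrow> al) H"
  shows "Wstar_equivalent G H"
  using fl_al_tower tower.Wstar[OF _ assms] by blast

section \<open>Countable groups carried by the natural numbers\<close>

text \<open>Puts both groups on the same carrier type; an enumeration of the group becomes the
  transport map \<open>e\<close>.\<close>

lemma nat_carrier:
  assumes "countable (UNIV :: 'a::group_add set)" "infinite (UNIV :: 'a set)"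
  shows "\<exists>(e :: nat \<Rightarrow> 'a) G. group_transport e G"
proof -
  define e where "e = from_nat_into (UNIV :: 'a set)"
  have b: "bij e" unfolding e_def by (rule bij_betw_from_nat_into[OF assms])
  define i where "i = inv_into UNIV e"
  have ie: "i (e n) = n" "e (i x) = x" for n x
    using b by (simp_all add: i_def bij_is_inj bij_is_surj surj_f_inv_f)
  define G where "G = \<lparr>carrier = (UNIV :: nat set), monoid.mult = (\<lambda>x y. i (e x + e y)), one = i 0\<rparr>"
  have "group G"
  proof (rule groupI)
    fix x assume "x \<in> carrier G"
    have "i (- e x) \<otimes>\<^bsub>G\<^esub> x = \<one>\<^bsub>G\<^esub>" by (simp add: G_def ie)
    then show "\<exists>y\<in>carrier G. y \<otimes>\<^bsub>G\<^esub> x = \<one>\<^bsub>G\<^esub>" by (auto simp: G_def)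
  qed (simp_all add: G_def ie add.assoc)
  then have "group_transport e G"
    by (simp add: group_transport_def transport_def group_transport_axioms_def b) (simp add: G_def ie)
  then show ?thesis by blast
qed

lemma unit_vec_bounded_zero: "i \<noteq> N \<Longrightarrow> bounded_supp (unit_vec i) \<and> unit_vec i N = 0"
  by (rule conjI, rule bounded_supp_unit_vec) (simp add: unit_vec_def)

lemma tau_unit_vec_FL: "i \<noteq> N \<Longrightarrow> tau (unit_vec i) N \<in> FL"
  using unit_vec_bounded_zero by (intro tau_FL) auto

lemma tau_inj: "v \<noteq> 0 \<Longrightarrow> v N = 0 \<Longrightarrow> v M = 0 \<Longrightarrow> tau v N = tau v M \<Longrightarrow> N = M"
proof (rule ccontr)
  assume v: "v \<noteq> 0" "tau v N = tau v M" "N \<noteq> M"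
  then obtain k where k: "v k \<noteq> 0" by (auto simp: fun_eq_iff zero_fun_def)
  have "tau v N (unit_vec N) k = tau v M (unit_vec N) k" using v by simp
  then show False using k v(3) by (simp add: tau_def unit_vec_def[of N])
qed

lemma countable_fl: "countable (UNIV :: fl set)" and infinite_fl: "infinite (UNIV :: fl set)"
  and countable_al: "countable (UNIV :: al set)" and infinite_al: "infinite (UNIV :: al set)"
proof -
  have f: "inj fl_fun" "range fl_fun \<subseteq> FL" by (auto simp: inj_def fl_fun_inject fl_fun)
  have a: "inj al_fun" "range al_fun \<subseteq> FL" by (auto simp: inj_def al_fun_inject al_fun_FL)
  show "countable (UNIV :: fl set)"
    by (rule countable_image_inj_on[OF countable_subset[OF f(2) countable_FL] f(1)])
  show "countable (UNIV :: al set)"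
    by (rule countable_image_inj_on[OF countable_subset[OF a(2) countable_FL] a(1)])
  have ne: "unit_vec 2 \<noteq> 0" by (simp add: unit_vec_def fun_eq_iff zero_fun_def)
  have z: "unit_vec 2 (N + 3) = 0" for N by (simp add: unit_vec_def)
  have inj: "inj (\<lambda>N. tau (unit_vec 2) (N + 3))"
    using tau_inj[OF ne z z] by (auto simp: inj_def)
  have AL: "tau (unit_vec 2) (N + 3) \<in> AL" for N
    using tau_unit_vec_FL[of 2 "N + 3"] by (simp add: AL_def) (simp add: tau_def unit_vec_def)
  have "inj (\<lambda>N. Abs_fl (tau (unit_vec 2) (N + 3)))"
    using inj AL AL_FL by (simp add: inj_def Abs_fl_inject)
  then show "infinite (UNIV :: fl set)" by (rule infinite_super[OF subset_UNIV range_inj_infinite])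
  have "inj (\<lambda>N. Abs_al (tau (unit_vec 2) (N + 3)))"
    using inj AL by (simp add: inj_def Abs_al_inject)
  then show "infinite (UNIV :: al set)" by (rule infinite_super[OF subset_UNIV range_inj_infinite])
qed

section \<open>The affine group does not have the ISR property\<close>

definition swap01 :: "nat \<Rightarrow> nat" where "swap01 i = (if i = 0 then 1 else if i = 1 then 0 else i)"

lemma swap01_0: "swap01 0 = 1" by (simp add: swap01_def)

text \<open>Conjugation by the transposition of 0 and 1, whose matrix is not in the affine group but
  normalizes it. On translations it exchanges the two copies of the module.\<close>

definition swap_rows :: "al \<Rightarrow> al" where "swap_rows h = Abs_al (cj swap01 (al_fun h))"

lemma swap01_involution: "fin_involution swap01"
  unfolding fin_involution_def by (auto simp: swap01_def intro!: exI[of _ 2])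

lemma al_fun_swap_rows: "al_fun (swap_rows h) = cj swap01 (al_fun h)"
proof -
  have "cj swap01 (al_fun h) \<in> AL"
    using cj_FL[OF al_fun_FL[of h] swap01_involution] al_fun[of h]
    by (auto simp: AL_def cj_def swap01_def)
  then show ?thesis by (simp add: swap_rows_def Abs_al_inverse)
qed

lemma swap_rows_add: "swap_rows (g + h) = swap_rows g + swap_rows h"
  by (simp add: al_fun_inject[symmetric] al_fun_swap_rows al_fun_simps(2) cj_comp[OF swap01_involution])

lemma swap_rows_swap_rows [simp]: "swap_rows (swap_rows h) = h"
  by (simp add: al_fun_inject[symmetric] al_fun_swap_rows cj_cj[OF swap01_involution])

lemma swap_rows_0 [simp]: "swap_rows 0 = 0"
  by (simp add: al_fun_inject[symmetric] al_fun_swap_rows al_fun_simps(1) cj_id[OF swap01_involution])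

lemma swap_rows_uminus: "swap_rows (- h) = - swap_rows h"
  using swap_rows_add[of "- h" h] by (simp add: eq_neg_iff_add_eq_0)

text \<open>The translations in the first two columns are the elements on which swapping the two rows
  commutes with all inner automorphisms.\<close>

definition swappable :: "al set" where
  "swappable = {h. \<forall>g. swap_rows (g + h - g) = g + swap_rows h - g}"

definition swap_sums :: "(al l2 \<Rightarrow> al l2) set" where
  "swap_sums = (\<lambda>h a. lam h a + lam (swap_rows h) a) ` swappable"

lemma swappable_conj: "h \<in> swappable \<Longrightarrow> g + h - g \<in> swappable"
proof -
  assume h: "h \<in> swappable"
  have "swap_rows (k + (g + h - g) - k) = k + swap_rows (g + h - g) - k" for k
  proof -
    have "k + (g + h - g) - k = (k + g) + h - (k + g)" by (simp add: diff_conv_add_uminus minus_add add.assoc del: add_uminus_conv_diff)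
    then have "swap_rows (k + (g + h - g) - k) = (k + g) + swap_rows h - (k + g)"
      using h by (simp add: swappable_def)
    also have "\<dots> = k + (g + swap_rows h - g) - k"
      by (simp add: diff_conv_add_uminus minus_add add.assoc del: add_uminus_conv_diff)
    finally show ?thesis using h by (simp add: swappable_def)
  qed
  then show ?thesis by (simp add: swappable_def)
qed

lemma swappable_uminus: "h \<in> swappable \<Longrightarrow> - h \<in> swappable"
proof -
  assume h: "h \<in> swappable"
  have "swap_rows (g + - h - g) = g + swap_rows (- h) - g" for g
  proof -
    have "g + - h - g = - (g + h - g)"
      by (simp add: diff_conv_add_uminus minus_add add.assoc del: add_uminus_conv_diff)
    then have "swap_rows (g + - h - g) = - (g + swap_rows h - g)"
      using h by (simp only: swap_rows_uminus) (simp add: swappable_def)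
    then show ?thesis
      by (simp add: swap_rows_uminus diff_conv_add_uminus minus_add add.assoc del: add_uminus_conv_diff)
  qed
  then show ?thesis by (simp add: swappable_def)
qed

text \<open>The witnesses are the transvections along \<open>unit_vec 2\<close> in columns 0 and 1,
  one from each copy of the module. Conjugation by \<open>g\<close> applies \<open>g\<close> to the
  vector and keeps the column, because rows 0 and 1 of \<open>g\<close> are trivial; so exchanging
  the columns commutes with it.\<close>

lemma swappable_not_fixed: "\<exists>h\<in>swappable. swap_rows h \<noteq> h"
proof -
  let ?v = "unit_vec 2"
  have AL: "tau ?v N \<in> AL" if "N < 2" for N
    using that tau_unit_vec_FL[of 2 N] by (simp add: AL_def) (auto simp: tau_def unit_vec_def)
  define h0 h1 where "h0 = Abs_al (tau ?v 0)" and "h1 = Abs_al (tau ?v 1)"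
  have f: "al_fun h0 = tau ?v 0" "al_fun h1 = tau ?v 1"
    using AL[of 0] AL[of 1] by (simp_all add: h0_def h1_def Abs_al_inverse)
  have sw: "swap_rows h0 = h1"
  proof -
    have "?v \<circ> swap01 = ?v"
      by (auto simp: unit_vec_def swap01_def fun_eq_iff)
    then show ?thesis
      by (simp add: al_fun_inject[symmetric] al_fun_swap_rows f cj_tau[OF swap01_involution] swap01_0)
  qed
  have conj: "al_fun (g + h - g) = tau (al_fun g ?v) N" if N: "N < 2" and h: "al_fun h = tau ?v N" for g h N
  proof
    fix x
    have N01: "N = 0 \<or> N = 1" using N by auto
    have low: "al_fun k y N = y N" for k y using al_fun[of k] N01 by (auto simp: AL_def)
    have "al_fun (g + h - g) x = al_fun g (tau ?v N (al_fun (- g) x))"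
      using al_fun_simps(2)[of "g + h" "- g"] al_fun_simps(2)[of g h] by (simp add: h)
    also have "\<dots> = al_fun g (al_fun (- g) x) + (if x N = 1 then al_fun g ?v else 0)"
      by (simp add: tau_alt low FL_linear[OF al_fun_FL] FL_zero[OF al_fun_FL] del: bit_not_zero_iff)
    finally show "al_fun (g + h - g) x = tau (al_fun g ?v) N x"
      by (simp add: al_fun_inv tau_alt)
  qed
  have "h0 \<in> swappable"
    unfolding swappable_def
  proof clarify
    fix g
    have "al_fun g ?v 0 = 0" "al_fun g ?v 1 = 0" using al_fun[of g] by (simp_all add: AL_def) (simp_all add: unit_vec_def)
    then have "al_fun g ?v \<circ> swap01 = al_fun g ?v"
      by (auto simp: swap01_def fun_eq_iff)
    then have "al_fun (swap_rows (g + h0 - g)) = al_fun (g + h1 - g)"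
      by (simp add: al_fun_swap_rows conj[OF _ f(1)] conj[OF _ f(2)] cj_tau[OF swap01_involution] swap01_0)
    then show "swap_rows (g + h0 - g) = g + swap_rows h0 - g" by (simp add: al_fun_inject sw)
  qed
  moreover have "h1 \<noteq> h0"
  proof
    assume "h1 = h0"
    then have "tau ?v 1 (unit_vec 0) 2 = tau ?v 0 (unit_vec 0) 2" using f by simp
    then show False by (simp add: tau_def unit_vec_def)
  qed
  ultimately show ?thesis using sw by metis
qed

lemma swap_sums_cbl: "swap_sums \<subseteq> Collect cbl"
  by (auto simp: swap_sums_def intro: cbl_plus)

lemma swap_sums_adjo: "T \<in> swap_sums \<Longrightarrow> adjo T \<in> swap_sums"
proof -
  assume "T \<in> swap_sums"
  then obtain h where h: "h \<in> swappable" "T = (\<lambda>a. lam h a + lam (swap_rows h) a)" by (auto simp: swap_sums_def)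
  have l: "cinner (lam k a) b = cinner a (lam (- k) b)" for k :: al and a b
    using adjo[OF cbl_lam] by (simp add: adjo_lam)
  have "(\<lambda>a. lam (- h) a + lam (swap_rows (- h)) a) = adjo T"
  proof (rule adjo_unique)
    show "cbl T" unfolding h(2) by (rule cbl_plus[OF cbl_lam cbl_lam])
    show "cinner (T a) b = cinner a (lam (- h) b + lam (swap_rows (- h)) b)" for a b
      unfolding h(2) cinner_simps l swap_rows_uminus ..
  qed
  then show ?thesis
    using imageI[OF swappable_uminus[OF h(1)], of "\<lambda>h a. lam h a + lam (swap_rows h) a"]
    unfolding swap_sums_def by (simp only:)
qed

lemma swap_sums_conj: "T \<in> swap_sums \<Longrightarrow> lam g \<circ> T \<circ> lam (- g) \<in> swap_sums"
proof -
  assume "T \<in> swap_sums"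
  then obtain h where h: "h \<in> swappable" "T = (\<lambda>a. lam h a + lam (swap_rows h) a)" by (auto simp: swap_sums_def)
  have "lam g \<circ> T \<circ> lam (- g) = (\<lambda>a. lam (g + h - g) a + lam (swap_rows (g + h - g)) a)"
    using h by (auto simp: fun_eq_iff cbl_add add_diff_eq swappable_def)
  then show ?thesis
    using imageI[OF swappable_conj[OF h(1), of g], of "\<lambda>h a. lam h a + lam (swap_rows h) a"]
    unfolding swap_sums_def by (simp only:)
qed

text \<open>Applied twice, it passes invariance from a set of generators to the double
  commutant.\<close>

lemma commut_conj:
  assumes M: "\<And>T. T \<in> M \<Longrightarrow> lam (- g) \<circ> T \<circ> lam g \<in> M" and T: "T \<in> commut M"
  shows "lam g \<circ> T \<circ> lam (- g) \<in> commut M"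
proof (rule commutI)
  show "cbl (lam g \<circ> T \<circ> lam (- g))" using T by (intro cbl_comp cbl_lam commut_cbl)
  fix S a assume S: "S \<in> M"
  have "T (lam (- g) (S a)) = lam (- g) (S (lam g (T (lam (- g) a))))"
    using commutD[OF T M[OF S], of "lam (- g) a"] by simp
  then have "lam g (T (lam (- g) (S a))) = lam g (lam (- g) (S (lam g (T (lam (- g) a)))))" by (rule arg_cong)
  then show "(lam g \<circ> T \<circ> lam (- g)) (S a) = S ((lam g \<circ> T \<circ> lam (- g)) a)" by simp
qed

lemma swap_sums_Lvn: "swap_sums \<subseteq> Lvn"
  unfolding swap_sums_def using vna_plus[OF vna_Lvn lam_Lvn lam_Lvn] by auto

lemma cbl_cut: "cbl (cut N)"
proof (rule cbl_intro[of _ 1])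
  show "norm (cut N a) \<le> 1 * norm a" for a :: "'a l2"
  proof -
    have "(\<Sum>\<^sub>\<infinity>x. (cmod (coord (cut N a) x))\<^sup>2) \<le> (\<Sum>\<^sub>\<infinity>x. (cmod (coord a x))\<^sup>2)"
      by (intro infsum_mono coord_summable) auto
    then show ?thesis by (simp add: norm_l2_eq)
  qed
qed (auto intro!: l2_eqI)

text \<open>Two operators exclude \<open>L(N)\<close>. The permutation operator of
  \<open>swap_rows\<close> commutes with \<open>swap_sums\<close>, so each \<open>n\<close> with
  \<open>lam n\<close> in the algebra is fixed by the exchange. The coordinate projection to
  \<open>N'\<close> commutes with translations by \<open>N'\<close>, so vectors
  \<open>x (bv 0)\<close> from the algebra vanish off \<open>N'\<close>. A sum over an exchanged
  pair of different elements contradicts this.\<close>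

theorem not_ISR_al:
  assumes "group_transport (e :: 'b \<Rightarrow> al) H" shows "\<not> ISR H"
proof
  assume ISR: "ISR H"
  interpret group_transport e H by fact
  let ?P = "bicommut swap_sums"
  have conj: "lam (- g) \<circ> T \<circ> lam g \<in> commut M" if "\<And>g T. T \<in> M \<Longrightarrow> lam (- g) \<circ> T \<circ> lam g \<in> M" "T \<in> commut M"
    for M T and g :: al
    using commut_conj[of M "- g" T] that(1)[of _ "- g"] that(2) by simp
  have "lam g \<circ> T \<circ> lam (- g) \<in> ?P" if "T \<in> ?P" for g T
  proof -
    have 1: "lam (- g) \<circ> T \<circ> lam g \<in> swap_sums" if "T \<in> swap_sums" for g T
      using swap_sums_conj[OF that, of "- g"] by simp
    have 2: "lam (- g) \<circ> T \<circ> lam g \<in> commut swap_sums" if "T \<in> commut swap_sums" for g T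
      using conj[OF 1 that] .
    show ?thesis using conj[OF 2 that, of "- g"] by simp
  qed
  then have "invariant_subalgebra H (opn ` ?P)"
    using invariant_subalgebra_opn[OF commut_subset] vna_bicommut[OF swap_sums_cbl swap_sums_adjo]
      vna_bicommut_subset[OF vna_Lvn swap_sums_Lvn] by blast
  then obtain N where N: "N \<lhd> H" "opn ` ?P = vn_of_subgroup H N" using ISR by (auto simp: ISR_def)
  have sub: "subgroup N H" using N(1) by (rule normal_imp_subgroup)
  have "opn ` ?P = opn ` bicommut (lam ` e ` N)"
    unfolding N(2) using subgroup.m_inv_closed[OF sub] by (rule vn_of_subgroup_opn)
  then have P: "?P = bicommut (lam ` e ` N)" using opn_inj by blast
  define N' where "N' = e ` N"
  have N': "0 \<in> N'" "\<And>x y. x \<in> N' \<Longrightarrow> y \<in> N' \<Longrightarrow> x + y \<in> N'" "\<And>x. x \<in> N' \<Longrightarrow> - x \<in> N'"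
    using subgroup.one_closed[OF sub] subgroup.m_closed[OF sub] subgroup.m_inv_closed[OF sub]
    by (auto simp: N'_def e_one[symmetric] e_mult[symmetric] e_inv[symmetric])
  have b: "bij swap_rows" by (rule o_bij[of swap_rows]) (auto simp: fun_eq_iff)
  have \<kappa>: "pm swap_rows \<in> commut swap_sums"
  proof (rule commutI)
    show "cbl (pm swap_rows)" by (rule cbl_pm[OF b])
    have "pm swap_rows (lam h a) = lam (swap_rows h) (pm swap_rows a)" for h a
      by (rule l2_eqI) (simp add: coord_pm[OF b] swap_rows_add swap_rows_uminus)
    then show "pm swap_rows (S a) = S (pm swap_rows a)" if "S \<in> swap_sums" for S a
      using that by (auto simp: swap_sums_def cbl_add[OF cbl_pm[OF b]] add.commute)
  qed
  have "lam ` e ` N \<subseteq> ?P" unfolding P by (rule subset_bicommut) auto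
  then have "lam n \<in> ?P" if "n \<in> N'" for n using that by (auto simp: N'_def)
  then have "lam n (pm swap_rows (bv 0)) = pm swap_rows (lam n (bv 0))" if "n \<in> N'" for n
    using commutD[OF _ \<kappa>] that by blast
  moreover have "pm swap_rows (bv h) = bv (swap_rows h)" for h
    using pm_bv[OF b, of "swap_rows h"] by simp
  ultimately have "bv n = bv (swap_rows n)" if "n \<in> N'" for n using that by simp
  then have fixed: "swap_rows n = n" if "n \<in> N'" for n
    using that coord_bv[of n n] coord_bv[of "swap_rows n" n] by (metis zero_neq_one)
  obtain h where h: "h \<in> swappable" "swap_rows h \<noteq> h" using swappable_not_fixed by blast
  then have hN: "h \<notin> N'" using fixed by blast
  let ?S = "\<lambda>a. lam h a + lam (swap_rows h) a"
  have "?S \<in> ?P" using h subset_bicommut[OF swap_sums_cbl] by (auto simp: swap_sums_def)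
  moreover have "cut N' \<in> commut (lam ` e ` N)"
  proof (rule commutI)
    show "cbl (cut N')" by (rule cbl_cut)
    have "cut N' (lam n a) = lam n (cut N' a)" if n: "n \<in> N'" for n a
    proof (rule l2_eqI)
      fix x
      have "n + (- n + x) = x" by (simp add: add.assoc[symmetric])
      then have "- n + x \<in> N' \<longleftrightarrow> x \<in> N'" using N'(2)[OF n, of "- n + x"] N'(2)[OF N'(3)[OF n], of x] by auto
      then show "coord (cut N' (lam n a)) x = coord (lam n (cut N' a)) x" by simp
    qed
    then show "cut N' (S a) = S (cut N' a)" if "S \<in> lam ` e ` N" for S a
      using that by (auto simp: N'_def)
  qed
  ultimately have "?S (cut N' (bv 0)) = cut N' (?S (bv 0))"
    unfolding P using commutD[of ?S "commut (lam ` e ` N)" "cut N'" "bv 0"] by simp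
  moreover have "cut N' (bv 0) = bv 0" using N'(1) by (auto intro!: l2_eqI simp: coord_bv)
  ultimately have "coord (bv h + bv (swap_rows h)) h = coord (cut N' (bv h + bv (swap_rows h))) h" by simp
  then show False using h(2) hN by (simp add: coord_bv)
qed

section \<open>The finitary linear group has the ISR property\<close>

lemma coord_const_on_infinite:
  assumes f: "inj (f :: nat \<Rightarrow> 'a)" and c: "\<And>n. coord x (f n) = c" shows "c = 0"
proof (rule ccontr)
  assume "c \<noteq> 0"
  then have pos: "(cmod c)\<^sup>2 > 0" by simp
  obtain k :: nat where k: "(norm x)\<^sup>2 / (cmod c)\<^sup>2 < real k" using reals_Archimedean2 by blast
  have "real k * (cmod c)\<^sup>2 = (\<Sum>y\<in>f ` {..<k}. (cmod (coord x y))\<^sup>2)"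
    using f by (subst sum.reindex) (auto simp: c intro: inj_on_subset)
  also have "\<dots> \<le> (norm x)\<^sup>2" by (rule sum_coord_le_norm) simp
  finally show False using k pos by (simp add: field_simps)
qed

section \<open>Elementary transvections and their conjugates\<close>

definition tv :: "vec \<Rightarrow> nat \<Rightarrow> fl" where "tv v N = Abs_fl (tau v N)"

lemma fl_fun_tv: "bounded_supp v \<Longrightarrow> v N = 0 \<Longrightarrow> fl_fun (tv v N) = tau v N"
  by (simp add: tv_def Abs_fl_inverse tau_FL)

lemma fl_eqI: "(\<And>x. fl_fun g x = fl_fun h x) \<Longrightarrow> g = h"
  by (simp add: fl_fun_inject[symmetric] fun_eq_iff)

lemma fl_fun_add: "fl_fun (g + h) x = fl_fun g (fl_fun h x)"
  by (simp add: fl_fun_simps)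

lemma tv_self [simp]: "bounded_supp v \<Longrightarrow> v N = 0 \<Longrightarrow> tv v N + tv v N = 0"
  by (rule fl_eqI) (simp add: fl_fun_add fl_fun_tv fl_fun_simps(1))

lemma tv_uminus: "bounded_supp v \<Longrightarrow> v N = 0 \<Longrightarrow> - tv v N = tv v N"
  using tv_self[of v N] by (simp add: eq_neg_iff_add_eq_0 minus_equation_iff neg_eq_iff_add_eq_0)

lemma tv_eq_0: "bounded_supp v \<Longrightarrow> v N = 0 \<Longrightarrow> tv v N = 0 \<Longrightarrow> v = 0"
proof -
  assume v: "bounded_supp v" "v N = 0" "tv v N = 0"
  then have "tau v N (unit_vec N) = unit_vec N" using fl_fun_tv[of v N] fl_fun_simps(1) by simp
  then have "unit_vec N k + v k = unit_vec N k" for k by (metis tau_def mult_1 unit_vec_def)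
  then show "v = 0" by (simp add: fun_eq_iff zero_fun_def)
qed

lemma tv_plus: "bounded_supp v \<Longrightarrow> v N = 0 \<Longrightarrow> bounded_supp w \<Longrightarrow> w N = 0 \<Longrightarrow> tv v N + tv w N = tv (v + w) N"
  by (rule fl_eqI) (simp add: fl_fun_add fl_fun_tv bounded_supp_add plus_fun_def[of v] tau_def algebra_simps
      bounded_supp_add[unfolded plus_fun_def])

text \<open>\<open>tv w k\<close> sends \<open>unit_vec k\<close> to \<open>unit_vec k + w\<close>,
  and since \<open>w N = 0\<close> it leaves the coordinate functional at \<open>N\<close>
  alone.\<close>

lemma tv_conj:
  assumes "k \<noteq> N" "bounded_supp w" "w N = 0" "w k = 0"
  shows "tv w k + tv (unit_vec k) N - tv w k = tv (unit_vec k + w) N"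
proof -
  have b: "bounded_supp (unit_vec k + w)" by (rule bounded_supp_add[OF bounded_supp_unit_vec assms(2)])
  have b': "(unit_vec k + w) N = 0" using assms by (simp add: plus_fun_def unit_vec_def)
  have u: "unit_vec k N = 0" using assms(1) by (simp add: unit_vec_def)
  have "fl_fun (tv w k + tv (unit_vec k) N + tv w k) x = fl_fun (tv (unit_vec k + w) N) x" for x
  proof
    fix i
    have "tau w k (tau (unit_vec k) N (tau w k x)) i = tau (unit_vec k + w) N x i"
      using assms by (cases "x k"; cases "x N"; cases "w i"; cases "x i") (auto simp: tau_def plus_fun_def unit_vec_def)
    then show "fl_fun (tv w k + tv (unit_vec k) N + tv w k) x i = fl_fun (tv (unit_vec k + w) N) x i"
      using assms b b' u by (simp add: fl_fun_add fl_fun_tv)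
  qed
  then have "tv w k + tv (unit_vec k) N + tv w k = tv (unit_vec k + w) N" by (rule fl_eqI)
  then show ?thesis using tv_uminus[OF assms(2,4)] by (simp only: diff_conv_add_uminus)
qed

text \<open>Here the conjugating element changes the functional and not the vector: coordinate
  \<open>N\<close> becomes the sum of coordinates \<open>N\<close> and \<open>M\<close>. This is how
  a normal subgroup reaches another column.\<close>

lemma tv_conj_column:
  assumes "k \<noteq> N" "k \<noteq> M" "M \<noteq> N"
  shows "tv (unit_vec N) M + tv (unit_vec k) N - tv (unit_vec N) M = tv (unit_vec k) N + tv (unit_vec k) M"
proof -
  have z: "unit_vec N M = 0" "unit_vec k N = 0" "unit_vec k M = 0" using assms by (auto simp: unit_vec_def)
  have "fl_fun (tv (unit_vec N) M + tv (unit_vec k) N + tv (unit_vec N) M) x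
      = fl_fun (tv (unit_vec k) N + tv (unit_vec k) M) x" for x
  proof
    fix i
    have "tau (unit_vec N) M (tau (unit_vec k) N (tau (unit_vec N) M x)) i = tau (unit_vec k) N (tau (unit_vec k) M x) i"
      using assms by (cases "x M"; cases "x N"; cases "x i") (auto simp: tau_def unit_vec_def)
    then show "fl_fun (tv (unit_vec N) M + tv (unit_vec k) N + tv (unit_vec N) M) x i
      = fl_fun (tv (unit_vec k) N + tv (unit_vec k) M) x i"
      using z by (simp add: fl_fun_add fl_fun_tv)
  qed
  then have "tv (unit_vec N) M + tv (unit_vec k) N + tv (unit_vec N) M = tv (unit_vec k) N + tv (unit_vec k) M"
    by (rule fl_eqI)
  then show ?thesis using tv_uminus[OF bounded_supp_unit_vec z(1)] by (simp only: diff_conv_add_uminus)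
qed

lemma tv_as_conj:
  assumes v: "bounded_supp v" "v N = 0" "v k \<noteq> 0"
  shows "\<exists>g. tv v N = g + tv (unit_vec k) N - g"
proof -
  define w where "w = unit_vec k + v"
  have kN: "k \<noteq> N" using v by auto
  have w: "bounded_supp w" unfolding w_def by (rule bounded_supp_add[OF bounded_supp_unit_vec v(1)])
  have w': "w N = 0" "w k = 0" using v kN by (simp_all add: w_def plus_fun_def unit_vec_def)
  have "unit_vec k + w = v" by (simp add: w_def add.assoc[symmetric])
  then show ?thesis using tv_conj[OF kN w w'] by metis
qed

lemma normal_closure_transvection:
  fixes N :: "fl set"
  assumes N: "0 \<in> N" "\<And>x y. x \<in> N \<Longrightarrow> y \<in> N \<Longrightarrow> x + y \<in> N" "\<And>x. x \<in> N \<Longrightarrow> - x \<in> N" "\<And>g x. x \<in> N \<Longrightarrow> g + x - g \<in> N"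
    and t: "tv (unit_vec i) j \<in> N" "i \<noteq> j"
  shows "g \<in> N"
proof -
  have col: "tv v c \<in> N" if t: "tv (unit_vec k) c \<in> N" "k \<noteq> c" and v: "bounded_supp v" "v c = 0" for k c v
  proof -
    have kc: "bounded_supp (unit_vec k)" "unit_vec k c = 0" using t(2) by (simp_all add: unit_vec_bounded_zero)
    have 1: "tv w c \<in> N" if w: "bounded_supp w" "w c = 0" "w k \<noteq> 0" for w
      using tv_as_conj[OF w] N(4)[OF t(1)] by metis
    show ?thesis
    proof (cases "v k = 0")
      case True
      \<comment> \<open>If \<open>v k\<close> vanishes, \<open>v\<close> is the sum of
        \<open>v + unit_vec k\<close> and \<open>unit_vec k\<close>, which both have a nonzero entry
        at \<open>k\<close>.\<close>
      have "tv (v + unit_vec k) c \<in> N"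
        using 1[of "v + unit_vec k"] v kc True by (simp add: bounded_supp_add) (simp add: plus_fun_def unit_vec_def)
      then have "tv (v + unit_vec k) c + tv (unit_vec k) c \<in> N" using t(1) N(2) by blast
      moreover have "tv v c + tv (unit_vec k) c = tv (v + unit_vec k) c" using tv_plus v kc by blast
      then have "tv (v + unit_vec k) c + tv (unit_vec k) c = tv v c + (tv (unit_vec k) c + tv (unit_vec k) c)"
        by (metis add.assoc)
      then have "tv (v + unit_vec k) c + tv (unit_vec k) c = tv v c" using tv_self[OF kc] by simp
      ultimately show ?thesis by simp
    next
      case False
      then show ?thesis using 1 v by blast
    qed
  qed
  have all: "tv v c \<in> N" if v: "bounded_supp v" "v c = 0" for v c
  proof (cases "c = j")
    case True
    then show ?thesis using col[OF t] v by simp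
  next
    case False
    obtain k where k: "k \<noteq> j" "k \<noteq> c" using ex_new_if_finite[of "{j, c}"] by auto
    have kj: "tv (unit_vec k) j \<in> N" using col[OF t] k unit_vec_bounded_zero by blast
    then have "tv (unit_vec k) j + tv (unit_vec k) c \<in> N"
      using tv_conj_column[OF k False] N(4)[OF kj, of "tv (unit_vec j) c"] by simp
    then have "- tv (unit_vec k) j + (tv (unit_vec k) j + tv (unit_vec k) c) \<in> N"
      using N(2) N(3)[OF kj] by blast
    then have "tv (unit_vec k) c \<in> N" by (simp add: add.assoc[symmetric])
    then show ?thesis using col k(2) v by blast
  qed
  have "Abs_fl h \<in> N" if "h \<in> FL" for h
    using that
  proof (induction rule: FL.induct)
    case FL_id
    show ?case using N(1) by (simp only: zero_fl_def)
  next
    case (FL_tau h v c)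
    have "Abs_fl (tau v c \<circ> h) = tv v c + Abs_fl h"
      using FL_tau by (simp add: plus_fl_def fl_fun_tv Abs_fl_inverse)
    then show ?case using N(2)[OF all[of v c] FL_tau.IH] FL_tau.hyps by (simp only:)
  qed
  from this[OF fl_fun] show ?thesis by (simp add: fl_fun_inverse)
qed

text \<open>A sequence splits into a finitely supported part vanishing at \<open>N\<close>, a tail
  out of reach of \<open>h\<close>, and a multiple of \<open>unit_vec N\<close>; only the last can
  be moved.\<close>

lemma supp_ge:
  assumes "supp d h" "\<And>w. bounded_supp w \<Longrightarrow> w N = 0 \<Longrightarrow> h w = w" "h \<in> FL"
  shows "h x = x + (if x N = 1 then h (unit_vec N) + unit_vec N else 0)"
proof -
  define y where "y = (\<lambda>k. if k = N \<or> k \<ge> max d (Suc N) then 0 else x k)"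
  define z where "z = (\<lambda>k. if k \<ge> max d (Suc N) then x k else 0)"
  have x: "x = y + z + (if x N = 1 then unit_vec N else 0)"
  proof
    fix k show "x k = (y + z + (if x N = 1 then unit_vec N else 0)) k"
      by (cases "x N") (auto simp: y_def z_def unit_vec_def plus_fun_def)
  qed
  have "bounded_supp y" unfolding bounded_supp_def by (rule exI[of _ "max d (Suc N)"]) (simp add: y_def)
  then have y: "h y = y" using assms(2)[of y] by (simp add: y_def)
  have z: "h z = z" using assms(1) by (simp add: supp_def z_def)
  have "h x = h y + h z + h (if x N = 1 then unit_vec N else 0)"
    by (subst x) (simp only: FL_linear[OF assms(3)])
  also have "\<dots> = y + z + (if x N = 1 then h (unit_vec N) else 0)"
    by (simp add: y z FL_zero[OF assms(3)])
  also have "\<dots> = x + (if x N = 1 then h (unit_vec N) + unit_vec N else 0)"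
  proof -
    have "y + z = x + (if x N = 1 then unit_vec N else 0)"
    proof
      fix k show "(y + z) k = (x + (if x N = 1 then unit_vec N else 0)) k"
        by (cases "x N") (auto simp: y_def z_def unit_vec_def plus_fun_def)
    qed
    then show ?thesis by (cases "x N = 1") (simp_all add: add.assoc add.commute)
  qed
  finally show ?thesis .
qed

text \<open>The centralizer of the transvection conjugates every other nontrivial element to infinitely
  many different ones; this replaces an estimate of conditional expectations by a count.\<close>

lemma transvection_centralizer_orbit:
  assumes ij: "i \<noteq> j" and h: "h \<noteq> 0" "h \<noteq> tv (unit_vec i) j"
  shows "\<exists>f. (\<forall>M::nat. f M + tv (unit_vec i) j = tv (unit_vec i) j + f M) \<and> inj (\<lambda>M. f M + h - f M)"
proof -
  obtain d where d: "supp d (fl_fun h)" using FL_supp fl_fun by blast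
  have ui: "bounded_supp (unit_vec i)" "unit_vec i j = 0" using ij by (simp_all add: unit_vec_bounded_zero)
  define s where "s = tv (unit_vec i) j"
  have s: "fl_fun s = tau (unit_vec i) j" unfolding s_def by (rule fl_fun_tv[OF ui])
  show ?thesis
  proof (cases "\<exists>w. bounded_supp w \<and> w j = 0 \<and> fl_fun h w \<noteq> w")
    \<comment> \<open>Transvections along \<open>w\<close> in far columns commute with
      \<open>s\<close>, and conjugating \<open>h\<close> by one of them puts the nonzero vector
      \<open>h w + w\<close> into that column.\<close>
    case True
    then obtain w where w: "bounded_supp w" "w j = 0" "fl_fun h w \<noteq> w" by blast
    then obtain b where b: "\<forall>k\<ge>b. w k = 0" by (auto simp: bounded_supp_def)
    define m where "m = Suc (d + b + i + j)"
    define f where "f M = tv w (m + M)" for M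
    have wz: "w (m + M) = 0" for M using b by (simp add: m_def)
    have f: "fl_fun (f M) = tau w (m + M)" for M unfolding f_def by (rule fl_fun_tv[OF w(1) wz])
    have "f M + s = s + f M" for M
    proof (rule fl_eqI, rule ext)
      fix x k
      have "m + M \<noteq> i" by (simp add: m_def)
      then show "fl_fun (f M + s) x k = fl_fun (s + f M) x k"
        using w(2) by (simp add: fl_fun_add f s tau_def unit_vec_def algebra_simps)
    qed
    moreover have conj: "fl_fun (f M + h - f M) x = fl_fun h x + (if x (m + M) = 1 then fl_fun h w + w else 0)" for M x
    proof -
      have hk: "fl_fun h y (m + M) = y (m + M)" for y using d by (simp add: supp_def m_def)
      have "fl_fun (f M + h + f M) x = tau w (m + M) (fl_fun h (tau w (m + M) x))"
        by (simp add: fl_fun_add f)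
      also have "\<dots> = fl_fun h x + (if x (m + M) = 1 then fl_fun h w + w else 0)"
      proof -
        have "fl_fun h (tau w (m + M) x) (m + M) = x (m + M)" using wz[of M] by (simp add: hk tau_def)
        then have 1: "tau w (m + M) (fl_fun h (tau w (m + M) x))
            = fl_fun h (tau w (m + M) x) + (if x (m + M) = 1 then w else 0)" by (simp add: tau_alt)
        have 2: "fl_fun h (tau w (m + M) x) = fl_fun h x + (if x (m + M) = 1 then fl_fun h w else 0)"
          by (simp add: tau_alt FL_linear[OF fl_fun] FL_zero[OF fl_fun])
        show ?thesis by (subst 1, subst 2) (simp add: add.assoc)
      qed
      finally show ?thesis using tv_uminus[OF w(1) wz, of M] by (simp add: f_def diff_conv_add_uminus del: add_uminus_conv_diff)
    qed
    have "inj (\<lambda>M. f M + h - f M)"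
    proof (rule injI, rule ccontr)
      fix M M' assume eq: "f M + h - f M = f M' + h - f M'" and ne: "M \<noteq> M'"
      have "fl_fun (f M + h - f M) (unit_vec (m + M)) = fl_fun (f M' + h - f M') (unit_vec (m + M))" by (simp only: eq)
      then have "fl_fun h (unit_vec (m + M)) + (fl_fun h w + w) = fl_fun h (unit_vec (m + M)) + 0"
        using ne by (simp only: conj) (simp add: unit_vec_def)
      then have "fl_fun h w + w = 0" by (rule add_left_imp_eq)
      then have "fl_fun h w + w + w = w" by simp
      then show False using w(3) by (simp add: add.assoc)
    qed
    ultimately show ?thesis unfolding s_def by blast
  next
    \<comment> \<open>Now \<open>h\<close> is a transvection along some \<open>a\<close> in column
      \<open>j\<close>. Being neither 0 nor \<open>s\<close>, it has an entry at some
      \<open>k\<close> other than \<open>i\<close>; transvections adding coordinate \<open>k\<close>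
      to far coordinates commute with \<open>s\<close> and change \<open>a\<close>.\<close>
    case False
    then have fixw: "fl_fun h w = w" if "bounded_supp w" "w j = 0" for w using that by blast
    define a where "a = fl_fun h (unit_vec j) + unit_vec j"
    have hx: "fl_fun h x = x + (if x j = 1 then a else 0)" for x
      unfolding a_def by (rule supp_ge[OF d fixw fl_fun])
    have "fl_fun h (unit_vec j) k = 0" if "k \<ge> max d (Suc j)" for k
      using d that by (simp add: supp_def unit_vec_def)
    then have hb: "bounded_supp (fl_fun h (unit_vec j))" unfolding bounded_supp_def by blast
    \<comment> \<open>Otherwise \<open>h\<close> maps \<open>unit_vec j\<close> into the hyperplane
      that it fixes, and injectivity makes \<open>unit_vec j\<close> itself fixed, although its
      image has coordinate 0 at \<open>j\<close>.\<close>
    have aj: "a j = 0"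
    proof (rule ccontr)
      assume "a j \<noteq> 0"
      then have "fl_fun h (unit_vec j) j = 0"
        by (simp add: a_def plus_fun_def unit_vec_def)
      then have "fl_fun h (fl_fun h (unit_vec j)) = fl_fun h (unit_vec j)" using fixw[OF hb] by simp
      then have "fl_fun (- h) (fl_fun h (fl_fun h (unit_vec j))) = fl_fun (- h) (fl_fun h (unit_vec j))" by simp
      then have "fl_fun h (unit_vec j) = unit_vec j" by (simp add: fl_fun_inv)
      then show False using \<open>fl_fun h (unit_vec j) j = 0\<close> by (simp add: unit_vec_def)
    qed
    have ab: "bounded_supp a" unfolding a_def by (intro bounded_supp_add hb bounded_supp_unit_vec)
    have h_tv: "h = tv a j"
      by (rule fl_eqI) (simp only: hx fl_fun_tv[OF ab aj] tau_alt)
    have "\<exists>k. k \<noteq> i \<and> a k \<noteq> 0"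
    proof (rule ccontr)
      assume "\<not> ?thesis"
      then have "a = unit_vec i \<or> a = 0"
        by (cases "a i") (auto simp: unit_vec_def fun_eq_iff zero_fun_def)
      moreover have "tv 0 j = 0" by (rule fl_eqI) (simp add: fl_fun_tv bounded_supp_def zero_fun_def tau_def fl_fun_simps(1))
      ultimately show False using h h_tv by auto
    qed
    then obtain k where k: "k \<noteq> i" "a k = 1" by auto
    have kj: "k \<noteq> j" using aj k by auto
    obtain b where b: "\<forall>n\<ge>b. a n = 0" using ab by (auto simp: bounded_supp_def)
    define m where "m = Suc (i + j + k + b)"
    define f where "f M = tv (unit_vec (m + M)) k" for M
    have mz: "bounded_supp (unit_vec (m + M))" "unit_vec (m + M) k = 0" for M
      by (rule bounded_supp_unit_vec) (simp add: unit_vec_def m_def)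
    have f: "fl_fun (f M) = tau (unit_vec (m + M)) k" for M
      unfolding f_def by (rule fl_fun_tv[OF mz])
    have "f M + s = s + f M" for M
    proof (rule fl_eqI, rule ext)
      fix x n
      have "m + M \<noteq> j" "k \<noteq> i" using k by (simp_all add: m_def)
      then show "fl_fun (f M + s) x n = fl_fun (s + f M) x n"
        by (simp add: fl_fun_add f s tau_def unit_vec_def algebra_simps)
    qed
    moreover have conj: "fl_fun (f M + h - f M) (unit_vec j) = unit_vec j + a + unit_vec (m + M)" for M
    proof -
      have "fl_fun (f M + h + f M) (unit_vec j) = tau (unit_vec (m + M)) k (fl_fun h (tau (unit_vec (m + M)) k (unit_vec j)))"
        by (simp add: fl_fun_add f)
      also have "tau (unit_vec (m + M)) k (unit_vec j) = unit_vec j" using kj by (simp add: tau_def unit_vec_def)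
      also have "fl_fun h (unit_vec j) = unit_vec j + a" by (simp add: hx unit_vec_def)
      also have "tau (unit_vec (m + M)) k (unit_vec j + a) = unit_vec j + a + unit_vec (m + M)"
        using k kj by (simp add: tau_alt plus_fun_def[of "unit_vec j" a]) (simp add: unit_vec_def plus_fun_def)
      finally show ?thesis using tv_uminus[OF mz, of M] by (simp add: f_def diff_conv_add_uminus del: add_uminus_conv_diff)
    qed
    have "inj (\<lambda>M. f M + h - f M)"
    proof (rule injI)
      fix M M' assume eq: "f M + h - f M = f M' + h - f M'"
      have "unit_vec j + a + unit_vec (m + M) = unit_vec j + a + unit_vec (m + M')"
        using conj[of M] conj[of M'] by (simp only: eq)
      then have "unit_vec (m + M) = unit_vec (m + M')" by (rule add_left_imp_eq)
      then have "unit_vec (m + M) (m + M) = unit_vec (m + M') (m + M)" by simp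
      then show "M = M'" by (simp add: unit_vec_def split: if_splits)
    qed
    ultimately show ?thesis unfolding s_def by blast
  qed
qed

section \<open>Conjugation on vectors and the dichotomy for one group element\<close>

lemma coord_conj:
  assumes "x \<in> Lvn" shows "coord ((lam g \<circ> x \<circ> lam (- g)) (bv 0)) y = coord (x (bv 0)) (- g + y + g)"
proof -
  have "x (lam (- g) (bv 0)) = rho g (x (bv 0))" using Lvn_bv[OF assms, of "- g"] by simp
  then show ?thesis by (simp add: add.assoc)
qed

text \<open>On \<open>x (bv 0)\<close> with \<open>x\<close> in \<open>Lvn\<close> this gives the
  vector of the conjugated operator, because \<open>lam (- g)\<close> and \<open>rho g\<close> agree
  on \<open>bv 0\<close>.\<close>

definition cjop :: "'a::group_add \<Rightarrow> 'a l2 \<Rightarrow> 'a l2" where "cjop g a = lam g (rho g a)"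

lemma cbl_cjop: "cbl (cjop g)"
  unfolding cjop_def[abs_def] using cbl_comp[OF cbl_lam cbl_rho] by (simp add: o_def)

lemma coord_cjop: "coord (cjop g a) y = coord a (- g + y + g)"
  by (simp add: cjop_def add.assoc)

lemma cinner_cjop: "cinner (cjop g a) b = cinner a (cjop (- g) b)"
proof -
  have "cinner (lam g c) b = cinner c (lam (- g) b)" "cinner (rho g a) c = cinner a (rho (- g) c)" for c
    using adjo[OF cbl_lam, of g] adjo[OF cbl_rho, of g] by (simp_all add: adjo_lam adjo_rho)
  then show ?thesis by (simp only: cjop_def lam_rho[of "- g"])
qed

text \<open>The projection of the basis vector of \<open>s\<close> to the closure of \<open>P\<close> is fixed by conjugation with
  the centralizer of \<open>s\<close>; being square summable it vanishes on infinite orbits.\<close>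

lemma invariant_dichotomy:
  fixes s :: "'a::group_add"
  assumes P: "vna P" "P \<subseteq> Lvn" "\<And>g T. T \<in> P \<Longrightarrow> lam g \<circ> T \<circ> lam (- g) \<in> P"
    and s: "s \<noteq> 0" "\<And>h. h \<noteq> 0 \<Longrightarrow> h \<noteq> s \<Longrightarrow>
      \<exists>f. (\<forall>M::nat. f M + s = s + f M) \<and> inj (\<lambda>M. f M + h - f M)"
  shows "lam s \<in> P \<or> (\<forall>x\<in>P. coord (x (bv 0)) s = 0)"
proof -
  let ?X = "(\<lambda>q. q (bv 0)) ` P"
  define S where "S = ccl ?X"
  have S: "csubspace S" "closed S" "?X \<subseteq> S" unfolding S_def by (rule csubspace_ccl closed_ccl subset_ccl)+
  have inv: "cjop g a \<in> S" if "a \<in> S" for g a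
  proof -
    have "a \<in> {a. cjop g a \<in> S}"
    proof (rule cclD[OF that[unfolded S_def]])
      show "csubspace {a. cjop g a \<in> S}"
        using S(1) by (auto simp: csubspace_def cbl_add[OF cbl_cjop] cbl_zero[OF cbl_cjop] cbl_scaleC[OF cbl_cjop])
      show "closed {a. cjop g a \<in> S}"
        using closed_vimage[OF S(2) linear_continuous_on[OF cbl_bounded_linear[OF cbl_cjop[of g]]]]
        by (simp only: vimage_def)
      show "?X \<subseteq> {a. cjop g a \<in> S}"
      proof clarify
        fix x assume x: "x \<in> P"
        then have xL: "x \<in> Lvn" using P(2) by blast
        have "cjop g (x (bv 0)) = (lam g \<circ> x \<circ> lam (- g)) (bv 0)"
          by (rule l2_eqI) (simp only: coord_conj[OF xL] coord_cjop)
        moreover have "(lam g \<circ> x \<circ> lam (- g)) (bv 0) \<in> S" using P(3)[OF x] S(3) by blast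
        ultimately show "cjop g (x (bv 0)) \<in> S" by simp
      qed
    qed
    then show ?thesis by simp
  qed
  obtain b where b: "b \<in> S" "\<And>c. c \<in> S \<Longrightarrow> cinner (bv s - b) c = 0"
    using Hilbert_projection[OF S(1,2), of "bv s"] by blast
  have fixed: "cjop g b = b" if g: "g + s = s + g" for g
  proof -
    have "- g + y + g = s \<longleftrightarrow> y = s" for y
    proof
      assume "- g + y + g = s"
      then have "g + (- g + y + g) = g + s" by simp
      then have "y + g = s + g" using g by (simp add: add.assoc[symmetric])
      then show "y = s" by simp
    next
      assume "y = s"
      then have "- g + y + g = - g + (g + s)" using g by (simp add: add.assoc)
      then show "- g + y + g = s" by (simp add: add.assoc[symmetric])
    qed
    then have bs: "cjop g (bv s) = bv s" by (intro l2_eqI) (simp add: coord_cjop coord_bv)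
    have "cinner (bv s - cjop g b) c = 0" if "c \<in> S" for c
    proof -
      have "bv s - cjop g b = cjop g (bv s - b)" by (simp add: cbl_diff[OF cbl_cjop] bs)
      then show ?thesis using b(2)[OF inv[OF that]] by (simp add: cinner_cjop)
    qed
    then have "cinner (b - cjop g b) c = 0" if "c \<in> S" for c
      using b(2)[OF that] that by (simp add: cinner_simps)
    moreover have "b - cjop g b \<in> S" using csubspace_diff[OF S(1)] b(1) inv by blast
    ultimately have "cinner (b - cjop g b) (b - cjop g b) = 0" by blast
    then show ?thesis by (simp add: cinner_norm)
  qed
  have off: "coord b h = 0" if h: "h \<noteq> 0" "h \<noteq> s" for h
  proof -
    obtain f where f: "\<And>M::nat. f M + s = s + f M" "inj (\<lambda>M. f M + h - f M)" using s(2)[OF h] by blast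
    have "coord b (f M + h - f M) = coord b h" for M
    proof -
      have "coord (cjop (f M) b) (f M + h - f M) = coord b (- f M + (f M + h - f M) + f M)" by (rule coord_cjop)
      also have "- f M + (f M + h - f M) + f M = h" by (simp add: add.assoc diff_conv_add_uminus del: add_uminus_conv_diff)
      finally show ?thesis by (simp add: fixed[OF f(1)])
    qed
    then show ?thesis using coord_const_on_infinite[OF f(2)] by blast
  qed
  \<comment> \<open>The orbit argument says nothing about the coordinate at 0. There the scalars in
    \<open>P\<close> help: \<open>bv 0\<close> lies in \<open>S\<close> and is orthogonal to
    \<open>bv s\<close>.\<close>
  have "(\<lambda>q. q (bv 0)) (\<lambda>a. a) \<in> ?X" using vna_id[OF P(1)] by (rule imageI)
  then have "bv 0 \<in> S" using S(3) by blast
  then have "cinner (bv s - b) (bv 0) = 0" by (rule b(2))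
  then have b0: "coord b 0 = 0" using s(1) by (simp add: cinner_bv coord_bv)
  define c where "c = coord b s"
  have bc: "b = c *\<^sub>C bv s"
  proof (rule l2_eqI)
    show "coord b x = coord (c *\<^sub>C bv s) x" for x
      using off[of x] b0 s(1) by (cases "x = 0"; cases "x = s") (auto simp: coord_bv c_def)
  qed
  have sb: "cinner (bv s) b = cnj c" using cinner_commute[of "bv s" b] by (simp add: cinner_bv c_def)
  have "cinner b b = c * cinner (bv s) b" using cinner_simps(5)[of c "bv s" b] bc by simp
  \<comment> \<open>If the projection of \<open>bv s\<close> is the multiple \<open>c\<close> of
    \<open>bv s\<close>, then \<open>c\<close> is 0 or 1; these are the two alternatives.\<close>
  then have "cinner (bv s - b) b = (1 - c) * cnj c" by (simp add: cinner_simps(3) sb left_diff_distrib)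
  then have "(1 - c) * cnj c = 0" using b(2)[OF b(1)] by simp
  then consider "c = 0" | "c = 1" by auto
  then show ?thesis
  proof cases
    case 1
    then have "b = 0" using bc by simp
    have "coord (x (bv 0)) s = 0" if "x \<in> P" for x
    proof -
      have "cinner (bv s) (x (bv 0)) = 0" using b(2)[of "x (bv 0)"] S(3) that \<open>b = 0\<close> by auto
      then show ?thesis using cinner_commute[of "x (bv 0)" "bv s"] by (simp add: cinner_bv)
    qed
    then show ?thesis by blast
  next
    case 2
    then have "bv s \<in> S" using bc b(1) by simp
    then have "lam s \<in> bicommut P"
      using bicommutI_vector[OF P(2) lam_Lvn, of s] by (simp add: S_def)
    then show ?thesis using P(1) by (simp add: vna_def)
  qed
qed

text \<open>After truncation to \<open>F\<close> only fixed points of \<open>A\<close> contribute to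
  the inner product, with nonnegative terms, since the other points of \<open>F\<close> are moved
  out of \<open>F\<close>. The full inner product vanishes, so this sum is bounded by two cross
  terms with the small remainder, whence the factor 2.\<close>

lemma cinner_self_perm_bound:
  assumes A: "bij A" and F: "finite F" "\<And>h. h \<in> F \<Longrightarrow> A h \<in> F \<Longrightarrow> A h = h"
    and h0: "h0 \<in> F" "A h0 = h0" and zero: "cinner x (pm A x) = 0"
  shows "(cmod (coord x h0))\<^sup>2 \<le> 2 * norm (x - cut F x) * norm x"
proof -
  define a where "a = cut F x"
  define b where "b = x - a"
  have x: "x = a + b" by (simp add: b_def)
  have na: "norm a \<le> norm x"
  proof -
    have "(\<Sum>\<^sub>\<infinity>g. (cmod (coord a g))\<^sup>2) \<le> (\<Sum>\<^sub>\<infinity>g. (cmod (coord x g))\<^sup>2)"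
      by (intro infsum_mono coord_summable) (auto simp: a_def)
    then show ?thesis by (simp add: norm_l2_eq)
  qed
  have "cinner a (pm A a) = (\<Sum>g\<in>F. coord a g * cnj (coord a (A g)))"
  proof -
    have "cinner a (pm A a) = (\<Sum>\<^sub>\<infinity>g\<in>F. coord a g * cnj (coord (pm A a) g))"
      unfolding cinner_def by (rule infsum_cong_neutral) (auto simp: a_def)
    then show ?thesis using F(1) by (simp add: coord_pm[OF A])
  qed
  also have "\<dots> = (\<Sum>g\<in>F. of_real (if A g = g then (cmod (coord x g))\<^sup>2 else 0))"
    using F(2) by (intro sum.cong) (auto simp: a_def mult_cnj_cmod)
  finally have aa: "cinner a (pm A a) = of_real (\<Sum>g\<in>F. if A g = g then (cmod (coord x g))\<^sup>2 else 0)" by simp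
  have "(cmod (coord x h0))\<^sup>2 = (\<Sum>g\<in>{h0}. if A g = g then (cmod (coord x g))\<^sup>2 else 0)" using h0 by simp
  also have "\<dots> \<le> (\<Sum>g\<in>F. if A g = g then (cmod (coord x g))\<^sup>2 else 0)"
    using F(1) h0 by (intro sum_mono2) auto
  also have "\<dots> = cmod (cinner a (pm A a))" by (simp add: aa sum_nonneg del: of_real_sum)
  also have "cinner a (pm A a) = - (cinner a (pm A b) + cinner b (pm A x))"
  proof -
    have "cinner x (pm A x) = cinner a (pm A a) + (cinner a (pm A b) + cinner b (pm A x))"
      using cbl_add[OF cbl_pm[OF A], of a b] x by (simp add: cinner_simps(1)[of a b, folded x]) (simp add: cinner_simps)
    then show ?thesis using zero by (simp only: eq_neg_iff_add_eq_0)
  qed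
  also have "cmod (- (cinner a (pm A b) + cinner b (pm A x))) \<le> norm a * norm b + norm b * norm x"
    using norm_triangle_ineq[of "cinner a (pm A b)" "cinner b (pm A x)"]
      cinner_Cauchy_Schwarz[of a "pm A b"] cinner_Cauchy_Schwarz[of b "pm A x"]
    by (simp only: norm_minus_cancel norm_pm[OF A])
  also have "\<dots> \<le> norm x * norm b + norm b * norm x" by (intro add_right_mono mult_right_mono na) simp
  finally show ?thesis by (simp add: b_def a_def mult_ac)
qed

lemma cut_approx_superset:
  assumes "e > 0" obtains F where "finite F" "h \<in> F" "norm (x - cut F x) < e"
proof -
  obtain F where F: "finite F" "norm (x - cut F x) < e" using cut_approx[OF assms] .
  have "(\<Sum>\<^sub>\<infinity>g. (cmod (coord (x - cut (insert h F) x) g))\<^sup>2) \<le> (\<Sum>\<^sub>\<infinity>g. (cmod (coord (x - cut F x) g))\<^sup>2)"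
    by (intro infsum_mono coord_summable) auto
  then have "norm (x - cut (insert h F) x) \<le> norm (x - cut F x)" by (simp only: norm_l2_eq) simp
  then show ?thesis using that[of "insert h F"] F by simp
qed

text \<open>Substituting \<open>l = - a + c\<close> in the convolution turns the coefficient at
  \<open>c\<close> into the inner product of the vector of \<open>x\<close> with a permuted copy of
  itself. The permutation takes \<open>h\<close> to \<open>h'\<close> exactly when
  \<open>h + \<sigma> = c + \<sigma> + h'\<close>.\<close>

lemma coord_commutator_product:
  assumes x: "x \<in> Lvn"
  shows "bij (\<lambda>a. - \<sigma> + (- c + a) + \<sigma>)"
    "coord ((x \<circ> (lam \<sigma> \<circ> adjo x \<circ> lam (- \<sigma>))) (bv 0)) c = cinner (x (bv 0)) (pm (\<lambda>a. - \<sigma> + (- c + a) + \<sigma>) (x (bv 0)))"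
proof -
  let ?\<xi> = "x (bv 0)" and ?A = "\<lambda>a. - \<sigma> + (- c + a) + \<sigma>" and ?l = "\<lambda>a. - a + c"
  show A: "bij ?A"
    by (rule bij_betw_byWitness[of _ "\<lambda>a. c + (\<sigma> + a + - \<sigma>)"]) (auto simp: add.assoc simp del: add_uminus_conv_diff)
  have l: "bij ?l"
    by (rule bij_betw_byWitness[of _ "\<lambda>l. c + - l"])
      (auto simp: diff_conv_add_uminus minus_add add.assoc simp del: add_uminus_conv_diff)
  have ax: "adjo x \<in> Lvn" using vna_Lvn x by (auto simp: vna_def)
  have star: "coord (adjo x (bv 0)) m = cnj (coord ?\<xi> (- m))" for m
  proof -
    have "coord (adjo x (bv 0)) m = cnj (coord (x (bv m)) 0)"
      unfolding coord_adjo[OF Lvn_cbl[OF x]] by (subst cinner_commute) (simp add: cinner_bv)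
    then show ?thesis using Lvn_bv[OF x, of m] by simp
  qed
  let ?z = "(lam \<sigma> \<circ> adjo x \<circ> lam (- \<sigma>)) (bv 0)"
  have z: "coord ?z l = cnj (coord ?\<xi> (- (- \<sigma> + l + \<sigma>)))" for l
    unfolding coord_conj[OF ax] star ..
  have "coord ((x \<circ> (lam \<sigma> \<circ> adjo x \<circ> lam (- \<sigma>))) (bv 0)) c = cinner ?z (flip c ?\<xi>)"
    using Lvn_coord[OF x, of ?z c] by simp
  also have "\<dots> = (\<Sum>\<^sub>\<infinity>l. cnj (coord ?\<xi> (- (- \<sigma> + l + \<sigma>))) * coord ?\<xi> (c - l))"
    by (simp add: cinner_def z coord_flip del: comp_apply minus_add_distrib)
  also have "\<dots> = (\<Sum>\<^sub>\<infinity>a. cnj (coord ?\<xi> (- (- \<sigma> + (- a + c) + \<sigma>))) * coord ?\<xi> (c - (- a + c)))"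
    using infsum_reindex_bij_betw[OF l, of "\<lambda>l. cnj (coord ?\<xi> (- (- \<sigma> + l + \<sigma>))) * coord ?\<xi> (c - l)"] by simp
  also have "\<dots> = cinner ?\<xi> (pm ?A ?\<xi>)"
    unfolding cinner_def coord_pm[OF A]
    by (intro infsum_cong) (simp add: diff_conv_add_uminus minus_add add.assoc mult.commute del: add_uminus_conv_diff)
  finally show "coord ((x \<circ> (lam \<sigma> \<circ> adjo x \<circ> lam (- \<sigma>))) (bv 0)) c = cinner ?\<xi> (pm ?A ?\<xi>)" .
qed

lemma fl_moves_unit_vec:
  assumes "h \<noteq> (0::fl)" shows "\<exists>i. fl_fun h (unit_vec i) \<noteq> unit_vec i"
proof (rule ccontr)
  assume "\<not> ?thesis"
  then have e: "fl_fun h (unit_vec i) = unit_vec i" for i by blast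
  obtain d where d: "supp d (fl_fun h)" using FL_supp fl_fun by blast
  have t: "fl_fun h (trunc c x) = trunc c x" for c x
  proof (induction c)
    case 0
    have "trunc 0 x = 0" by (simp add: trunc_def zero_fun_def)
    then show ?case by (simp only: FL_zero[OF fl_fun])
  next
    case (Suc c)
    have "trunc (Suc c) x = trunc c x + (if x c = 1 then unit_vec c else 0)"
    proof
      fix k show "trunc (Suc c) x k = (trunc c x + (if x c = 1 then unit_vec c else 0)) k"
        by (cases "x c") (auto simp: trunc_def unit_vec_def plus_fun_def less_Suc_eq)
    qed
    then show ?case using Suc by (simp only: FL_linear[OF fl_fun]) (simp add: e FL_zero[OF fl_fun])
  qed
  have "fl_fun h x = x" for x
    using supp_trunc[OF fl_fun d, of x] t[of d x] by (simp add: add.left_commute[of "trunc d x"])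
  then show False using assms by (metis fl_eqI fl_fun_simps(1) id_apply)
qed

theorem fl_invariant_algebras:
  fixes P :: "(fl l2 \<Rightarrow> fl l2) set"
  assumes P: "vna P" "P \<subseteq> Lvn" "\<And>g T. T \<in> P \<Longrightarrow> lam g \<circ> T \<circ> lam (- g) \<in> P"
  shows "P = Lvn \<or> P = bicommut {lam 0}"
proof (cases "\<exists>i j. i \<noteq> j \<and> lam (tv (unit_vec i) j) \<in> P")
  case True
  then obtain i j where ij: "i \<noteq> j" "lam (tv (unit_vec i) j) \<in> P" by blast
  define N where "N = {g. lam g \<in> P}"
  have lam_add: "lam g \<circ> lam h = lam (g + h)" for g h :: fl by (simp add: fun_eq_iff)
  have "g \<in> N" for g
  proof (rule normal_closure_transvection[of N i j])
    have "lam (0::fl) = (\<lambda>a. a)" by (simp add: fun_eq_iff)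
    then show "0 \<in> N" using vna_id[OF P(1)] by (simp add: N_def)
    show "x + y \<in> N" if "x \<in> N" "y \<in> N" for x y
      using vna_comp[OF P(1), of "lam x" "lam y"] that by (simp add: N_def lam_add)
    show "- x \<in> N" if "x \<in> N" for x
      using that P(1) by (auto simp: N_def vna_def adjo_lam[symmetric])
    show "g + x - g \<in> N" if "x \<in> N" for g x
      using P(3)[of "lam x" g] that by (simp add: N_def lam_add)
  qed (use ij in \<open>auto simp: N_def\<close>)
  then have "range lam \<subseteq> P" by (auto simp: N_def)
  then have "Lvn \<subseteq> P" using vna_bicommut_subset[OF P(1)] bicommut_lam by blast
  then show ?thesis using P(2) by blast
next
  case False
  have z: "coord (x (bv 0)) (tv (unit_vec i) j) = 0" if ij: "i \<noteq> j" and "x \<in> P" for i j x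
  proof -
    have "unit_vec i \<noteq> 0"
    proof
      assume "unit_vec i = 0"
      then have "unit_vec i i = 0" by (simp only: zero_fun_def)
      then show False by (simp add: unit_vec_def)
    qed
    then have "tv (unit_vec i) j \<noteq> 0" using tv_eq_0[of "unit_vec i" j] unit_vec_bounded_zero[OF ij] by blast
    from invariant_dichotomy[OF P this transvection_centralizer_orbit[OF ij]] show ?thesis
      using False that by blast
  qed
  \<comment> \<open>Every nontrivial transvection is conjugate to an elementary one, so invariance
    of \<open>P\<close> spreads the vanishing.\<close>
  have zc: "coord (x (bv 0)) (tv v N) = 0" if v: "bounded_supp v" "v N = 0" "v \<noteq> 0" and x: "x \<in> P" for v N x
  proof -
    obtain k where k: "v k \<noteq> 0" using v(3) by (auto simp: fun_eq_iff zero_fun_def)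
    then have kN: "k \<noteq> N" using v(2) by auto
    obtain g where g: "tv v N = g + tv (unit_vec k) N - g" using tv_as_conj[OF v(1,2) k] by blast
    have "lam (- g) \<circ> x \<circ> lam (- (- g)) \<in> P" by (rule P(3)[OF x])
    from z[OF kN this] have "coord (x (bv 0)) (- (- g) + tv (unit_vec k) N + - g) = 0"
      using coord_conj[of x "- g"] x P(2) by (simp only: subset_iff)
    then show ?thesis by (simp add: g)
  qed
  have van: "coord (x (bv 0)) h0 = 0" if x: "x \<in> P" and h0: "h0 \<noteq> 0" for x h0
  proof -
    let ?\<xi> = "x (bv 0)"
    have xL: "x \<in> Lvn" using x P(2) by blast
    have bound: "(cmod (coord ?\<xi> h0))\<^sup>2 \<le> 2 * e * norm ?\<xi>" if e: "e > 0" for e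
    proof -
      obtain F where F: "finite F" "h0 \<in> F" "norm (?\<xi> - cut F ?\<xi>) < e" using cut_approx_superset[OF e] .
      obtain i where i: "fl_fun h0 (unit_vec i) \<noteq> unit_vec i" using fl_moves_unit_vec[OF h0] by blast
      obtain d where d: "\<And>h. h \<in> F \<Longrightarrow> supp (d h) (fl_fun h)" using FL_supp[OF fl_fun] by metis
      \<comment> \<open>A column beyond \<open>i\<close> and the supports of all elements of
        \<open>F\<close>: these neither move \<open>unit_vec N\<close> nor change coordinate
        \<open>N\<close>.\<close>
      define N where "N = Suc (i + (\<Sum>h\<in>F. d h))"
      have sN: "supp N (fl_fun h)" if h: "h \<in> F" for h
      proof -
        have "d h \<le> (\<Sum>h\<in>F. d h)" using F(1) h by (intro member_le_sum) auto
        then show ?thesis using supp_mono[OF d[OF h], of N] by (simp add: N_def)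
      qed
      have fixN: "fl_fun h y N = y N" if "h \<in> F" for h y using sN[OF that] by (simp add: supp_def)
      have eN: "fl_fun h (unit_vec N) = unit_vec N" if "h \<in> F" for h
        using sN[OF that] by (simp add: supp_def unit_vec_def)
      have iN: "i \<noteq> N" by (simp add: N_def)
      \<comment> \<open>Conjugating the transvection along \<open>unit_vec i\<close> in column
        \<open>N\<close> by \<open>h0\<close> applies \<open>h0\<close> to the vector. The
        commutator is thus again a transvection, along \<open>v\<close>, and \<open>zc\<close>
        applies to it.\<close>
      define v where "v = fl_fun h0 (unit_vec i) + unit_vec i"
      have "unit_vec i k = 0" if "k \<ge> N" for k using that by (auto simp: unit_vec_def N_def)
      then have vk: "v k = 0" if "k \<ge> N" for k
        using that sN[OF F(2)] by (simp add: v_def plus_fun_def supp_def)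
      then have vb: "bounded_supp v" "v N = 0" unfolding bounded_supp_def by auto
      have v0: "v \<noteq> 0"
      proof
        assume "v = 0"
        then have "fl_fun h0 (unit_vec i) + unit_vec i + unit_vec i = unit_vec i" by (simp add: v_def)
        then show False using i by (simp add: add.assoc)
      qed
      define \<sigma> where "\<sigma> = tv (unit_vec i) N"
      define c where "c = tv v N"
      have f\<sigma>: "fl_fun \<sigma> y = y + (if y N = 1 then unit_vec i else 0)" for y
        unfolding \<sigma>_def using unit_vec_bounded_zero[OF iN] by (simp add: fl_fun_tv tau_alt)
      have fc: "fl_fun c y = y + (if y N = 1 then v else 0)" for y
        unfolding c_def by (simp add: fl_fun_tv[OF vb] tau_alt)
      have left: "fl_fun (h + \<sigma>) y = fl_fun h y + (if y N = 1 then fl_fun h (unit_vec i) else 0)" for h y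
        by (simp add: fl_fun_add f\<sigma> FL_linear[OF fl_fun] FL_zero[OF fl_fun])
      have right: "fl_fun (c + \<sigma> + h) y = fl_fun h y + (if y N = 1 then fl_fun h0 (unit_vec i) else 0)"
        if h: "h \<in> F" for h y
      proof -
        have "fl_fun \<sigma> (fl_fun h y) N = y N"
          using iN by (simp add: f\<sigma> fixN[OF h] plus_fun_def) (simp add: unit_vec_def)
        then have 1: "fl_fun (c + \<sigma> + h) y = fl_fun \<sigma> (fl_fun h y) + (if y N = 1 then v else 0)"
          by (simp add: fl_fun_add fc)
        have 2: "fl_fun \<sigma> (fl_fun h y) = fl_fun h y + (if y N = 1 then unit_vec i else 0)"
          by (simp add: f\<sigma> fixN[OF h])
        show ?thesis by (subst 1, subst 2) (simp add: v_def add.assoc add.commute[of "unit_vec i"])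
      qed
      let ?A = "\<lambda>a. - \<sigma> + (- c + a) + \<sigma>"
      have A_iff: "?A h = h' \<longleftrightarrow> h + \<sigma> = c + \<sigma> + h'" for h h'
      proof
        assume "?A h = h'"
        then have "c + \<sigma> + (- \<sigma> + (- c + h) + \<sigma>) = c + \<sigma> + h'" by simp
        then show "h + \<sigma> = c + \<sigma> + h'" by (simp add: add.assoc)
      next
        assume "h + \<sigma> = c + \<sigma> + h'"
        then have "- \<sigma> + (- c + (h + \<sigma>)) = - \<sigma> + (- c + (c + \<sigma> + h'))" by simp
        then show "?A h = h'" by (simp add: add.assoc)
      qed
      have "coord ((x \<circ> (lam \<sigma> \<circ> adjo x \<circ> lam (- \<sigma>))) (bv 0)) c = 0"
        unfolding c_def
      proof (rule zc[OF vb v0])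
        have "adjo x \<in> P" using P(1) x by (auto simp: vna_def)
        then show "x \<circ> (lam \<sigma> \<circ> adjo x \<circ> lam (- \<sigma>)) \<in> P" by (intro vna_comp[OF P(1)] x P(3))
      qed
      then have zero: "cinner ?\<xi> (pm ?A ?\<xi>) = 0" using coord_commutator_product(2)[OF xL] by simp
      have "(cmod (coord ?\<xi> h0))\<^sup>2 \<le> 2 * norm (?\<xi> - cut F ?\<xi>) * norm ?\<xi>"
      proof (rule cinner_self_perm_bound[OF coord_commutator_product(1)[OF xL] F(1) _ F(2) _ zero])
        show "?A h0 = h0" unfolding A_iff by (rule fl_eqI) (simp only: left right[OF F(2)])
        fix h assume h: "h \<in> F" "?A h \<in> F"
        define h' where "h' = ?A h"
        have h': "h' \<in> F" using h(2) by (simp add: h'_def)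
        \<comment> \<open>The two products differ from \<open>h\<close> and \<open>h'\<close> in
          column \<open>N\<close> only, so \<open>h\<close> and \<open>h'\<close> agree on vectors
          with coordinate 0 at \<open>N\<close>; both fix \<open>unit_vec N\<close>, hence they are
          equal.\<close>
        have eq: "fl_fun h y + (if y N = 1 then fl_fun h (unit_vec i) else 0)
            = fl_fun h' y + (if y N = 1 then fl_fun h0 (unit_vec i) else 0)" for y
          using A_iff[of h h'] left[of h y] right[OF h', of y] by (simp add: h'_def)
        have low: "fl_fun h y = fl_fun h' y" if "y N = 0" for y using eq[of y] that by simp
        have "fl_fun h y = fl_fun h' y" for y
        proof (cases "y N = 0")
          case False
          have "(y + unit_vec N) N = 0" using False by (simp add: plus_fun_def unit_vec_def)
          from low[of "y + unit_vec N", OF this] have "fl_fun h y + unit_vec N = fl_fun h' y + unit_vec N"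
            by (simp add: FL_linear[OF fl_fun] eN h h')
          then show ?thesis by simp
        qed (rule low)
        then have "h = h'" by (rule fl_eqI)
        then show "?A h = h" by (simp add: h'_def)
      qed
      also have "\<dots> \<le> 2 * e * norm ?\<xi>" using F(3) by (intro mult_right_mono) auto
      finally show ?thesis .
    qed
    have "(cmod (coord ?\<xi> h0))\<^sup>2 \<le> 0"
    proof (rule field_le_epsilon)
      fix e :: real assume e: "e > 0"
      \<comment> \<open>The truncation error is chosen relative to the norm of the vector; the added
        1 keeps the denominator positive.\<close>
      have "(cmod (coord ?\<xi> h0))\<^sup>2 \<le> 2 * (e / (2 * (norm ?\<xi> + 1))) * norm ?\<xi>"
        by (rule bound) (use e in \<open>simp add: add_nonneg_pos\<close>)
      also have "\<dots> = e * (norm ?\<xi> / (norm ?\<xi> + 1))"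
      proof -
        have "norm ?\<xi> + 1 \<noteq> 0" using norm_ge_zero[of ?\<xi>] by linarith
        then show ?thesis by (simp add: divide_simps)
      qed
      also have "\<dots> \<le> e * 1" using e by (intro mult_left_mono) (simp_all add: divide_le_eq_1 add_nonneg_pos)
      finally show "(cmod (coord ?\<xi> h0))\<^sup>2 \<le> 0 + e" by simp
    qed
    then show ?thesis by simp
  qed
  have one: "lam (0::fl) = (\<lambda>a. a)" by (simp add: fun_eq_iff)
  have bc: "vna (bicommut {lam (0::fl)})" by (rule vna_bicommut) (auto simp: adjo_lam)
  have "x \<in> bicommut {lam 0}" if x: "x \<in> P" for x
  proof -
    have "x (bv 0) = coord (x (bv 0)) 0 *\<^sub>C bv 0" using van[OF x] by (intro l2_eqI) (auto simp: coord_bv)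
    then have "x = (\<lambda>a. coord (x (bv 0)) 0 *\<^sub>C a)"
      using x P(2) vna_cmult[OF vna_Lvn vna_id[OF vna_Lvn]] by (intro Lvn_eqI) auto
    then show ?thesis using vna_cmult[OF bc vna_id[OF bc]] by metis
  qed
  moreover have "bicommut {lam 0} \<subseteq> P"
    using vna_bicommut_subset[OF P(1)] vna_id[OF P(1)] by (simp add: one)
  ultimately show ?thesis by blast
qed

theorem ISR_fl:
  assumes "group_transport (e :: 'b \<Rightarrow> fl) G" shows "ISR G"
  unfolding ISR_def
proof (intro allI impI)
  interpret group_transport e G by fact
  interpret group G by (rule group_G)
  fix P assume inv: "invariant_subalgebra G P"
  then obtain Q where Q: "P = opn ` Q" "Q \<subseteq> Collect cbl" using invariant_subalgebraE by blast
  then have "vna Q" "Q \<subseteq> Lvn" "\<And>g T. T \<in> Q \<Longrightarrow> lam g \<circ> T \<circ> lam (- g) \<in> Q"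
    using inv invariant_subalgebra_opn[OF Q(2)] by auto
  then have "Q = Lvn \<or> Q = bicommut {lam 0}" by (rule fl_invariant_algebras)
  then show "\<exists>N. N \<lhd> G \<and> P = vn_of_subgroup G N"
  proof
    assume "Q = Lvn"
    then have "P = vn_of_subgroup G (carrier G)" using group_vn_opn Q(1) by (simp add: group_vn_def)
    moreover have "carrier G \<lhd> G" by (rule normal_invI[OF subgroup_self]) simp
    ultimately show ?thesis by blast
  next
    assume "Q = bicommut {lam 0}"
    then have "P = vn_of_subgroup G {\<one>\<^bsub>G\<^esub>}"
      using vn_of_subgroup_opn[of "{\<one>\<^bsub>G\<^esub>}"] Q(1) by (simp add: e_one)
    then show ?thesis using one_is_normal by blast
  qed
qed

theorem corollary1p2:
  shows "\<exists>(G :: nat monoid) (H :: nat monoid).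
    group G \<and> countable (carrier G) \<and> group H \<and> countable (carrier H) \<and>
    Wstar_equivalent G H \<and>
    ((ISR G \<and> \<not> ISR H) \<or> (\<not> ISR G \<and> ISR H))"
proof -
  obtain e :: "nat \<Rightarrow> fl" and G where G: "group_transport e G"
    using nat_carrier[OF countable_fl infinite_fl] by blast
  obtain e' :: "nat \<Rightarrow> al" and H where H: "group_transport e' H"
    using nat_carrier[OF countable_al infinite_al] by blast
  have "group G" "group H"
    using group_transport.group_G[OF G] group_transport.group_G[OF H] by simp_all
  moreover have "Wstar_equivalent G H" by (rule Wstar_fl_al[OF G H])
  ultimately show ?thesis
    using ISR_fl[OF G] not_ISR_al[OF H] by (meson countableI_type)
qed

end
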